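(* Let $(I,(X_i,G_i),F_{ij})$ be an inverse system of spaces of orderings and let $(X,G)=\varprojlim (X_i,G_i)$ be its inverse limit. If, for all $i\in I$, the pp conjecture holds in $(X_i,G_i)$, then the pp conjecture holds in $(X,G)$.
   Context: **Spaces of orderings (Marshall).** A space of orderings is a pair $(X,G)$ satisfying the following axioms. (AX1) $X$ is a nonempty set, and $G$ is a subgroup of $\{1,-1\}^X$ (pointwise multiplication) which contains the constant function $-1$ and separates points of $X$ (if $x\neq y$ in $X$, there is $a\in G$ with $a(x)\ne a(y)$). For $a,b\in G$ the value set is $$D_X(a,b)=\{c\in G:\ \forall x\in X\ (a(x)=c(x)\ \vee\ b(x)=c(x))\}.$$ $X$ embeds naturally in the character group $\chi(G)$ of all group homomorphisms $G\to\{-1,1\}$ by identifying $x\in X$ with the character $a\mapsto a(x)$. (AX2) If $x\in\chi(G)$ satisfies $x(-1)=-1$ and, for all $a,b\in\ker(x)$, $D_X(a,b)\subset\ker(x)$, then $x$ lies in the image of $X$ under the natural embedding. (AX3) For all $a_1,a_2,a_3\in G$, if $b\in D_X(a_1,c)$ for some $c\in D_X(a_2,a_3)$, then $b\in D_X(d,a_3)$ for some $d\in D_X(a_1,a_2)$. **Morphisms.** A morphism $F:(X_1,G_1)\to(X_2,G_2)$ of spaces of orderings is a function $F:X_1\to X_2$ such that $b\circ F\in G_1$ for all $b\in G_2$. **Inverse systems and limits.** An inverse system of spaces of orderings consists of a directed set $(I,\succeq)$, spaces of orderings $(X_i,G_i)$ for $i\in I$, and morphisms $F_{ij}:(X_i,G_i)\to(X_j,G_j)$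 for $i\succeq j$, such that $F_{ii}=\mathrm{id}$, $F_{ij}(X_i)=X_j$ for all $i\succeq j$, and $F_{ik}=F_{jk}\circ F_{ij}$ for $i\succeq j\succeq k$. Surjectivity of $F_{ij}$ makes $F_{ij}^*:G_j\to G_i$, $b\mapsto b\circ F_{ij}$, injective. The inverse limit $\varprojlim(X_i,G_i)$ is $(X,G)$, where $X=\varprojlim X_i$ is the inverse limit of the sets $X_i$ along the $F_{ij}$, with projections $\pi_i:X\to X_i$, and $G=\varinjlim G_i$ is the direct limit along the $F_{ij}^*$, realized as the group of functions $a\circ\pi_i$ on $X$ with $i\in I$, $a\in G_i$. It is again a space of orderings. **Subspaces.** For $a\in G$ let $H_X(a)=\{x\in X: a(x)=1\}$. A (nonempty) subset $Y\subset X$ is a subspace of $(X,G)$ if $Y=\bigcap_{a\in S}H_X(a)$ for some subset $S\subset G$. With $G|_Y=\{a|_Y: a\in G\}$, the pair $(Y,G|_Y)$ is again a space of orderings. A subspace is finite if $Y$ is a finite set. **pp formulas.** For a space of orderings $(X,G)$, a positive primitive (pp) formula with $n$ quantifiers and $k$ parameters in $G$ is a formula $$P(\underline a)=\exists\,\underline t\ \bigwedge_{j=1}^m\ p_j(\underline t,\underline a)\in D_X(1,q_j(\underline t,\underline a)),$$ where $\underline t=(t_1,\dots,t_n)$ ranges over $G^n$, $\underline a=(a_1,\dots,a_k)$ with $a_1,\dots,a_k\in G$, and for each $j\in\{1,\dots,m\}$ the expressions $p_j(\underline t,\underline a)$ and $q_j(\underline t,\underline a)$ are $\pm$ products of some of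 the $t_i$'s and $a_l$'s, $i\in\{1,\dots,n\}$, $l\in\{1,\dots,k\}$. The formula $P(\underline a)$ in a subspace $Y$ is obtained by replacing each atom by $p_j(\underline t,\underline a)|_Y\in D_Y(1,q_j(\underline t,\underline a)|_Y)$, where $D_Y$ is the value set computed in $(Y,G|_Y)$. **The pp conjecture.** The pp conjecture holds in a space of orderings $(X,G)$ if every pp formula $P(\underline a)$ with parameters in $G$ that holds in every finite subspace of $(X,G)$ also holds in $(X,G)$. *)

theory Defs
  imports "HOL-Algebra.Product_Groups" "HOL-Algebra.Sym_Groups"
begin

section \<open>Spaces of orderings\<close>

text \<open>
  \<^const>\<open>sign_img\<close> is the multiplicative group of the integers $1$ and $-1$, so the following is the
  group of all sign functions on \<open>X\<close>. Its elements are extensional: they are \<^const>\<open>undefined\<close>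
  outside \<open>X\<close>, so that equality in it is equality of functions on \<open>X\<close>.
\<close>

definition sign_functions :: "'a set \<Rightarrow> ('a \<Rightarrow> int) monoid" where
  "sign_functions X = product_group X (\<lambda>_. sign_img)"

definition minus_one :: "'a set \<Rightarrow> 'a \<Rightarrow> int" where
  "minus_one X = (\<lambda>x\<in>X. - 1)"

definition value_set ::
    "'a set \<Rightarrow> ('a \<Rightarrow> int) set \<Rightarrow> ('a \<Rightarrow> int) \<Rightarrow> ('a \<Rightarrow> int) \<Rightarrow> ('a \<Rightarrow> int) set" where
  "value_set X G a b = {c \<in> G. \<forall>x\<in>X. a x = c x \<or> b x = c x}"

definition group_on :: "'a set \<Rightarrow> ('a \<Rightarrow> int) set \<Rightarrow> ('a \<Rightarrow> int) monoid" where
  "group_on X G = (sign_functions X)\<lparr>carrier := G\<rparr>"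

locale space_of_orderings =
  fixes X :: "'a set" and G :: "('a \<Rightarrow> int) set"
  assumes nonempty: "X \<noteq> {}"
    and G_subgroup: "subgroup G (sign_functions X)"
    and minus_one_mem: "minus_one X \<in> G"
    and separates: "\<lbrakk>x \<in> X; y \<in> X; x \<noteq> y\<rbrakk> \<Longrightarrow> \<exists>a\<in>G. a x \<noteq> a y"
    and character_in_image:
      "\<lbrakk>\<chi> \<in> hom (group_on X G) sign_img; \<chi> (minus_one X) = - 1;
        \<forall>a\<in>kernel (group_on X G) sign_img \<chi>. \<forall>b\<in>kernel (group_on X G) sign_img \<chi>.
          value_set X G a b \<subseteq> kernel (group_on X G) sign_img \<chi>\<rbrakk>
       \<Longrightarrow> \<exists>x\<in>X. \<forall>a\<in>G. \<chi> a = a x"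
    and weak_associativity:
      "\<lbrakk>a1 \<in> G; a2 \<in> G; a3 \<in> G; c \<in> value_set X G a2 a3; b \<in> value_set X G a1 c\<rbrakk>
       \<Longrightarrow> \<exists>d\<in>value_set X G a1 a2. b \<in> value_set X G d a3"

definition morphism ::
    "'a set \<Rightarrow> ('a \<Rightarrow> int) set \<Rightarrow> 'b set \<Rightarrow> ('b \<Rightarrow> int) set \<Rightarrow> ('a \<Rightarrow> 'b) \<Rightarrow> bool" where
  "morphism X1 G1 X2 G2 F \<longleftrightarrow> F \<in> X1 \<rightarrow> X2 \<and> (\<forall>b\<in>G2. compose X1 b F \<in> G1)"

section \<open>Inverse systems and inverse limits\<close>

text \<open>
  \<open>ge i j\<close> is the relation $i \succeq j$ on the directed set \<open>I\<close>. It is a preorder;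
  antisymmetry is not required.
\<close>

locale inverse_system =
  fixes I :: "'i set" and ge :: "'i \<Rightarrow> 'i \<Rightarrow> bool"
    and X :: "'i \<Rightarrow> 'a set" and G :: "'i \<Rightarrow> ('a \<Rightarrow> int) set"
    and F :: "'i \<Rightarrow> 'i \<Rightarrow> 'a \<Rightarrow> 'a"
  assumes index_nonempty: "I \<noteq> {}"
    and ge_refl: "i \<in> I \<Longrightarrow> ge i i"
    and ge_trans: "\<lbrakk>i \<in> I; j \<in> I; k \<in> I; ge i j; ge j k\<rbrakk> \<Longrightarrow> ge i k"
    and directed: "\<lbrakk>i \<in> I; j \<in> I\<rbrakk> \<Longrightarrow> \<exists>k\<in>I. ge k i \<and> ge k j"
    and spaces: "i \<in> I \<Longrightarrow> space_of_orderings (X i) (G i)"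
    and F_morphism: "\<lbrakk>i \<in> I; j \<in> I; ge i j\<rbrakk> \<Longrightarrow> morphism (X i) (G i) (X j) (G j) (F i j)"
    and F_id: "\<lbrakk>i \<in> I; x \<in> X i\<rbrakk> \<Longrightarrow> F i i x = x"
    and F_surj: "\<lbrakk>i \<in> I; j \<in> I; ge i j\<rbrakk> \<Longrightarrow> F i j ` X i = X j"
    and F_comp: "\<lbrakk>i \<in> I; j \<in> I; k \<in> I; ge i j; ge j k; x \<in> X i\<rbrakk> \<Longrightarrow> F i k x = F j k (F i j x)"

definition limit_points ::
    "'i set \<Rightarrow> ('i \<Rightarrow> 'i \<Rightarrow> bool) \<Rightarrow> ('i \<Rightarrow> 'a set) \<Rightarrow> ('i \<Rightarrow> 'i \<Rightarrow> 'a \<Rightarrow> 'a) \<Rightarrow> ('i \<Rightarrow> 'a) set" where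
  "limit_points I ge X F =
     {x \<in> (\<Pi>\<^sub>E i\<in>I. X i). \<forall>i\<in>I. \<forall>j\<in>I. ge i j \<longrightarrow> F i j (x i) = x j}"

definition limit_group ::
    "'i set \<Rightarrow> ('i \<Rightarrow> 'i \<Rightarrow> bool) \<Rightarrow> ('i \<Rightarrow> 'a set) \<Rightarrow> ('i \<Rightarrow> ('a \<Rightarrow> int) set) \<Rightarrow>
     ('i \<Rightarrow> 'i \<Rightarrow> 'a \<Rightarrow> 'a) \<Rightarrow> (('i \<Rightarrow> 'a) \<Rightarrow> int) set" where
  "limit_group I ge X G F =
     {compose (limit_points I ge X F) a (\<lambda>x. x i) | i a. i \<in> I \<and> a \<in> G i}"

section \<open>Subspaces\<close>

definition positive_set :: "'a set \<Rightarrow> ('a \<Rightarrow> int) \<Rightarrow> 'a set" where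
  "positive_set X a = {x \<in> X. a x = 1}"

text \<open>The intersection with \<open>X\<close> makes the empty family \<open>S\<close> define the whole space.\<close>

definition ordering_subspace :: "'a set \<Rightarrow> ('a \<Rightarrow> int) set \<Rightarrow> 'a set \<Rightarrow> bool" where
  "ordering_subspace X G Y \<longleftrightarrow>
     Y \<noteq> {} \<and> (\<exists>S\<subseteq>G. Y = X \<inter> (\<Inter>a\<in>S. positive_set X a))"

definition restrict_group :: "('a \<Rightarrow> int) set \<Rightarrow> 'a set \<Rightarrow> ('a \<Rightarrow> int) set" where
  "restrict_group G Y = (\<lambda>a. restrict a Y) ` G"

section \<open>Positive primitive formulas\<close>

text \<open>
  \<open>PP_Prod s T A\<close> stands for the product of the sign \<open>s\<close>, the \<open>t i\<close> with \<open>i \<in> T\<close>, and the \<open>a l\<close>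
  with \<open>l \<in> A\<close>. Index sets suffice, since every element of the group squares to $1$.
  Indices start at 0.
\<close>

datatype pp_prod = PP_Prod int "nat set" "nat set"

text \<open>An atom \<open>(p, q)\<close> stands for $p \in D(1, q)$, and a list of atoms for their conjunction.\<close>

type_synonym pp_matrix = "(pp_prod \<times> pp_prod) list"

fun pp_prod_wf :: "nat \<Rightarrow> nat \<Rightarrow> pp_prod \<Rightarrow> bool" where
  "pp_prod_wf n k (PP_Prod s T A) \<longleftrightarrow> s \<in> {1, - 1} \<and> T \<subseteq> {..<n} \<and> A \<subseteq> {..<k}"

definition pp_formula :: "nat \<Rightarrow> nat \<Rightarrow> pp_matrix \<Rightarrow> bool" where
  "pp_formula n k P \<longleftrightarrow> (\<forall>(p, q)\<in>set P. pp_prod_wf n k p \<and> pp_prod_wf n k q)"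

fun pp_value ::
    "'a set \<Rightarrow> (nat \<Rightarrow> 'a \<Rightarrow> int) \<Rightarrow> (nat \<Rightarrow> 'a \<Rightarrow> int) \<Rightarrow> pp_prod \<Rightarrow> 'a \<Rightarrow> int" where
  "pp_value X t a (PP_Prod s T A) = (\<lambda>x\<in>X. s * (\<Prod>i\<in>T. t i x) * (\<Prod>l\<in>A. a l x))"

definition pp_holds ::
    "'a set \<Rightarrow> ('a \<Rightarrow> int) set \<Rightarrow> nat \<Rightarrow> pp_matrix \<Rightarrow> (nat \<Rightarrow> 'a \<Rightarrow> int) \<Rightarrow> bool" where
  "pp_holds X G n P a \<longleftrightarrow>
     (\<exists>t. (\<forall>i<n. t i \<in> G) \<and>
       (\<forall>(p, q)\<in>set P.
          pp_value X t a p \<in> value_set X G \<one>\<^bsub>sign_functions X\<^esub> (pp_value X t a q)))"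

definition pp_holds_in_subspace ::
    "'a set \<Rightarrow> ('a \<Rightarrow> int) set \<Rightarrow> 'a set \<Rightarrow> nat \<Rightarrow> pp_matrix \<Rightarrow> (nat \<Rightarrow> 'a \<Rightarrow> int) \<Rightarrow> bool" where
  "pp_holds_in_subspace X G Y n P a \<longleftrightarrow>
     (\<exists>t. (\<forall>i<n. t i \<in> G) \<and>
       (\<forall>(p, q)\<in>set P.
          restrict (pp_value X t a p) Y
            \<in> value_set Y (restrict_group G Y) \<one>\<^bsub>sign_functions Y\<^esub>
                (restrict (pp_value X t a q) Y)))"

definition pp_conjecture :: "'a set \<Rightarrow> ('a \<Rightarrow> int) set \<Rightarrow> bool" where
  "pp_conjecture X G \<longleftrightarrow>
     (\<forall>n k P a. pp_formula n k P \<longrightarrow> (\<forall>l<k. a l \<in> G) \<longrightarrow>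
        (\<forall>Y. ordering_subspace X G Y \<and> finite Y \<longrightarrow> pp_holds_in_subspace X G Y n P a) \<longrightarrow>
        pp_holds X G n P a)"

end

theory Submission
  imports Defs "HOL-Library.Function_Algebras"
begin

text \<open>
  A formula that fails on a finite space of orderings already fails on at most $2^d$ points of it,
  where \<open>d\<close> is the number of all formulas with the same numbers of quantifiers and parameters that fail.
  Indeed, a finite space with more than one point either is a direct sum, or is carried to itself by
  a nontrivial character. A formula holds in a direct sum if it holds in both summands; in the
  second case it holds in the space if it and a sign-twisted copy of it hold in the quotient, which embeds as
  a proper subspace. Thus one descends to proper subspaces with fewer failing formulas, or with the
  same failing formulas.

  Now let a formula fail in the inverse limit. Then it fails in every \<open>X i\<close> with \<open>i\<close> large, hence on
  some finite subspace of \<open>X i\<close>, hence on at most \<open>N\<close> points of \<open>X i\<close>, with \<open>N\<close> independent of \<open>i\<close>. An ultralimit of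
  these \<open>N\<close>-tuples gives \<open>N\<close> points of the limit on which the formula fails, and they span a finite subspace.

  The decomposition of a finite space \<open>X\<close> is proved by induction. Let \<open>Y\<close> be maximal among the proper
  subspaces that are not direct sums. If \<open>X\<close> is not a direct sum either, then in each configuration of \<open>Y\<close> and
  its complement either \<open>X\<close> has a translation, or one exhibits four elements of \<open>G\<close> that violate
  the associativity axiom (AX3).
\<close>

section \<open>Sign spaces\<close>

text \<open>The obstacle is uniformity. At level \<open>i\<close> the conjecture supplies a finite
  subspace of uncontrolled size, and only tuples of a fixed length have ultralimits, so the size
  bound must depend on the shape of the formula alone. Induction on a single formula cannot provide
  it: the quotient by a translation \<open>\<alpha>\<close> brings in a copy twisted by the signs
  \<open>\<alpha> (t i)\<close> of an unknown solution \<open>t\<close>. The formulas with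
  \<open>n\<close> quantifiers and \<open>k\<close> parameters are finitely many and closed under
  these twists, so the set of those that fail is used as the induction measure. Each doubling of the
  point set is paid for by a strict drop of this measure.

  The decomposition of finite spaces is Marshall's structure theorem; a translation exhibits the
  space as a group extension. Its conflicts with (AX3) all have one shape, \<open>exchange\<close>:
  (AX3) is read as a statement on sets of negative points, where suitable \<open>A\<close>,
  \<open>B\<close>, \<open>C\<close>, \<open>K\<close> force into \<open>G\<close> an element
  \<open>D\<close> that cannot be there.\<close>

locale sign_group =
  fixes X :: "'a set" and G :: "('a \<Rightarrow> int) set"
  assumes sign: "\<lbrakk>a \<in> G; x \<in> X\<rbrakk> \<Longrightarrow> a x = 1 \<or> a x = - 1"
    and one: "1 \<in> G"
    and mult: "\<lbrakk>a \<in> G; b \<in> G\<rbrakk> \<Longrightarrow> a * b \<in> G"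
    and minus: "a \<in> G \<Longrightarrow> - a \<in> G"

text \<open>Only the values on \<open>X\<close> count, so one \<open>G\<close> serves
  \<open>X\<close> and all its subspaces. (AX2) is stated with a single element \<open>a\<close>:
  since D(a,b) = a D(1,ab), a kernel closed under D(1,a) is closed under all value sets, and c in
  D(1,a) says that \<open>c\<close> is 1 wherever \<open>a\<close> is.\<close>

locale sign_space = sign_group +
  assumes nonempty: "X \<noteq> {}"
    and separates: "\<lbrakk>x \<in> X; y \<in> X; x \<noteq> y\<rbrakk> \<Longrightarrow> \<exists>a\<in>G. a x \<noteq> a y"
    and character_point:
      "\<lbrakk>\<And>a. a \<in> G \<Longrightarrow> \<chi> a = 1 \<or> \<chi> a = - 1;
        \<And>a b. \<lbrakk>a \<in> G; b \<in> G\<rbrakk> \<Longrightarrow> \<chi> (a * b) = \<chi> a * \<chi> b; \<chi> (- 1) = - 1;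
        \<And>a c. \<lbrakk>a \<in> G; c \<in> G; \<chi> a = 1; \<forall>x\<in>X. a x = 1 \<longrightarrow> c x = 1\<rbrakk> \<Longrightarrow> \<chi> c = 1\<rbrakk>
       \<Longrightarrow> \<exists>x\<in>X. \<forall>a\<in>G. \<chi> a = (a x :: int)"
    and associativity:
      "\<lbrakk>a1 \<in> G; a2 \<in> G; a3 \<in> G; b \<in> G; c \<in> G;
        \<forall>x\<in>X. a2 x = c x \<or> a3 x = c x; \<forall>x\<in>X. a1 x = b x \<or> c x = b x\<rbrakk>
       \<Longrightarrow> \<exists>d\<in>G. (\<forall>x\<in>X. a1 x = d x \<or> a2 x = d x) \<and> (\<forall>x\<in>X. d x = b x \<or> a3 x = b x)"

text \<open>These are the subspaces and the empty set: the family that cuts out a subspace can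
  always be taken to be the annihilator of \<open>Y\<close>, the elements of \<open>G\<close> that
  are 1 on \<open>Y\<close>.\<close>

definition flat :: "'a set \<Rightarrow> ('a \<Rightarrow> int) set \<Rightarrow> 'a set \<Rightarrow> bool" where
  "flat X G Y \<longleftrightarrow>
     Y \<subseteq> X \<and> (\<forall>x\<in>X. (\<forall>g\<in>G. (\<forall>y\<in>Y. g y = 1) \<longrightarrow> g x = 1) \<longrightarrow> x \<in> Y)"

definition saturated :: "'a set \<Rightarrow> ('a \<Rightarrow> int) set \<Rightarrow> ('a \<Rightarrow> int) set \<Rightarrow> bool" where
  "saturated X G M \<longleftrightarrow> M \<subseteq> G \<and> 1 \<in> M \<and> (\<forall>a\<in>M. \<forall>b\<in>M. a * b \<in> M) \<and>
     (\<forall>a\<in>M. \<forall>c\<in>G. (\<forall>x\<in>X. a x = 1 \<longrightarrow> c x = 1) \<longrightarrow> c \<in> M)"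

text \<open>The union of the value sets D(u, v g) with \<open>u\<close>, \<open>v\<close> in
  \<open>M\<close>. For saturated \<open>M\<close> it is the saturated subgroup M[g] generated by
  \<open>M\<close> and \<open>g\<close>.\<close>

definition adjoin ::
    "'a set \<Rightarrow> ('a \<Rightarrow> int) set \<Rightarrow> ('a \<Rightarrow> int) set \<Rightarrow> ('a \<Rightarrow> int) \<Rightarrow> ('a \<Rightarrow> int) set" where
  "adjoin X G M g = {c \<in> G. \<exists>u\<in>M. \<exists>v\<in>M. \<forall>x\<in>X. u x = c x \<or> v x * g x = c x}"

context sign_space
begin

section \<open>Saturated subgroups and the points they define\<close>

lemma minus_one: "- 1 \<in> G"
  using minus one by blast

lemma sq: "\<lbrakk>a \<in> G; x \<in> X\<rbrakk> \<Longrightarrow> a x * a x = 1"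
  using sign by fastforce

text \<open>D(a,b) = a D(1,ab), so closure under the sets D(1,a) extends to all value sets of
  elements of \<open>M\<close>.\<close>

lemma saturated_between:
  assumes M: "saturated X G M" and "a \<in> M" "b \<in> M" "c \<in> G"
    and c: "\<forall>x\<in>X. a x = c x \<or> b x = c x"
  shows "c \<in> M"
proof -
  have G: "a \<in> G" "b \<in> G"
    using assms by (auto simp: saturated_def)
  have "a * b \<in> M" and "a * c \<in> G"
    using assms G mult by (auto simp: saturated_def)
  moreover have "\<forall>x\<in>X. (a * b) x = 1 \<longrightarrow> (a * c) x = 1"
    using c sign[OF G(1)] sign[OF G(2)] sign[OF \<open>c \<in> G\<close>] by fastforce
  ultimately have "a * c \<in> M"
    using M by (auto simp: saturated_def)
  hence "a * (a * c) \<in> M"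
    using M \<open>a \<in> M\<close> by (auto simp: saturated_def)
  moreover have "\<forall>x\<in>X. (a * (a * c)) x = 1 \<longrightarrow> c x = 1"
    using sign[OF G(1)] by fastforce
  ultimately show ?thesis
    using M \<open>c \<in> G\<close> by (auto simp: saturated_def)
qed

text \<open>If -1 is in D(u, v g), then - v g is 1 wherever \<open>u\<close> is, hence lies in
  \<open>M\<close>; then \<open>v\<close> cancels.\<close>

lemma saturated_one_adjoin:
  assumes M: "saturated X G M" and g: "g \<in> G" and "- 1 \<in> adjoin X G M g"
  shows "- g \<in> M"
proof -
  obtain u v where uv: "u \<in> M" "v \<in> M" "\<forall>x\<in>X. u x = - 1 \<or> v x * g x = - 1"
    using assms by (auto simp: adjoin_def)
  have G: "u \<in> G" "v \<in> G"
    using uv M by (auto simp: saturated_def)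
  have "\<forall>x\<in>X. u x = 1 \<longrightarrow> (- (v * g)) x = 1"
    using uv(3) by fastforce
  hence 1: "- (v * g) \<in> M"
    using M uv(1) mult minus G g by (auto simp: saturated_def)
  have "\<forall>x\<in>X. (v * - (v * g)) x = 1 \<longrightarrow> (- g) x = 1"
    using sign[OF G(2)] by fastforce
  moreover have "v * - (v * g) \<in> M"
    using 1 uv(2) M unfolding saturated_def by blast
  moreover have "- g \<in> G"
    using minus g by blast
  ultimately show ?thesis
    using M by (meson saturated_def)
qed

lemma adjoin_superset:
  assumes "saturated X G M" "g \<in> G"
  shows "M \<subseteq> adjoin X G M g" "g \<in> adjoin X G M g"
proof -
  show "M \<subseteq> adjoin X G M g"
    using assms unfolding adjoin_def saturated_def by fastforce
  have "\<forall>x\<in>X. 1 x = g x \<or> 1 x * g x = g x" and "1 \<in> M"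
    using assms by (auto simp: saturated_def)
  thus "g \<in> adjoin X G M g"
    using assms unfolding adjoin_def by blast
qed

text \<open>Three uses of associativity rearrange D(D(u, v g), D(u', v' g)) into D(z, y) with
  \<open>z\<close> in D(u', u) and \<open>y\<close> in D(v' g, v g). Then \<open>z\<close> and
  \<open>y * g\<close> lie in \<open>M\<close>.\<close>

lemma adjoin_between:
  assumes M: "saturated X G M" and g: "g \<in> G"
    and e: "e \<in> adjoin X G M g" and f: "f \<in> adjoin X G M g" and h: "h \<in> G"
    and ef: "\<forall>x\<in>X. e x = h x \<or> f x = h x"
  shows "h \<in> adjoin X G M g"
proof -
  obtain u v where uv: "u \<in> M" "v \<in> M" "\<forall>x\<in>X. u x = e x \<or> (v * g) x = e x"
    using e by (auto simp: adjoin_def)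
  obtain u' v' where uv': "u' \<in> M" "v' \<in> M" "\<forall>x\<in>X. u' x = f x \<or> (v' * g) x = f x"
    using f by (auto simp: adjoin_def)
  have G: "u \<in> G" "v \<in> G" "u' \<in> G" "v' \<in> G" "e \<in> G" "f \<in> G" "v * g \<in> G" "v' * g \<in> G"
  proof -
    have "M \<subseteq> G" using M by (simp add: saturated_def)
    thus "u \<in> G" "v \<in> G" "u' \<in> G" "v' \<in> G" using uv(1,2) uv'(1,2) by blast+
    thus "v * g \<in> G" "v' * g \<in> G" using mult g by simp_all
    show "e \<in> G" "f \<in> G" using e f by (simp_all add: adjoin_def)
  qed
  obtain w where w: "w \<in> G" "\<forall>x\<in>X. e x = w x \<or> u' x = w x" "\<forall>x\<in>X. w x = h x \<or> (v' * g) x = h x"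
    using associativity[of e u' "v' * g" h f] G h uv'(3) ef by blast
  have "\<forall>x\<in>X. (v * g) x = e x \<or> u x = e x" "\<forall>x\<in>X. u' x = w x \<or> e x = w x"
    using uv(3) w(2) by blast+
  then obtain z where z: "z \<in> G" "\<forall>x\<in>X. u' x = z x \<or> u x = z x" "\<forall>x\<in>X. z x = w x \<or> (v * g) x = w x"
    using associativity[of u' u "v * g" w e] G w by blast
  have zM: "z \<in> M"
    using saturated_between[OF M uv'(1) uv(1) z(1,2)] .
  have "\<forall>x\<in>X. (v' * g) x = h x \<or> w x = h x" "\<forall>x\<in>X. (v * g) x = w x \<or> z x = w x"
    using w(3) z(3) by blast+
  then obtain y where y: "y \<in> G" "\<forall>x\<in>X. (v' * g) x = y x \<or> (v * g) x = y x"
      "\<forall>x\<in>X. y x = h x \<or> z x = h x"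
    using associativity[of "v' * g" "v * g" z h w] G h w z by blast
  have "y * g \<in> M"
  proof (rule saturated_between[OF M uv'(2) uv(2)])
    show "y * g \<in> G" using mult y g by blast
    show "\<forall>x\<in>X. v' x = (y * g) x \<or> v x = (y * g) x"
      using y(2) sign[OF g] by fastforce
  qed
  moreover have "\<forall>x\<in>X. z x = h x \<or> (y * g) x * g x = h x"
    using y(3) sign[OF g] by fastforce
  ultimately show ?thesis
    using h zM unfolding adjoin_def by blast
qed

lemma saturated_adjoin:
  assumes M: "saturated X G M" and g: "g \<in> G"
  shows "saturated X G (adjoin X G M g)"
proof -
  have MG: "M \<subseteq> G" and prodM: "\<And>a b. \<lbrakk>a \<in> M; b \<in> M\<rbrakk> \<Longrightarrow> a * b \<in> M"
    using M unfolding saturated_def by blast+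
  have one_mem: "1 \<in> adjoin X G M g"
    using adjoin_superset(1)[OF M g] M by (auto simp: saturated_def)
  have scale: "m * f \<in> adjoin X G M g" if mf: "m \<in> M" "f \<in> adjoin X G M g" for m f
  proof -
    obtain u v where uv: "u \<in> M" "v \<in> M" "\<forall>x\<in>X. u x = f x \<or> v x * g x = f x"
 using mf by (auto simp: adjoin_def)
    have "\<forall>x\<in>X. (m * u) x = (m * f) x \<or> (m * v) x * g x = (m * f) x"
      using uv(3) by (auto simp: algebra_simps)
    moreover have "m * u \<in> M" "m * v \<in> M"
      using prodM mf(1) uv(1,2) by simp_all
    moreover have "m * f \<in> G"
      using mult[of m f] MG mf by (auto simp: adjoin_def)
    ultimately show ?thesis unfolding adjoin_def by blast
  qed
  have scale_g: "(m * g) * f \<in> adjoin X G M g" if mf: "m \<in> M" "f \<in> adjoin X G M g" for m f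
  proof -
    obtain u v where uv: "u \<in> M" "v \<in> M" "\<forall>x\<in>X. u x = f x \<or> v x * g x = f x"
 using mf by (auto simp: adjoin_def)
    have "\<forall>x\<in>X. (m * v) x = (m * g * f) x \<or> (m * u) x * g x = (m * g * f) x"
      using uv(3) sign[OF g] by fastforce
    moreover have "m * u \<in> M" "m * v \<in> M"
      using prodM mf(1) uv(1,2) by simp_all
    moreover have "m * g * f \<in> G"
      using mult[OF mult[OF _ g]] MG mf by (auto simp: adjoin_def)
    ultimately show ?thesis unfolding adjoin_def by blast
  qed
  \<comment> \<open>For \<open>e\<close> in D(u, v g) the product \<open>e * f\<close> is in D(u f,
    v g f), and both ends are already known to lie in M[g].\<close>
  have prod: "e * f \<in> adjoin X G M g" if e: "e \<in> adjoin X G M g" and f: "f \<in> adjoin X G M g" for e f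
  proof -
    obtain u v where uv: "u \<in> M" "v \<in> M" "\<forall>x\<in>X. u x = e x \<or> v x * g x = e x"
      using e by (auto simp: adjoin_def)
    have "\<forall>x\<in>X. (u * f) x = (e * f) x \<or> (v * g * f) x = (e * f) x"
      using uv(3) by auto
    moreover have "e * f \<in> G"
      using e f mult by (auto simp: adjoin_def)
    ultimately show ?thesis
      using adjoin_between[OF M g scale[OF uv(1) f] scale_g[OF uv(2) f]] by blast
  qed
  have "c \<in> adjoin X G M g"
    if a: "a \<in> adjoin X G M g" and c: "c \<in> G" and ac: "\<forall>x\<in>X. a x = 1 \<longrightarrow> c x = 1" for a c
  proof -
    have aG: "a \<in> G" using a by (auto simp: adjoin_def)
    have "\<forall>x\<in>X. 1 x = c x \<or> a x = c x"
      using ac sign[OF aG] sign[OF c] by fastforce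
    thus ?thesis
      using adjoin_between[OF M g one_mem a c] by blast
  qed
  thus ?thesis
    using one_mem prod unfolding saturated_def adjoin_def by blast
qed

text \<open>Maximality forces \<open>g\<close> or \<open>- g\<close> into \<open>M\<close> for every
  \<open>g\<close>. Hence \<open>M\<close> is the kernel of a character, and (AX2) turns this
  character into a point.\<close>

lemma maximal_saturated_point:
  assumes M: "saturated X G M" and "- 1 \<notin> M"
    and max: "\<And>M'. \<lbrakk>saturated X G M'; M \<subseteq> M'; - 1 \<notin> M'\<rbrakk> \<Longrightarrow> M' = M"
  shows "\<exists>x\<in>X. \<forall>a\<in>G. a \<in> M \<longleftrightarrow> a x = 1"
proof -
  have mM: "- g \<in> M" if "g \<in> G" "g \<notin> M" for g
  proof (rule saturated_one_adjoin[OF M that(1)], rule ccontr)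
    assume "- 1 \<notin> adjoin X G M g"
    hence "adjoin X G M g = M"
      using max saturated_adjoin[OF M that(1)] adjoin_superset(1)[OF M that(1)] by blast
    thus False
      using adjoin_superset(2)[OF M that(1)] that by blast
  qed
  have ext: "b \<in> M" if "a \<in> M" "b \<in> G" "\<forall>x\<in>X. a x = b x" for a b
    using saturated_between[OF M that(1,1,2)] that(3) by blast
  have prodM: "a * b \<in> M" if "a \<in> M" "b \<in> M" for a b
    using M that by (auto simp: saturated_def)
  have notboth: "\<not> (g \<in> M \<and> - g \<in> M)" if "g \<in> G" for g
  proof
    assume "g \<in> M \<and> - g \<in> M"
    hence "g * - g \<in> M" using prodM by blast
    moreover have "\<forall>x\<in>X. (g * - g) x = (- 1) x"
      using sq[OF that] by simp
    ultimately have "- 1 \<in> M"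
      using ext minus_one by blast
    thus False using assms by blast
  qed
  define \<chi> :: "('a \<Rightarrow> int) \<Rightarrow> int" where "\<chi> = (\<lambda>g. if g \<in> M then 1 else - 1)"
  have "\<exists>x\<in>X. \<forall>a\<in>G. \<chi> a = a x"
  proof (rule character_point)
    show "\<chi> (- 1) = - 1" using assms by (simp add: \<chi>_def)
    show "\<chi> a = 1 \<or> \<chi> a = - 1" for a by (simp add: \<chi>_def)
    show "\<chi> (a * b) = \<chi> a * \<chi> b" if ab: "a \<in> G" "b \<in> G" for a b
    proof -
      have 1: "a * b \<notin> M" if "a \<in> M" "b \<notin> M"
        using prodM[of a "- b"] mM[of b] ab that notboth[of "a * b"] mult[of a b] by auto
      have 2: "a * b \<notin> M" if "a \<notin> M" "b \<in> M"
        using prodM[of "- a" b] mM[of a] ab that notboth[of "a * b"] mult[of a b] by auto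
      have 3: "a * b \<in> M" if "a \<notin> M" "b \<notin> M"
        using prodM[of "- a" "- b"] mM[of a] mM[of b] ab that by auto
      show ?thesis using 1 2 3 prodM[of a b] by (auto simp: \<chi>_def)
    qed
    show "\<chi> c = 1" if "a \<in> G" "c \<in> G" "\<chi> a = 1" "\<forall>x\<in>X. a x = 1 \<longrightarrow> c x = 1" for a c
      using that M by (auto simp: \<chi>_def saturated_def split: if_splits)
  qed
  then obtain x where x: "x \<in> X" "\<forall>a\<in>G. \<chi> a = a x" by blast
  have "a \<in> M \<longleftrightarrow> a x = 1" if "a \<in> G" for a
    using x(2) that unfolding \<chi>_def by (metis one_neq_neg_one)
  thus ?thesis using x(1) by blast
qed

lemma saturated_Union_chain:
  assumes "C \<noteq> {}" "subset.chain {M. saturated X G M \<and> P M} C"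
  shows "saturated X G (\<Union>C)"
proof -
  have sat: "saturated X G M" if "M \<in> C" for M
    using assms that by (auto simp: subset.chain_def)
  have "a * b \<in> \<Union>C" if ab: "a \<in> \<Union>C" "b \<in> \<Union>C" for a b
  proof -
    obtain M N where MN: "M \<in> C" "N \<in> C" "a \<in> M" "b \<in> N" using ab by blast
    then have "M \<subseteq> N \<or> N \<subseteq> M" using assms(2) by (auto simp: subset.chain_def)
    then obtain L where "L \<in> C" "a \<in> L" "b \<in> L" using MN by blast
    thus ?thesis using sat[of L] by (auto simp: saturated_def)
  qed
  moreover have "c \<in> \<Union>C"
    if "a \<in> \<Union>C" "c \<in> G" "\<forall>x\<in>X. a x = 1 \<longrightarrow> c x = 1" for a c
    using that sat unfolding saturated_def by blast
  moreover have "\<Union>C \<subseteq> G" "1 \<in> \<Union>C"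
    using sat assms(1) unfolding saturated_def by blast+
  ultimately show ?thesis unfolding saturated_def by blast
qed

text \<open>M[-e] does not contain -1, as \<open>e\<close> is not in \<open>M\<close>; Zorn's lemma
  extends it to a maximal such subgroup, which is a point. Thus a saturated subgroup is determined
  by the points at which it is 1.\<close>

lemma saturated_separation:
  assumes M: "saturated X G M" and e: "e \<in> G" "e \<notin> M"
  shows "\<exists>x\<in>X. (\<forall>a\<in>M. a x = 1) \<and> e x = - 1"
proof -
  let ?N = "adjoin X G M (- e)"
  let ?A = "{M'. saturated X G M' \<and> (?N \<subseteq> M' \<and> - 1 \<notin> M')}"
  have N: "saturated X G ?N" using saturated_adjoin[OF M] minus e by blast
  have "- 1 \<notin> ?N"
  proof
    assume "- 1 \<in> ?N"
    from saturated_one_adjoin[OF M minus[OF e(1)] this] e show False by simp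
  qed
  hence "?N \<in> ?A" using N by blast
  have "\<exists>M'\<in>?A. \<forall>L\<in>?A. M' \<subseteq> L \<longrightarrow> L = M'"
  proof (rule subset_Zorn_nonempty)
    show "?A \<noteq> {}" using \<open>?N \<in> ?A\<close> by blast
    fix C assume C: "C \<noteq> {}" "subset.chain ?A C"
    have "saturated X G (\<Union>C)" using saturated_Union_chain[OF C] .
    moreover have "?N \<subseteq> \<Union>C" "- 1 \<notin> \<Union>C"
      using C unfolding subset.chain_def by blast+
    ultimately show "\<Union>C \<in> ?A" by blast
  qed
  then obtain M' where "M' \<in> ?A" and "\<forall>L\<in>?A. M' \<subseteq> L \<longrightarrow> L = M'"
    by (rule bexE)
  hence M': "saturated X G M'" "?N \<subseteq> M'" "- 1 \<notin> M'"
    and max: "\<And>L. \<lbrakk>saturated X G L; M' \<subseteq> L; - 1 \<notin> L\<rbrakk> \<Longrightarrow> L = M'"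
    by auto
  obtain x where x: "x \<in> X" "\<forall>a\<in>G. a \<in> M' \<longleftrightarrow> a x = 1"
    using maximal_saturated_point[OF M'(1,3) max] by blast
  have "\<forall>a\<in>M. a x = 1"
    using x M'(2) adjoin_superset(1)[OF M minus[OF e(1)]] M by (auto simp: saturated_def)
  moreover have "(- e) x = 1"
    using x M'(2) adjoin_superset(2)[OF M minus[OF e(1)]] minus[OF e(1)] by blast
  ultimately show ?thesis using x(1) by force
qed

text \<open>A value set of \<open>Y\<close> lifts to \<open>X\<close> up to factors from the
  annihilator M of \<open>Y\<close>. A point at which M[ab] is 1 lies in the flat \<open>Y\<close>
  and has a = b, so a = c there. By separation \<open>a * c\<close> lies in M[ab], that is, in D(u,
  v a b) with \<open>u\<close>, \<open>v\<close> in M; multiply by \<open>a\<close>.\<close>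

lemma flat_between_lift:
  assumes Y: "flat X G Y" and G: "a \<in> G" "b \<in> G" "c \<in> G"
    and c: "\<forall>x\<in>Y. a x = c x \<or> b x = c x"
  shows "\<exists>u\<in>G. \<exists>v\<in>G. (\<forall>y\<in>Y. u y = 1 \<and> v y = 1) \<and> (\<forall>x\<in>X. (a * u) x = c x \<or> (b * v) x = c x)"
proof -
  let ?M = "{g\<in>G. \<forall>y\<in>Y. g y = 1}"
  have YX: "Y \<subseteq> X" using Y by (auto simp: flat_def)
  have M: "saturated X G ?M"
    unfolding saturated_def using one mult YX by auto
  have ab: "a * b \<in> G" "a * c \<in> G" using mult G by blast+
  have "a * c \<in> adjoin X G ?M (a * b)"
  proof (rule ccontr)
    assume "a * c \<notin> adjoin X G ?M (a * b)"
    then obtain x where x: "x \<in> X" "\<forall>g\<in>adjoin X G ?M (a * b). g x = 1" "(a * c) x = - 1"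
      using saturated_separation[OF saturated_adjoin[OF M ab(1)] ab(2)] by blast
    hence "x \<in> Y"
      using Y adjoin_superset(1)[OF M ab(1)] unfolding flat_def by blast
    moreover have "(a * b) x = 1" using x adjoin_superset(2)[OF M ab(1)] by blast
    ultimately show False
      using c x sign[OF G(1) x(1)] sign[OF G(2) x(1)] sign[OF G(3) x(1)] by fastforce
  qed
  then obtain u v where uv: "u \<in> ?M" "v \<in> ?M" "\<forall>x\<in>X. u x = (a * c) x \<or> v x * (a * b) x = (a * c) x"
    by (auto simp: adjoin_def)
  have "\<forall>x\<in>X. (a * u) x = c x \<or> (b * v) x = c x"
  proof
    fix x assume x: "x \<in> X"
    show "(a * u) x = c x \<or> (b * v) x = c x"
      using uv(3) x sign[OF G(1) x] by (auto simp: algebra_simps)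
  qed
  thus ?thesis using uv by blast
qed

text \<open>For (AX3) both value-set relations are lifted from \<open>Y\<close> to \<open>X\<close>,
  the axiom is applied there, and restriction to \<open>Y\<close> forgets the correcting factors.
  For (AX2) the character is found as a point of \<open>X\<close>, and flatness puts it into
  \<open>Y\<close>.\<close>

lemma sign_space_flat:
  assumes Y: "flat X G Y" and "Y \<noteq> {}"
  shows "sign_space Y G"
proof
  have YX: "Y \<subseteq> X" using Y by (auto simp: flat_def)
  show "Y \<noteq> {}" "1 \<in> G" by (fact assms one)+
  show "\<And>a x. \<lbrakk>a \<in> G; x \<in> Y\<rbrakk> \<Longrightarrow> a x = 1 \<or> a x = - 1" using sign YX by blast
  show "\<And>a b. \<lbrakk>a \<in> G; b \<in> G\<rbrakk> \<Longrightarrow> a * b \<in> G" "\<And>a. a \<in> G \<Longrightarrow> - a \<in> G"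
    using mult minus by blast+
  show "\<And>x y. \<lbrakk>x \<in> Y; y \<in> Y; x \<noteq> y\<rbrakk> \<Longrightarrow> \<exists>a\<in>G. a x \<noteq> a y"
    using separates YX by blast
  show "\<exists>x\<in>Y. \<forall>a\<in>G. \<chi> a = a x"
    if \<chi>: "\<And>a. a \<in> G \<Longrightarrow> \<chi> a = 1 \<or> \<chi> a = - 1"
      "\<And>a b. \<lbrakk>a \<in> G; b \<in> G\<rbrakk> \<Longrightarrow> \<chi> (a * b) = \<chi> a * \<chi> b" "\<chi> (- 1) = - 1"
      "\<And>a c. \<lbrakk>a \<in> G; c \<in> G; \<chi> a = 1; \<forall>x\<in>Y. a x = 1 \<longrightarrow> c x = 1\<rbrakk> \<Longrightarrow> \<chi> c = 1"
    for \<chi> :: "('a \<Rightarrow> int) \<Rightarrow> int"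
  proof -
    have "\<exists>x\<in>X. \<forall>a\<in>G. \<chi> a = a x"
    proof (rule character_point)
      show "\<chi> c = 1" if "a \<in> G" "c \<in> G" "\<chi> a = 1" "\<forall>x\<in>X. a x = 1 \<longrightarrow> c x = 1" for a c
        using \<chi>(4)[of a c] that YX by blast
    qed (fact \<chi>)+
    then obtain x where x: "x \<in> X" "\<forall>a\<in>G. \<chi> a = a x" by blast
    have "\<chi> 1 = 1" using \<chi>(2)[OF one one] \<chi>(1)[OF one] by auto
    hence "\<forall>g\<in>G. (\<forall>y\<in>Y. g y = 1) \<longrightarrow> g x = 1"
      using x(2) \<chi>(4)[OF one] by auto
    thus ?thesis using Y x unfolding flat_def by blast
  qed
  show "\<exists>d\<in>G. (\<forall>x\<in>Y. a1 x = d x \<or> a2 x = d x) \<and> (\<forall>x\<in>Y. d x = b x \<or> a3 x = b x)"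
    if G: "a1 \<in> G" "a2 \<in> G" "a3 \<in> G" "b \<in> G" "c \<in> G"
      and c: "\<forall>x\<in>Y. a2 x = c x \<or> a3 x = c x" and b: "\<forall>x\<in>Y. a1 x = b x \<or> c x = b x"
    for a1 a2 a3 b c
  proof -
    obtain u v where uv: "u \<in> G" "v \<in> G" "\<forall>y\<in>Y. u y = 1 \<and> v y = 1"
        "\<forall>x\<in>X. (a1 * u) x = b x \<or> (c * v) x = b x"
      using flat_between_lift[OF Y G(1,5,4) b] by blast
    obtain p q where pq: "p \<in> G" "q \<in> G" "\<forall>y\<in>Y. p y = 1 \<and> q y = 1"
        "\<forall>x\<in>X. (a2 * p) x = c x \<or> (a3 * q) x = c x"
      using flat_between_lift[OF Y G(2,3,5) c] by blast
    have "\<forall>x\<in>X. (a2 * p * v) x = (c * v) x \<or> (a3 * q * v) x = (c * v) x"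
      using pq(4) by auto
    from associativity[OF mult[OF G(1) uv(1)] mult[OF mult[OF G(2) pq(1)] uv(2)]
        mult[OF mult[OF G(3) pq(2)] uv(2)] G(4) mult[OF G(5) uv(2)] this uv(4)]
    obtain d where d: "d \<in> G" "\<forall>x\<in>X. (a1 * u) x = d x \<or> (a2 * p * v) x = d x"
        "\<forall>x\<in>X. d x = b x \<or> (a3 * q * v) x = b x"
      by blast
    have "\<forall>x\<in>Y. a1 x = d x \<or> a2 x = d x"
    proof
      fix x assume "x \<in> Y"
      thus "a1 x = d x \<or> a2 x = d x" using d(2) YX uv(3) pq(3) by fastforce
    qed
    moreover have "\<forall>x\<in>Y. d x = b x \<or> a3 x = b x"
    proof
      fix x assume "x \<in> Y"
      thus "d x = b x \<or> a3 x = b x" using d(3) YX uv(3) pq(3) by fastforce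
    qed
    ultimately show ?thesis using d(1) by blast
  qed
qed

text \<open>(AX3) for b = 1 in terms of negative sets: \<open>K\<close> is in D(B,C) and 1 in
  D(A,K), so some \<open>D\<close> in D(A,B) has 1 in D(D,C). In applications the two bounds on
  \<open>D\<close> pin down enough of its values for a contradiction.\<close>

lemma exchange:
  assumes G: "A \<in> G" "B \<in> G" "C \<in> G" "K \<in> G"
    and "\<And>x. \<lbrakk>x \<in> X; B x = - 1; C x = - 1\<rbrakk> \<Longrightarrow> K x = - 1"
    and "\<And>x. \<lbrakk>x \<in> X; K x = - 1\<rbrakk> \<Longrightarrow> (B x = - 1 \<or> C x = - 1) \<and> A x = 1"
  obtains D where "D \<in> G" "\<And>x. \<lbrakk>x \<in> X; A x = - 1; B x = - 1\<rbrakk> \<Longrightarrow> D x = - 1"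
    "\<And>x. \<lbrakk>x \<in> X; D x = - 1\<rbrakk> \<Longrightarrow> (A x = - 1 \<or> B x = - 1) \<and> C x = 1"
proof -
  have "\<forall>x\<in>X. B x = K x \<or> C x = K x" "\<forall>x\<in>X. A x = 1 x \<or> K x = 1 x"
    using assms sign[OF G(1)] sign[OF G(2)] sign[OF G(3)] sign[OF G(4)] by fastforce+
  then obtain D where D: "D \<in> G" "\<forall>x\<in>X. A x = D x \<or> B x = D x" "\<forall>x\<in>X. D x = 1 x \<or> C x = 1 x"
    using associativity[of A B C 1 K] G one by blast
  show thesis
    using that[OF D(1)] D(2,3) by fastforce
qed

end

section \<open>Decompositions and translations\<close>

text \<open>\<open>G\<close> restricts to the full product of its restrictions to \<open>Y\<close>
  and \<open>Z\<close>, as in a direct sum. Disjointness is automatic, because 1 and -1 can be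
  glued.\<close>

definition splits :: "('a \<Rightarrow> int) set \<Rightarrow> 'a set \<Rightarrow> 'a set \<Rightarrow> bool" where
  "splits G Y Z \<longleftrightarrow>
     (\<forall>g\<in>G. \<forall>h\<in>G. \<exists>k\<in>G. (\<forall>x\<in>Y. k x = g x) \<and> (\<forall>x\<in>Z. k x = h x))"

definition indecomposable :: "('a \<Rightarrow> int) set \<Rightarrow> 'a set \<Rightarrow> bool" where
  "indecomposable G X \<longleftrightarrow> \<not> (\<exists>Y Z. Y \<noteq> {} \<and> Z \<noteq> {} \<and> X = Y \<union> Z \<and> splits G Y Z)"

definition sign_character :: "('a \<Rightarrow> int) set \<Rightarrow> (('a \<Rightarrow> int) \<Rightarrow> int) \<Rightarrow> bool" where
  "sign_character G \<alpha> \<longleftrightarrow>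
     (\<forall>a\<in>G. \<alpha> a = 1 \<or> \<alpha> a = - 1) \<and> (\<forall>a\<in>G. \<forall>b\<in>G. \<alpha> (a * b) = \<alpha> a * \<alpha> b)"

text \<open>\<open>y\<close> is the product of \<open>\<alpha>\<close> and \<open>x\<close> in the
  character group. This is a relation and not a map, since the product may fall outside the
  space.\<close>

definition shifted ::
    "('a \<Rightarrow> int) set \<Rightarrow> (('a \<Rightarrow> int) \<Rightarrow> int) \<Rightarrow> 'a \<Rightarrow> 'a \<Rightarrow> bool" where
  "shifted G \<alpha> x y \<longleftrightarrow> (\<forall>g\<in>G. g y = \<alpha> g * g x)"

definition translation ::
    "('a \<Rightarrow> int) set \<Rightarrow> 'a set \<Rightarrow> (('a \<Rightarrow> int) \<Rightarrow> int) \<Rightarrow> bool" where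
  "translation G X \<alpha> \<longleftrightarrow>
     sign_character G \<alpha> \<and> (\<exists>a\<in>G. \<alpha> a = - 1) \<and> (\<forall>x\<in>X. \<exists>y\<in>X. shifted G \<alpha> x y)"

section \<open>Elementary properties of splittings and flats\<close>

lemma splits_commute: "splits G Y Z \<Longrightarrow> splits G Z Y"
  unfolding splits_def by blast

lemma splitsD:
  "\<lbrakk>splits G Y Z; g \<in> G; h \<in> G\<rbrakk> \<Longrightarrow> \<exists>k\<in>G. (\<forall>x\<in>Y. k x = g x) \<and> (\<forall>x\<in>Z. k x = h x)"
  by (simp add: splits_def)

lemma splits_mono:
  assumes "splits G Y Z" "Y' \<subseteq> Y" "Z' \<subseteq> Z" shows "splits G Y' Z'"
  unfolding splits_def
proof (intro ballI)
  fix g h assume "g \<in> G" "h \<in> G"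
  from splitsD[OF assms(1) this]
  obtain k where "k \<in> G" "\<And>x. x \<in> Y \<Longrightarrow> k x = g x" "\<And>x. x \<in> Z \<Longrightarrow> k x = h x"
    by blast
  thus "\<exists>k\<in>G. (\<forall>x\<in>Y'. k x = g x) \<and> (\<forall>x\<in>Z'. k x = h x)"
    using assms(2,3) by (intro bexI[of _ k]) auto
qed

lemma shiftedD: "\<lbrakk>shifted G \<alpha> x y; g \<in> G\<rbrakk> \<Longrightarrow> g y = \<alpha> g * g x"
  by (simp add: shifted_def)

lemma sign_characterD:
  assumes "sign_character G \<alpha>"
  shows "a \<in> G \<Longrightarrow> \<alpha> a = 1 \<or> \<alpha> a = - 1"
    and "\<lbrakk>a \<in> G; b \<in> G\<rbrakk> \<Longrightarrow> \<alpha> (a * b) = \<alpha> a * \<alpha> b"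
  using assms unfolding sign_character_def by blast+

lemma flat_subset: "flat X G Y \<Longrightarrow> Y \<subseteq> X"
  by (simp add: flat_def)

lemma flatD:
  assumes "flat X G Y" "x \<in> X" "\<And>g. \<lbrakk>g \<in> G; \<forall>y\<in>Y. g y = 1\<rbrakk> \<Longrightarrow> g x = 1"
  shows "x \<in> Y"
  using assms by (simp add: flat_def)

lemma flatI:
  assumes "Y \<subseteq> X"
    and "\<And>x. \<lbrakk>x \<in> X; \<And>g. \<lbrakk>g \<in> G; \<forall>y\<in>Y. g y = 1\<rbrakk> \<Longrightarrow> g x = 1\<rbrakk> \<Longrightarrow> x \<in> Y"
  shows "flat X G Y"
  using assms by (simp add: flat_def)

lemma flat_trans:
  assumes "flat X G Y" "flat Y G Z" shows "flat X G Z"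
proof (rule flatI)
  show "Z \<subseteq> X" using assms flat_subset by blast
  fix x assume x: "x \<in> X" and ann: "\<And>g. \<lbrakk>g \<in> G; \<forall>y\<in>Z. g y = 1\<rbrakk> \<Longrightarrow> g x = 1"
  have "x \<in> Y"
    using flatD[OF assms(1) x] ann flat_subset[OF assms(2)] by (simp add: subset_iff)
  thus "x \<in> Z" by (rule flatD[OF assms(2)]) (rule ann)
qed

lemma flat_positive:
  assumes "flat X G Y" "g \<in> G"
  shows "flat X G {x \<in> Y. g x = 1}"
proof (rule flatI)
  show "{x \<in> Y. g x = 1} \<subseteq> X" using flat_subset[OF assms(1)] by blast
  fix x assume x: "x \<in> X"
    and ann: "\<And>h. \<lbrakk>h \<in> G; \<forall>y\<in>{x \<in> Y. g x = 1}. h y = 1\<rbrakk> \<Longrightarrow> h x = 1"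
  have "g x = 1" using ann[OF assms(2)] by simp
  moreover have "x \<in> Y" by (rule flatD[OF assms(1) x]) (simp add: ann)
  ultimately show "x \<in> {x \<in> Y. g x = 1}" by simp
qed

lemma flat_self: "flat X G X"
  by (auto simp: flat_def)

lemma indecomposableD:
  assumes "indecomposable G X" "splits G Y Z" "X = Y \<union> Z"
  shows "Y = {} \<or> Z = {}"
  using assms unfolding indecomposable_def by metis

lemma indecomposable_subset:
  assumes "indecomposable G C" "C \<subseteq> P \<union> Q" "splits G P Q"
  shows "C \<subseteq> P \<or> C \<subseteq> Q"
proof (rule ccontr)
  assume "\<not> ?thesis"
  hence ne: "C \<inter> P \<noteq> {}" "C \<inter> Q \<noteq> {}" using assms(2) by auto
  have "C = (C \<inter> P) \<union> (C \<inter> Q)" using assms(2) by auto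
  moreover have "splits G (C \<inter> P) (C \<inter> Q)" using splits_mono[OF assms(3)] by blast
  ultimately show False using indecomposableD[OF assms(1)] ne by blast
qed

context sign_space
begin

lemma splits_disjoint:
  assumes "splits G Y Z" shows "Y \<inter> Z = {}"
proof -
  obtain k where "k \<in> G" "\<forall>x\<in>Y. k x = 1 x" "\<forall>x\<in>Z. k x = (- 1) x"
    using splitsD[OF assms one minus_one] by blast
  thus ?thesis by force
qed

lemma splits_flat:
  assumes "splits G C (X - C)" "C \<subseteq> X" shows "flat X G C"
proof -
  obtain k where k: "k \<in> G" "\<And>x. x \<in> C \<Longrightarrow> k x = 1 x" "\<And>x. x \<in> X - C \<Longrightarrow> k x = (- 1) x"
    using splitsD[OF assms(1) one minus_one] by blast
  show ?thesis
    proof (rule flatI)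
    fix x assume x: "x \<in> X" and ann: "\<And>g. \<lbrakk>g \<in> G; \<forall>y\<in>C. g y = 1\<rbrakk> \<Longrightarrow> g x = 1"
    have "k x = 1" using ann[OF k(1)] k(2) by simp
    thus "x \<in> C" using k(3)[of x] x by force
  qed (fact assms)
qed

lemma normalized_separates:
  assumes "x \<in> X" "y \<in> X" "x \<noteq> y"
  obtains g where "g \<in> G" "g x = 1" "g y = - 1"
proof -
  obtain h where h: "h \<in> G" "h x \<noteq> h y" using separates assms by blast
  show thesis
  proof (cases "h x = 1")
    case True
    thus ?thesis using that[OF h(1)] h sign[OF h(1) assms(2)] by auto
  next
    case False
    thus ?thesis using that[OF minus[OF h(1)]] h sign[OF h(1) assms(1)] sign[OF h(1) assms(2)] by auto
  qed
qed

text \<open>Within \<open>Y\<close>, multiplication by \<open>b\<close> changes the sign at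
  \<open>y\<close> and nowhere else.\<close>

lemma splits_single:
  assumes "y \<in> Y" and "b \<in> G" "b y = - 1" "\<And>x. x \<in> Y \<Longrightarrow> x \<noteq> y \<Longrightarrow> b x = 1" "Y \<subseteq> X"
  shows "splits G {y} (Y - {y})"
  unfolding splits_def
proof (intro ballI)
  fix g h :: "'a \<Rightarrow> int" assume g: "g \<in> G" and h: "h \<in> G"
  show "\<exists>k\<in>G. (\<forall>x\<in>{y}. k x = g x) \<and> (\<forall>x\<in>Y - {y}. k x = h x)"
  proof (cases "g y = h y")
    case True
    thus ?thesis using h by (intro bexI[of _ h]) auto
  next
    case False
    hence "h y * b y = g y" using assms(1,3,5) sign[OF g] sign[OF h] by force
    thus ?thesis using mult[OF h assms(2)] assms(4) by (intro bexI[of _ "h * b"]) auto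
  qed
qed

lemma indecomposable_single: "indecomposable G {y}"
  unfolding indecomposable_def
proof (rule notI, elim exE conjE)
  fix Y Z assume YZ: "Y \<noteq> {}" "Z \<noteq> {}" "{y} = Y \<union> Z" "splits G Y Z"
  have "Y = {y} \<and> Z = {y}" using YZ(1,2) YZ(3)[symmetric] by (simp add: Un_singleton_iff)
  thus False using splits_disjoint[OF YZ(4)] by simp
qed

text \<open>Among the sets containing \<open>y\<close> that split from their complement take a
  smallest one. A splitting of it, glued with its own splitting from the rest of \<open>X\<close>,
  would give a smaller one.\<close>

lemma component:
  assumes "finite X" "y \<in> X"
  obtains C where "y \<in> C" "C \<subseteq> X" "splits G C (X - C)" "indecomposable G C"
proof -
  define P where "P = (\<lambda>C. y \<in> C \<and> C \<subseteq> X \<and> splits G C (X - C))"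
  have "P X" using assms(2) unfolding P_def splits_def by auto
  then obtain C where C: "P C" and min: "\<And>C'. P C' \<Longrightarrow> card C \<le> card C'"
    using ex_has_least_nat[of P X card] by blast
  have CP: "y \<in> C" "C \<subseteq> X" "splits G C (X - C)" using C by (simp_all add: P_def)
  have "indecomposable G C"
  proof (rule ccontr)
    assume "\<not> ?thesis"
    then obtain Y Z where YZ: "Y \<noteq> {}" "Z \<noteq> {}" "C = Y \<union> Z" "splits G Y Z"
      by (auto simp: indecomposable_def)
    have aux: False if PQ: "P' \<noteq> {}" "Q' \<noteq> {}" "C = P' \<union> Q'" "splits G P' Q'" "y \<in> P'" for P' Q'
    proof -
      have disj: "P' \<inter> Q' = {}" using splits_disjoint[OF PQ(4)] .
      have "splits G P' (X - P')"
        unfolding splits_def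
      proof (intro ballI)
        fix g h assume g: "g \<in> G" and h: "h \<in> G"
        obtain k where k: "k \<in> G" "\<And>x. x \<in> P' \<Longrightarrow> k x = g x" "\<And>x. x \<in> Q' \<Longrightarrow> k x = h x"
          using splitsD[OF PQ(4) g h] by blast
        obtain l where l: "l \<in> G" "\<And>x. x \<in> C \<Longrightarrow> l x = k x" "\<And>x. x \<in> X - C \<Longrightarrow> l x = h x"
          using splitsD[OF CP(3) k(1) h] by blast
        show "\<exists>k\<in>G. (\<forall>x\<in>P'. k x = g x) \<and> (\<forall>x\<in>X - P'. k x = h x)"
        proof (intro bexI[of _ l] conjI ballI)
          fix x assume "x \<in> P'" thus "l x = g x" using l(2) k(2) PQ(3) by auto
        next
          fix x assume "x \<in> X - P'" thus "l x = h x"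
            using l(2)[of x] l(3)[of x] k(3)[of x] PQ(3) by auto
        qed (fact l)
      qed
      hence "P P'" using CP(2) PQ(3,5) by (simp add: P_def)
      moreover have "card P' < card C"
      proof (rule psubset_card_mono)
        show "finite C" using CP(2) assms(1) by (rule finite_subset)
        show "P' \<subset> C" using PQ(2,3) disj by auto
      qed
      ultimately show False using min[of P'] by simp
    qed
    have "y \<in> Y \<or> y \<in> Z" using CP(1) YZ(3) by simp
    moreover have "C = Z \<union> Y" using YZ(3) by auto
    ultimately show False using aux[OF YZ(1-4)] aux[OF YZ(2,1) _ splits_commute[OF YZ(4)]] by auto
  qed
  thus thesis using that[OF CP] by blast
qed

section \<open>Characters that keep some points inside the space\<close>

lemma translation_minus:
  assumes "sign_character G \<alpha>" "x \<in> X" "y \<in> X" "shifted G \<alpha> x y" "g \<in> G"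
  shows "\<alpha> (- g) = \<alpha> g"
  using shiftedD[OF assms(4,5)] shiftedD[OF assms(4) minus[OF assms(5)]]
    sign[OF assms(5,2)] sign[OF assms(5,3)] by auto

text \<open>The implication from \<open>a\<close> to \<open>c\<close> is used both at
  \<open>z\<close> and at its translate \<open>w\<close>, where the signs are changed by
  \<open>\<alpha> a\<close> and \<open>\<alpha> c\<close>.\<close>

lemma shift_implication:
  assumes \<alpha>: "sign_character G \<alpha>" and zw: "z \<in> X" "w \<in> X" "shifted G \<alpha> z w"
    and ac: "a \<in> G" "c \<in> G" "\<forall>x\<in>X. a x = 1 \<longrightarrow> c x = 1"
  shows "\<lbrakk>\<alpha> a = 1; \<alpha> c = - 1\<rbrakk> \<Longrightarrow> a z = - 1"
    and "\<lbrakk>\<alpha> a = - 1; \<alpha> c = 1\<rbrakk> \<Longrightarrow> c z = 1"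
    and "\<lbrakk>\<alpha> a = - 1; \<alpha> c = - 1\<rbrakk> \<Longrightarrow> a z = c z"
proof -
  note s = sign[OF ac(1) zw(1)] sign[OF ac(2) zw(1)]
  note w = shiftedD[OF zw(3) ac(1)] shiftedD[OF zw(3) ac(2)]
  note i = ac(3)[rule_format, OF zw(1)] ac(3)[rule_format, OF zw(2)]
  show "\<lbrakk>\<alpha> a = 1; \<alpha> c = - 1\<rbrakk> \<Longrightarrow> a z = - 1" using s w i by auto
  show "\<lbrakk>\<alpha> a = - 1; \<alpha> c = 1\<rbrakk> \<Longrightarrow> c z = 1" using s w i by auto
  show "\<lbrakk>\<alpha> a = - 1; \<alpha> c = - 1\<rbrakk> \<Longrightarrow> a z = c z" using s w i by auto
qed

text \<open>If the product of \<open>\<alpha>\<close> and \<open>z\<close> is not a point, it must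
  violate the last condition of (AX2); \<open>a\<close> and \<open>c\<close> are the
  violation.\<close>

lemma no_shift_witness:
  assumes \<alpha>: "sign_character G \<alpha>" "\<alpha> (- 1) = 1" and z: "z \<in> X"
    and no: "\<not> (\<exists>w\<in>X. shifted G \<alpha> z w)"
  obtains a c where "a \<in> G" "c \<in> G" "\<alpha> a * a z = 1" "\<alpha> c * c z = - 1"
    "\<forall>x\<in>X. a x = 1 \<longrightarrow> c x = 1"
proof (rule ccontr)
  assume neg: "\<not> thesis"
  have "\<exists>w\<in>X. \<forall>g\<in>G. \<alpha> g * g z = g w"
  proof (rule character_point)
    fix a assume a: "a \<in> G"
    show "\<alpha> a * a z = 1 \<or> \<alpha> a * a z = - 1"
      using sign[OF a z] sign_characterD(1)[OF \<alpha>(1) a] by auto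
  next
    fix a b assume "a \<in> G" "b \<in> G"
    thus "\<alpha> (a * b) * (a * b) z = \<alpha> a * a z * (\<alpha> b * b z)"
      using sign_characterD(2)[OF \<alpha>(1)] by simp
  next
    show "\<alpha> (- 1) * (- 1) z = - 1" using \<alpha>(2) by simp
  next
    fix a c assume ac: "a \<in> G" "c \<in> G" "\<alpha> a * a z = 1" "\<forall>x\<in>X. a x = 1 \<longrightarrow> c x = 1"
    have "\<alpha> c * c z = 1 \<or> \<alpha> c * c z = - 1"
      using sign[OF ac(2) z] sign_characterD(1)[OF \<alpha>(1) ac(2)] by auto
    thus "\<alpha> c * c z = 1" using that[OF ac(1,2,3) _ ac(4)] neg by blast
  qed
  thus False using no unfolding shifted_def by metis
qed

text \<open>If the translate of \<open>z\<close> is missing, take the witnesses \<open>a\<close>,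
  \<open>c\<close> of this. Depending on \<open>\<alpha> a\<close> and \<open>\<alpha> c\<close>,
  one of \<open>- a\<close>, \<open>c\<close>, \<open>a * c\<close> is 1 at all points whose
  translate exists and -1 at \<open>z\<close>.\<close>

lemma flat_shift:
  assumes \<alpha>: "sign_character G \<alpha>"
    and x0: "x0 \<in> X" "y0 \<in> X" "shifted G \<alpha> x0 y0"
  shows "flat X G {x\<in>X. \<exists>y\<in>X. shifted G \<alpha> x y}" (is "flat X G ?Y")
proof (rule flatI)
  show "?Y \<subseteq> X" by auto
  fix z assume z: "z \<in> X" and ann: "\<And>g. \<lbrakk>g \<in> G; \<forall>y\<in>?Y. g y = 1\<rbrakk> \<Longrightarrow> g z = 1"
  show "z \<in> ?Y"
  proof (rule ccontr)
    assume "z \<notin> ?Y"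
    hence no: "\<not> (\<exists>w\<in>X. shifted G \<alpha> z w)" using z by blast
    have m1: "\<alpha> (- 1) = 1"
      using shiftedD[OF x0(3) minus_one] by simp
    obtain a c where ac: "a \<in> G" "c \<in> G" "\<alpha> a * a z = 1" "\<alpha> c * c z = - 1"
        "\<forall>x\<in>X. a x = 1 \<longrightarrow> c x = 1"
      using no_shift_witness[OF \<alpha> m1 z no] by metis
    note imp = shift_implication[OF \<alpha> _ _ _ ac(1,2,5)]
    consider "\<alpha> a = 1" "a z = 1" | "\<alpha> a = - 1" "a z = - 1"
      using ac(3) sign[OF ac(1) z] sign_characterD(1)[OF \<alpha> ac(1)] by auto
    thus False
    proof cases
      case 1
      hence "c z = 1" using ac(5) z by blast
      hence "\<alpha> c = - 1" using ac(4) by simp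
      hence "\<forall>y\<in>?Y. (- a) y = 1" using imp(1)[OF _ _ _ 1(1)] by auto
      hence "(- a) z = 1" by (rule ann[OF minus[OF ac(1)]])
      thus False using 1 by simp
    next
      case 2
      show False
      proof (cases "\<alpha> c = 1")
        case True
        hence "\<forall>y\<in>?Y. c y = 1" using imp(2)[OF _ _ _ 2(1)] by auto
        hence "c z = 1" by (rule ann[OF ac(2)])
        thus False using ac(4) True by simp
      next
        case False
        hence c: "\<alpha> c = - 1" using sign_characterD(1)[OF \<alpha> ac(2)] by auto
        have "\<forall>y\<in>?Y. (a * c) y = 1"
          using imp(3)[OF _ _ _ 2(1) c] sq[OF ac(2)] by auto
        hence "(a * c) z = 1" by (rule ann[OF mult[OF ac(1,2)]])
        thus False using 2 c ac(4) by simp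
      qed
    qed
  qed
qed

text \<open>The same three cases as for \<open>flat_shift\<close>, now keeping the second function
  as well: the pair \<open>c\<close>, \<open>d\<close> of the conclusion is (c, -a), (-a, c) or (-a,
  a c) in terms of the witnesses. The resulting \<open>c\<close> is later used to cut
  \<open>Y\<close> into two translates.\<close>

lemma no_shift_separation:
  assumes \<alpha>: "translation G Y \<alpha>" and Y: "Y \<subseteq> X" "Y \<noteq> {}" and z: "z \<in> X"
    and no: "\<not> (\<exists>w\<in>X. shifted G \<alpha> z w)"
  obtains c d where "c \<in> G" "d \<in> G" "\<alpha> c = - 1" "d z = - 1" "\<forall>y\<in>Y. d y = 1"
    "\<forall>x\<in>X. d x = - 1 \<longrightarrow> c x = 1"
proof -
  have ch: "sign_character G \<alpha>" and sh: "\<And>y. y \<in> Y \<Longrightarrow> \<exists>w\<in>X. shifted G \<alpha> y w"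
    using \<alpha> Y(1) unfolding translation_def by blast+
  obtain x0 y0 where x0: "x0 \<in> X" "y0 \<in> X" "shifted G \<alpha> x0 y0" using sh Y by blast
  have m1: "\<alpha> (- 1) = 1" using shiftedD[OF x0(3) minus_one] by simp
  obtain a c where ac: "a \<in> G" "c \<in> G" "\<alpha> a * a z = 1" "\<alpha> c * c z = - 1"
      "\<forall>x\<in>X. a x = 1 \<longrightarrow> c x = 1"
    using no_shift_witness[OF ch m1 z no] by metis
  have imp: "\<lbrakk>\<alpha> a = 1; \<alpha> c = - 1\<rbrakk> \<Longrightarrow> a y = - 1" "\<lbrakk>\<alpha> a = - 1; \<alpha> c = 1\<rbrakk> \<Longrightarrow> c y = 1"
    "\<lbrakk>\<alpha> a = - 1; \<alpha> c = - 1\<rbrakk> \<Longrightarrow> a y = c y" if y: "y \<in> Y" for y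
  proof -
    obtain w where w: "w \<in> X" "shifted G \<alpha> y w" using sh[OF y] by blast
    have "y \<in> X" using y Y(1) by blast
    from shift_implication[OF ch this w ac(1,2,5)]
    show "\<lbrakk>\<alpha> a = 1; \<alpha> c = - 1\<rbrakk> \<Longrightarrow> a y = - 1" "\<lbrakk>\<alpha> a = - 1; \<alpha> c = 1\<rbrakk> \<Longrightarrow> c y = 1"
      "\<lbrakk>\<alpha> a = - 1; \<alpha> c = - 1\<rbrakk> \<Longrightarrow> a y = c y" by simp_all
  qed
  consider "\<alpha> a = 1" "a z = 1" | "\<alpha> a = - 1" "a z = - 1"
    using ac(3) sign[OF ac(1) z] sign_characterD(1)[OF ch ac(1)] by auto
  thus thesis
  proof cases
    case 1
    hence "c z = 1" using ac(5) z by blast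
    hence "\<alpha> c = - 1" using ac(4) by simp
    thus ?thesis using that[OF ac(2) minus[OF ac(1)]] 1 imp(1) ac(5) by auto
  next
    case 2
    have ma: "\<alpha> (- a) = - 1" using translation_minus[OF ch x0 ac(1)] 2 by simp
    show ?thesis
    proof (cases "\<alpha> c = 1")
      case True
      have "c z = - 1" using True ac(4) by simp
      moreover have "\<forall>x\<in>X. c x = - 1 \<longrightarrow> (- a) x = 1"
        using ac(5) sign[OF ac(1)] by fastforce
      ultimately show ?thesis
        using that[OF minus[OF ac(1)] ac(2) ma] imp(2) 2 True by blast
    next
      case False
      hence c: "\<alpha> c = - 1" using sign_characterD(1)[OF ch ac(2)] by auto
      have "(a * c) z = - 1" using c ac(4) 2 by simp
      moreover have "\<forall>x\<in>X. (a * c) x = - 1 \<longrightarrow> (- a) x = 1"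
        using ac(5) sign[OF ac(1)] by fastforce
      moreover have "\<forall>y\<in>Y. (a * c) y = 1"
        using imp(3)[OF _ 2(1) c] sq[OF ac(2)] Y(1) by auto
      ultimately show ?thesis
        using that[OF minus[OF ac(1)] mult[OF ac(1,2)] ma] by blast
    qed
  qed
qed

end

text \<open>
  Think of \<open>E\<close> as the even and \<open>O\<close> as the odd words of a binary code on \<open>R\<close>. The words
  meeting a minimal hitting set \<open>\<rho>\<close> in one point form a basis; the hypothesis \<open>below\<close> makes these
  basis words odd and pairwise disjoint.
\<close>

lemma odd_singletons:
  fixes E O' :: "'a set set" and R :: "'a set"
  defines "sd \<equiv> \<lambda>A B :: 'a set. (A - B) \<union> (B - A)"
  assumes fin: "finite R" and sub: "\<And>w. w \<in> E \<union> O' \<Longrightarrow> w \<subseteq> R"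
    and ee: "\<And>a b. \<lbrakk>a \<in> E; b \<in> E\<rbrakk> \<Longrightarrow> sd a b \<in> E"
    and eo: "\<And>a b. \<lbrakk>a \<in> E; b \<in> O'\<rbrakk> \<Longrightarrow> sd a b \<in> O'"
    and oo: "\<And>a b. \<lbrakk>a \<in> O'; b \<in> O'\<rbrakk> \<Longrightarrow> sd a b \<in> E"
    and nonempty: "{} \<notin> O'"
    and below: "\<And>a. \<lbrakk>a \<in> E; a \<noteq> {}\<rbrakk> \<Longrightarrow> \<exists>c\<in>O'. c \<subseteq> a"
    and separates: "\<And>r s. \<lbrakk>r \<in> R; s \<in> R; r \<noteq> s\<rbrakk> \<Longrightarrow> \<exists>a\<in>E. r \<in> a \<and> s \<notin> a"
    and cover: "\<And>r. r \<in> R \<Longrightarrow> \<exists>a\<in>E. r \<in> a"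
    and r: "r \<in> R"
  shows "{r} \<in> O'"
proof -
  define L where "L = E \<union> O'"
  have sd_comm: "sd a b = sd b a" for a b by (auto simp: sd_def)
  have LL: "sd a b \<in> L" if "a \<in> L" "b \<in> L" for a b
    using that ee eo oo sd_comm[of a b] unfolding L_def by (metis Un_iff)
  define hits where "hits = (\<lambda>\<rho>. \<rho> \<subseteq> R \<and> (\<forall>w\<in>L. w \<noteq> {} \<longrightarrow> w \<inter> \<rho> \<noteq> {}))"
  have "hits R" using sub unfolding hits_def L_def by blast
  then obtain \<rho> where \<rho>: "hits \<rho>" and min: "\<And>\<rho>'. hits \<rho>' \<Longrightarrow> card \<rho> \<le> card \<rho>'"
    using ex_has_least_nat[of hits R card] by blast
  have \<rho>R: "\<rho> \<subseteq> R" and hit: "\<And>w. \<lbrakk>w \<in> L; w \<inter> \<rho> = {}\<rbrakk> \<Longrightarrow> w = {}"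
    using \<rho> by (auto simp: hits_def)
  have hit_odd: "c \<inter> \<rho> \<noteq> {}" if "c \<in> O'" for c
    using hit[of c] that nonempty by (auto simp: L_def)
  have fin\<rho>: "finite \<rho>" using \<rho>R fin by (rule finite_subset)
  \<comment> \<open>Removing from an even word an odd word inside it leaves an odd word.\<close>
  have split: "\<exists>c\<in>O'. \<exists>c'\<in>O'. c \<inter> c' = {} \<and> a = c \<union> c'" if "a \<in> E" "a \<noteq> {}" for a
  proof -
    obtain c where c: "c \<in> O'" "c \<subseteq> a" using below \<open>a \<in> E\<close> \<open>a \<noteq> {}\<close> by blast
    have "sd a c \<in> O'" using eo[OF \<open>a \<in> E\<close> c(1)] .
    thus ?thesis using c by (intro bexI[of _ c] bexI[of _ "sd a c"]) (auto simp: sd_def)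
  qed
  have unique: "u = w" if "u \<in> L" "w \<in> L" "u \<inter> \<rho> = w \<inter> \<rho>" for u w
  proof -
    have "sd u w \<inter> \<rho> = {}" using that(3) by (auto simp: sd_def)
    hence "sd u w = {}" using hit LL that by blast
    thus ?thesis by (auto simp: sd_def)
  qed
  have "\<exists>w\<in>O'. w \<inter> \<rho> = {s}" if s: "s \<in> \<rho>" for s
  proof -
    have "card (\<rho> - {s}) < card \<rho>" using card_Diff1_less[OF fin\<rho> s] .
    hence "\<not> hits (\<rho> - {s})" using min by fastforce
    then obtain w where w: "w \<in> L" "w \<noteq> {}" "w \<inter> (\<rho> - {s}) = {}"
      using \<rho>R unfolding hits_def by blast
    have ws: "w \<inter> \<rho> = {s}" using hit[OF w(1)] w(2,3) by blast
    \<comment> \<open>An even \<open>w\<close> would be the disjoint union of two odd words, and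
      both would have to contain \<open>s\<close>, the only point at which \<open>w\<close> meets
      \<open>\<rho>\<close>.\<close>
    have "w \<notin> E"
    proof
      assume "w \<in> E"
      then obtain c c' where c: "c \<in> O'" "c' \<in> O'" "c \<inter> c' = {}" "w = c \<union> c'"
        using split w(2) by blast
      have "c \<inter> \<rho> \<subseteq> {s}" "c' \<inter> \<rho> \<subseteq> {s}" using ws c(4) by auto
      hence "s \<in> c" "s \<in> c'" using hit_odd[OF c(1)] hit_odd[OF c(2)] by auto
      thus False using c(3) by auto
    qed
    thus ?thesis using w(1) ws unfolding L_def by blast
  qed
  then obtain b where b: "\<And>s. s \<in> \<rho> \<Longrightarrow> b s \<in> O'" "\<And>s. s \<in> \<rho> \<Longrightarrow> b s \<inter> \<rho> = {s}"
    by metis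
  have bL: "b s \<in> L" if "s \<in> \<rho>" for s using b that by (auto simp: L_def)
  \<comment> \<open>The even word \<open>sd (b s) (b t)\<close> is a disjoint union of two odd
    words, each meeting \<open>\<rho>\<close> in just one of \<open>s\<close>, \<open>t\<close>. So
    one of \<open>b s\<close>, \<open>b t\<close> lies inside their symmetric difference.\<close>
  have disj: "b s \<inter> b t = {}" if st: "s \<in> \<rho>" "t \<in> \<rho>" "s \<noteq> t" for s t
  proof -
    have s: "sd (b s) (b t) \<inter> \<rho> = {s, t}" using b(2)[OF st(1)] b(2)[OF st(2)] st by (auto simp: sd_def)
    have "sd (b s) (b t) \<in> E" using oo b(1) st by blast
    then obtain c c' where c: "c \<in> O'" "c' \<in> O'" "c \<inter> c' = {}" "sd (b s) (b t) = c \<union> c'"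
      using split s by blast
    have ne: "c \<inter> \<rho> \<noteq> {}" "c' \<inter> \<rho> \<noteq> {}" using hit_odd c(1,2) by simp_all
    have un: "c \<inter> \<rho> \<union> c' \<inter> \<rho> = {s, t}" "(c \<inter> \<rho>) \<inter> (c' \<inter> \<rho>) = {}" using c s by auto
    obtain p where p: "p \<in> c" "p \<in> \<rho>" using ne(1) by auto
    obtain p' where p': "p' \<in> c'" "p' \<in> \<rho>" using ne(2) by auto
    have sub: "c \<inter> \<rho> \<subseteq> {s, t}" "c' \<inter> \<rho> \<subseteq> {s, t}" using un(1) by auto
    have "p \<in> {s, t}" "p' \<in> {s, t}" "p' \<notin> c" using sub p p' c(3) by auto
    hence "c \<inter> \<rho> = {p}" "p = s \<or> p = t" using sub(1) p by auto
    hence "c \<inter> \<rho> = {s} \<or> c \<inter> \<rho> = {t}" by metis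
    moreover have "c \<in> L" using c(1) by (simp add: L_def)
    ultimately have "c = b s \<or> c = b t"
      using unique[OF _ bL[OF st(1)]] unique[OF _ bL[OF st(2)]] b(2) st by metis
    moreover have "c \<subseteq> sd (b s) (b t)" using c by blast
    ultimately show ?thesis by (auto simp: sd_def)
  qed
  have span: "w = (\<Union>s\<in>w \<inter> \<rho>. b s)" if "w \<in> L" for w
    using that
  proof (induction "card (w \<inter> \<rho>)" arbitrary: w)
    case 0
    hence "w \<inter> \<rho> = {}" using fin\<rho> by simp
    thus ?case using hit 0 by simp
  next
    case (Suc n)
    then obtain s where s: "s \<in> w" "s \<in> \<rho>" by (metis IntE card.empty equals0I nat.distinct(1))
    have w': "sd w (b s) \<inter> \<rho> = w \<inter> \<rho> - {s}" using b(2)[OF s(2)] s by (auto simp: sd_def)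
    hence "n = card (sd w (b s) \<inter> \<rho>)" using Suc.hyps(2) s fin\<rho> by simp
    hence IH: "sd w (b s) = (\<Union>t\<in>w \<inter> \<rho> - {s}. b t)" using Suc.hyps(1)[OF _ LL[OF Suc.prems bL[OF s(2)]]] w' by simp
    hence "sd w (b s) \<inter> b s = {}" using disj s by blast
    hence "w = sd w (b s) \<union> b s" by (auto simp: sd_def)
    also have "\<dots> = (\<Union>t\<in>w \<inter> \<rho>. b t)" unfolding IH using s by blast
    finally show ?case .
  qed
  \<comment> \<open>By \<open>span\<close>, a word containing \<open>s\<close> contains all of
    \<open>b s\<close>, so no even word could separate \<open>s\<close> from a second point of
    \<open>b s\<close>.\<close>
  have single: "b s = {s}" if s: "s \<in> \<rho>" for s
  proof (rule ccontr)
    assume "b s \<noteq> {s}"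
    then obtain e where e: "e \<in> b s" "e \<noteq> s" using b(2)[OF s] by blast
    have "e \<in> R" "s \<in> R" using e bL[OF s] sub s \<rho>R unfolding L_def by blast+
    then obtain a where a: "a \<in> E" "s \<in> a" "e \<notin> a" using separates e(2) by metis
    hence "b s \<subseteq> a" using span[of a] s unfolding L_def by blast
    thus False using e a by blast
  qed
  obtain a where a: "a \<in> E" "r \<in> a" using cover r by blast
  then obtain s where "s \<in> \<rho>" "r \<in> b s" using span[of a] unfolding L_def by blast
  thus ?thesis using single b(1) by force
qed

section \<open>The structure of finite sign spaces\<close>

locale maximal_flat = sign_space +
  fixes Y :: "'a set"
  assumes finite_X: "finite X" and connected: "indecomposable G X"
    and flat_Y: "flat X G Y" and Y_nonempty: "Y \<noteq> {}" and Y_proper: "Y \<noteq> X"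
    and connected_Y: "indecomposable G Y"
    and maximal: "\<lbrakk>flat X G W; indecomposable G W; Y \<subseteq> W; W \<noteq> X\<rbrakk> \<Longrightarrow> W = Y"
begin

lemma Y_subset: "Y \<subseteq> X"
  using flat_subset[OF flat_Y] .

lemma space_Y: "sign_space Y G"
  using sign_space_flat[OF flat_Y Y_nonempty] .

lemma not_splits: "\<not> splits G Y (X - Y)"
proof
  assume "splits G Y (X - Y)"
  moreover have "X = Y \<union> (X - Y)" using Y_subset by blast
  ultimately have "Y = {} \<or> X - Y = {}" using indecomposableD[OF connected] by blast
  thus False using Y_nonempty Y_subset Y_proper by blast
qed

text \<open>The component of \<open>W\<close> that meets \<open>Y\<close> contains the
  indecomposable \<open>Y\<close>, is itself a proper indecomposable flat of \<open>X\<close>, and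
  so equals \<open>Y\<close>. This is why \<open>Y\<close> is chosen maximal among indecomposable
  flats and not among all proper flats.\<close>

lemma splits_above:
  assumes W: "flat X G W" "Y \<subseteq> W" "W \<noteq> X"
  shows "splits G Y (W - Y)"
proof -
  obtain y where y: "y \<in> Y" using Y_nonempty by blast
  have WX: "W \<subseteq> X" using flat_subset[OF W(1)] .
  interpret W: sign_space W G
    using sign_space_flat[OF W(1)] y W(2) by blast
  have "finite W" using WX finite_X by (rule finite_subset)
  moreover have "y \<in> W" using y W(2) by blast
  ultimately obtain C where C: "y \<in> C" "C \<subseteq> W" "splits G C (W - C)" "indecomposable G C"
    by (rule W.component)
  have "Y \<subseteq> C \<or> Y \<subseteq> W - C"
    by (rule indecomposable_subset[OF connected_Y _ C(3)]) (use W(2) in blast)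
  hence "Y \<subseteq> C" using y C(1) by blast
  moreover have "flat X G C" using flat_trans[OF W(1) W.splits_flat[OF C(3,2)]] .
  moreover have "C \<noteq> X" using C(2) W(3) WX by blast
  ultimately have "C = Y" using maximal C(4) by blast
  thus ?thesis using C(3) by simp
qed

lemma annihilator_negative:
  assumes "r \<in> X - Y"
  obtains a where "a \<in> G" "\<forall>y\<in>Y. a y = 1" "a r = - 1"
proof (rule ccontr)
  assume neg: "\<not> thesis"
  have "r \<in> Y"
  proof (rule flatD[OF flat_Y])
    show "r \<in> X" using assms by blast
    fix g assume g: "g \<in> G" "\<forall>y\<in>Y. g y = 1"
    have "g r = 1 \<or> g r = - 1" using sign[OF g(1)] assms by blast
    thus "g r = 1" using that[OF g] neg by blast
  qed
  thus False using assms by blast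
qed

subsection \<open>Flats of codimension at least two\<close>

text \<open>\<open>g\<close> shows that the annihilator of \<open>Y\<close> has rank at least two.
  Hence the flat \<open>W\<close> spanned by \<open>Y\<close> and \<open>r\<close> is proper, so
  \<open>Y\<close> splits off from it, and an element separating \<open>r\<close> from
  \<open>s\<close> inside \<open>W\<close> can be replaced by 1 on \<open>Y\<close>.\<close>

lemma annihilator_separates:
  assumes g: "g \<in> G" "\<forall>y\<in>Y. g y = 1" "r0 \<in> X - Y" "s0 \<in> X - Y" "g r0 = 1" "g s0 = - 1"
    and rs: "r \<in> X - Y" "s \<in> X - Y" "r \<noteq> s"
  obtains a where "a \<in> G" "\<forall>y\<in>Y. a y = 1" "a r = 1" "a s = - 1"
proof (rule ccontr)
  note witness = that
  assume neg: "\<not> thesis"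
  define W where "W = {x\<in>X. \<forall>a\<in>G. (\<forall>y\<in>Y. a y = 1) \<longrightarrow> a r = 1 \<longrightarrow> a x = 1}"
  have W: "flat X G W"
  proof (rule flatI)
    show "W \<subseteq> X" by (auto simp: W_def)
    fix x assume x: "x \<in> X" and ann: "\<And>g. \<lbrakk>g \<in> G; \<forall>y\<in>W. g y = 1\<rbrakk> \<Longrightarrow> g x = 1"
    have "a x = 1" if a: "a \<in> G" "\<forall>y\<in>Y. a y = 1" "a r = 1" for a
      by (rule ann[OF a(1)]) (use a in \<open>auto simp: W_def\<close>)
    thus "x \<in> W" using x by (simp add: W_def)
  qed
  have YW: "Y \<subseteq> W" using Y_subset by (auto simp: W_def)
  have rW: "r \<in> W" using rs by (auto simp: W_def)
  have sW: "s \<in> W"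
  proof -
    have "a s = 1" if a: "a \<in> G" "\<forall>y\<in>Y. a y = 1" "a r = 1" for a
    proof -
      have "a s = 1 \<or> a s = - 1" using sign[OF a(1)] rs(2) by blast
      thus ?thesis using witness[OF a] neg by blast
    qed
    thus ?thesis using rs(2) by (auto simp: W_def)
  qed
  obtain b where b: "b \<in> G" "\<forall>y\<in>Y. b y = 1" "b r0 = - 1"
    using annihilator_negative[OF g(3)] by blast
  have vals: "b r = 1 \<or> b r = - 1" "g r = 1 \<or> g r = - 1"
    using sign[OF b(1)] sign[OF g(1)] rs(1) by blast+
  \<comment> \<open>If \<open>W = X\<close>, an annihilating element that is 1 at \<open>r\<close>
    is 1 everywhere. Then \<open>g\<close> and \<open>b\<close> are both -1 at \<open>r\<close>, so
    \<open>g * b\<close> is trivial, although it is -1 at \<open>r0\<close>.\<close>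
  have "W \<noteq> X"
  proof
    assume "W = X"
    hence all: "a x = 1" if "a \<in> G" "\<forall>y\<in>Y. a y = 1" "a r = 1" "x \<in> X" for a x
      using that by (auto simp: W_def)
    have "g r \<noteq> 1" using all[OF g(1,2), of s0] g(4,6) by auto
    moreover have "b r \<noteq> 1" using all[OF b(1,2), of r0] g(3) b(3) by auto
    ultimately have "(g * b) r = 1" using vals by simp
    moreover have "\<forall>y\<in>Y. (g * b) y = 1" using g(2) b(2) by simp
    ultimately have "(g * b) r0 = 1" using all[OF mult[OF g(1) b(1)]] g(3) by blast
    thus False using g(5) b(3) by simp
  qed
  hence sp: "splits G Y (W - Y)" using splits_above[OF W YW] by blast
  obtain h where h: "h \<in> G" "h r = 1" "h s = - 1"
    using normalized_separates[of r s] rs by blast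
  obtain k where k: "k \<in> G" "\<forall>y\<in>Y. k y = 1 y" "\<forall>x\<in>W - Y. k x = h x"
    using splitsD[OF sp one h(1)] by blast
  have "k r = 1" "k s = - 1" using k(3) h rW sW rs by auto
  thus False using witness[OF k(1)] k(2) neg by simp
qed

text \<open>\<open>g0\<close> restricted to \<open>Y\<close> does not extend to \<open>X\<close> by
  1; it is the product of two elements that cannot be glued. The negative sets outside
  \<open>Y\<close> of the elements equal to 1 on \<open>Y\<close> are the even words of
  \<open>odd_singletons\<close>, those of the elements equal to \<open>g0\<close> on
  \<open>Y\<close> the odd words.\<close>

lemma odd_functions:
  assumes g: "g \<in> G" "\<forall>y\<in>Y. g y = 1" "r0 \<in> X - Y" "s0 \<in> X - Y" "g r0 = 1" "g s0 = - 1"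
  shows "\<exists>g0\<in>G. \<not> (\<exists>k\<in>G. (\<forall>y\<in>Y. k y = g0 y) \<and> (\<forall>x\<in>X - Y. k x = 1)) \<and>
    (\<exists>f. \<forall>r\<in>X - Y. f r \<in> G \<and> (\<forall>y\<in>Y. f r y = g0 y) \<and>
      (\<forall>x\<in>X - Y. f r x = (if x = r then - 1 else 1)))"
proof -
  let ?R = "X - Y"
  define glue where "glue = (\<lambda>g h. \<exists>k\<in>G. (\<forall>x\<in>Y. k x = g x) \<and> (\<forall>x\<in>X - Y. k x = h x))"
  have "\<not> (\<forall>g\<in>G. \<forall>h\<in>G. glue g h)"
    using not_splits by (simp add: splits_def glue_def)
  then obtain g1 g2 where g12: "g1 \<in> G" "g2 \<in> G" and no: "\<not> glue g1 g2"
    by blast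
  define g0 where "g0 = g1 * g2"
  have g0: "g0 \<in> G" using mult[OF g12] by (simp add: g0_def)
  have no0: False if k: "k \<in> G" "\<forall>y\<in>Y. k y = g0 y" "\<forall>x\<in>X - Y. k x = 1" for k
  proof -
    have "\<forall>x\<in>Y. (k * g2) x = g1 x" using k(2) sq[OF g12(2)] Y_subset by (auto simp: g0_def mult.assoc)
    moreover have "\<forall>x\<in>X - Y. (k * g2) x = g2 x" using k(3) by simp
    ultimately have "glue g1 g2" unfolding glue_def by (intro bexI[OF _ mult[OF k(1) g12(2)]] conjI)
    thus False using no by simp
  qed
  define neg where "neg = (\<lambda>f :: 'a \<Rightarrow> int. {x\<in>?R. f x = - 1})"
  define E where "E = neg ` {f\<in>G. \<forall>y\<in>Y. f y = 1}"
  define O' where "O' = neg ` {f\<in>G. \<forall>y\<in>Y. f y = g0 y}"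
  have neg_mult: "(neg f - neg h) \<union> (neg h - neg f) = neg (f * h)" if "f \<in> G" "h \<in> G" for f h
  proof -
    have "(f x = - 1 \<and> h x \<noteq> - 1 \<or> h x = - 1 \<and> f x \<noteq> - 1) \<longleftrightarrow> (f * h) x = - 1" if "x \<in> ?R" for x
      using sign[OF \<open>f \<in> G\<close>, of x] sign[OF \<open>h \<in> G\<close>, of x] that by auto
    thus ?thesis unfolding neg_def by blast
  qed
  have single: "{r} \<in> O'" if "r \<in> ?R" for r
  proof (rule odd_singletons[of ?R E O'])
    show "finite ?R" using finite_X by simp
    show "w \<subseteq> ?R" if "w \<in> E \<union> O'" for w using that by (auto simp: E_def O'_def neg_def)
    show "(a - b) \<union> (b - a) \<in> E" if ab: "a \<in> E" "b \<in> E" for a b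
    proof -
      obtain f h where fh: "f \<in> G" "\<forall>y\<in>Y. f y = 1" "a = neg f" "h \<in> G" "\<forall>y\<in>Y. h y = 1" "b = neg h"
        using ab unfolding E_def by blast
      have "f * h \<in> {f\<in>G. \<forall>y\<in>Y. f y = 1}" using fh mult by simp
      thus ?thesis using neg_mult[OF fh(1,4)] fh(3,6) unfolding E_def by blast
    qed
    show "(a - b) \<union> (b - a) \<in> O'" if ab: "a \<in> E" "b \<in> O'" for a b
    proof -
      obtain f h where fh: "f \<in> G" "\<forall>y\<in>Y. f y = 1" "a = neg f" "h \<in> G" "\<forall>y\<in>Y. h y = g0 y" "b = neg h"
        using ab unfolding E_def O'_def by blast
      have "f * h \<in> {f\<in>G. \<forall>y\<in>Y. f y = g0 y}" using fh mult by simp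
      thus ?thesis using neg_mult[OF fh(1,4)] fh(3,6) unfolding O'_def by blast
    qed
    show "(a - b) \<union> (b - a) \<in> E" if ab: "a \<in> O'" "b \<in> O'" for a b
    proof -
      obtain f h where fh: "f \<in> G" "\<forall>y\<in>Y. f y = g0 y" "a = neg f" "h \<in> G" "\<forall>y\<in>Y. h y = g0 y" "b = neg h"
        using ab unfolding O'_def by blast
      have "f * h \<in> {f\<in>G. \<forall>y\<in>Y. f y = 1}" using fh mult sq[OF g0] Y_subset by auto
      thus ?thesis using neg_mult[OF fh(1,4)] fh(3,6) unfolding E_def by blast
    qed
    show "{} \<notin> O'"
    proof
      assume "{} \<in> O'"
      then obtain f where f: "f \<in> G" "\<forall>y\<in>Y. f y = g0 y" "neg f = {}" unfolding O'_def by auto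
      hence "\<forall>x\<in>?R. f x = 1" using sign[OF f(1)] unfolding neg_def by blast
      thus False using no0 f by blast
    qed
    \<comment> \<open>\<open>Y\<close> splits off from the proper flat on which \<open>f\<close> is
      1, so \<open>g0\<close> on \<open>Y\<close> can be glued with 1 there; this leaves negative
      points outside \<open>Y\<close> only where \<open>f\<close> is -1.\<close>
    show "\<exists>c\<in>O'. c \<subseteq> a" if a: "a \<in> E" "a \<noteq> {}" for a
    proof -
      obtain f where f: "f \<in> G" "\<forall>y\<in>Y. f y = 1" "a = neg f" using a unfolding E_def by blast
      let ?W = "{x\<in>X. f x = 1}"
      have "flat X G ?W" using flat_positive[OF flat_self f(1)] .
      moreover have "Y \<subseteq> ?W" using f(2) Y_subset by blast
      moreover have "?W \<noteq> X" using a(2) f(3) unfolding neg_def by force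
      ultimately have "splits G Y (?W - Y)" using splits_above by blast
      from splitsD[OF this g0 one]
      obtain k where k: "k \<in> G" "\<forall>x\<in>Y. k x = g0 x" "\<forall>x\<in>?W - Y. k x = 1 x" by blast
      have "neg k \<subseteq> a"
      proof
        fix x assume x: "x \<in> neg k"
        hence "x \<in> ?R" "k x = - 1" by (auto simp: neg_def)
        hence "f x \<noteq> 1" using k(3) by auto
        thus "x \<in> a" using sign[OF f(1)] \<open>x \<in> ?R\<close> f(3) by (auto simp: neg_def)
      qed
      thus ?thesis using k(1,2) unfolding O'_def by blast
    qed
    show "\<exists>a\<in>E. r \<in> a \<and> s \<notin> a" if rs: "r \<in> ?R" "s \<in> ?R" "r \<noteq> s" for r s
    proof -
      obtain a where "a \<in> G" "\<forall>y\<in>Y. a y = 1" "a s = 1" "a r = - 1"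
        using annihilator_separates[OF g rs(2,1)] rs(3) by blast
      thus ?thesis using rs unfolding E_def neg_def by force
    qed
    show "\<exists>a\<in>E. r \<in> a" if r: "r \<in> ?R" for r
    proof -
      obtain a where "a \<in> G" "\<forall>y\<in>Y. a y = 1" "a r = - 1"
        using annihilator_negative[OF r] by blast
      thus ?thesis using r unfolding E_def neg_def by force
    qed
  qed (fact that)
  have "\<forall>r\<in>?R. \<exists>k. k \<in> G \<and> (\<forall>y\<in>Y. k y = g0 y) \<and> (\<forall>x\<in>?R. k x = (if x = r then - 1 else 1))"
  proof
    fix r assume "r \<in> ?R"
    hence "{r} \<in> neg ` {f\<in>G. \<forall>y\<in>Y. f y = g0 y}" using single by (simp add: O'_def)
    then obtain k where k: "k \<in> G" "\<forall>y\<in>Y. k y = g0 y" "{r} = neg k" by blast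
    have "k x = (if x = r then - 1 else 1)" if x: "x \<in> ?R" for x
    proof -
      have "x = r \<longleftrightarrow> k x = - 1" using k(3) x unfolding neg_def by blast
      thus ?thesis using sign[OF k(1), of x] x by auto
    qed
    thus "\<exists>k. k \<in> G \<and> (\<forall>y\<in>Y. k y = g0 y) \<and> (\<forall>x\<in>?R. k x = (if x = r then - 1 else 1))"
      using k by (intro exI[of _ k]) simp
  qed
  note f = bchoice[OF this]
  show ?thesis
  proof (rule bexI[OF _ g0], rule conjI)
    show "\<not> (\<exists>k\<in>G. (\<forall>y\<in>Y. k y = g0 y) \<and> (\<forall>x\<in>?R. k x = 1))"
      using no0 by blast
  qed (rule f)
qed

text \<open>Products of the functions \<open>f r\<close> realize every even subset of the complement
  as the negative set of an element that is 1 on \<open>Y\<close>, while no single point is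
  realized. (AX3) then leaves only a space of four points whose product is trivial.\<close>

lemma translation_codim_two:
  assumes g: "g \<in> G" "\<forall>y\<in>Y. g y = 1" "r0 \<in> X - Y" "s0 \<in> X - Y" "g r0 = 1" "g s0 = - 1"
  shows "\<exists>\<alpha>. translation G X \<alpha>"
proof -
  let ?R = "X - Y"
  from odd_functions[OF g] obtain g0 where g0: "g0 \<in> G"
    and no0: "\<not> (\<exists>k\<in>G. (\<forall>y\<in>Y. k y = g0 y) \<and> (\<forall>x\<in>X - Y. k x = 1))"
    and ex: "\<exists>f. \<forall>r\<in>X - Y. f r \<in> G \<and> (\<forall>y\<in>Y. f r y = g0 y) \<and>
      (\<forall>x\<in>X - Y. f r x = (if x = r then - 1 else 1))"
    by (elim bexE conjE)
  from ex obtain f where f: "\<forall>r\<in>X - Y. f r \<in> G \<and> (\<forall>y\<in>Y. f r y = g0 y) \<and>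
      (\<forall>x\<in>X - Y. f r x = (if x = r then - 1 else 1))" ..
  have fG: "f r \<in> G" if "r \<in> ?R" for r using f that by simp
  have fY: "f r y = g0 y" if "r \<in> ?R" "y \<in> Y" for r y using f that by simp
  have fR: "f r x = (if x = r then - 1 else 1)" if "r \<in> ?R" "x \<in> ?R" for r x
    using f that by simp
  define e where "e = (\<lambda>r s. f r * f s)"
  have eG: "e r s \<in> G" if "r \<in> ?R" "s \<in> ?R" for r s
    using mult fG that by (simp add: e_def)
  have eY: "e r s y = 1" if "r \<in> ?R" "s \<in> ?R" "y \<in> Y" for r s y
    using that fY sq[OF g0] Y_subset by (auto simp: e_def)
  have eR: "e r s x = (if x = r then - 1 else 1) * (if x = s then - 1 else 1)"
    if "r \<in> ?R" "s \<in> ?R" "x \<in> ?R" for r s x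
    using that fR by (simp add: e_def)
  \<comment> \<open>Multiplied by \<open>f r\<close>, such a \<open>D\<close> would extend
    \<open>g0\<close> from \<open>Y\<close> by 1.\<close>
  have noodd: False if D: "D \<in> G" "r \<in> ?R" "\<And>y. y \<in> Y \<Longrightarrow> D y = 1" "D r = - 1"
      "\<And>x. \<lbrakk>x \<in> ?R; x \<noteq> r\<rbrakk> \<Longrightarrow> D x = 1" for D r
  proof -
    have "D * f r \<in> G" using mult[OF D(1) fG[OF D(2)]] .
    moreover have "\<forall>y\<in>Y. (D * f r) y = g0 y" using D(3) fY[OF D(2)] by simp
    moreover have "\<forall>x\<in>?R. (D * f r) x = 1"
    proof
      fix x assume x: "x \<in> ?R"
      show "(D * f r) x = 1" using D(4,5) fR[OF D(2) x] x by (cases "x = r") simp_all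
    qed
    ultimately show False using no0 by blast
  qed
  have signX: "D x = 1" if "D \<in> G" "x \<in> X" "D x \<noteq> - 1" for D x
    using sign[OF that(1,2)] that(3) by blast
  \<comment> \<open>Outside \<open>Y\<close> the functions \<open>?A\<close>, \<open>?B\<close>,
    \<open>?C\<close>, \<open>?K\<close> are negative, among the four points, at {r1,r2}, {r1,r3},
    {r2,r3,r4}, {r3}; on \<open>Y\<close> they are 1, 1, \<open>g0\<close>, \<open>g0\<close>. The
    exchanged element would be 1 on \<open>Y\<close> and negative at \<open>r1\<close>
    alone.\<close>
  have no4: False if r: "r1 \<in> ?R" "r2 \<in> ?R" "r3 \<in> ?R" "r4 \<in> ?R" and ne: "distinct [r1, r2, r3, r4]"
    for r1 r2 r3 r4
  proof -
    let ?A = "e r1 r2" and ?B = "e r1 r3" and ?C = "e r2 r3 * f r4" and ?K = "f r3"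
    have ineq: "r1 \<noteq> r2" "r1 \<noteq> r3" "r1 \<noteq> r4" "r2 \<noteq> r3" "r2 \<noteq> r4" "r3 \<noteq> r4"
      "r2 \<noteq> r1" "r3 \<noteq> r1" "r4 \<noteq> r1" "r3 \<noteq> r2" "r4 \<noteq> r2" "r4 \<noteq> r3" using ne by auto
    have gs: "?A \<in> G" "?B \<in> G" "?C \<in> G" "?K \<in> G" using eG fG mult r by auto
    obtain D where D: "D \<in> G" "\<And>x. \<lbrakk>x \<in> X; ?A x = - 1; ?B x = - 1\<rbrakk> \<Longrightarrow> D x = - 1"
        "\<And>x. \<lbrakk>x \<in> X; D x = - 1\<rbrakk> \<Longrightarrow> (?A x = - 1 \<or> ?B x = - 1) \<and> ?C x = 1"
    proof (rule exchange[OF gs])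
      fix x assume x: "x \<in> X" "?B x = - 1" "?C x = - 1"
      have "x \<in> ?R" using x eY r by force
      thus "?K x = - 1" using x eR fR r ineq by (auto split: if_splits)
    next
      fix x assume x: "x \<in> X" "?K x = - 1"
      show "(?B x = - 1 \<or> ?C x = - 1) \<and> ?A x = 1"
      proof (cases "x \<in> Y")
        case True
        thus ?thesis using x eY fY r by auto
      next
        case False
        hence "x \<in> ?R" using x by blast
        thus ?thesis using x eR fR r ineq by (auto split: if_splits)
      qed
    qed blast
    have DY: "D y = 1" if "y \<in> Y" for y
      using D(3)[of y] signX[OF D(1), of y] eY r that Y_subset by force
    have DR: "D x = 1" if x: "x \<in> ?R" "x \<noteq> r1" for x
    proof (rule ccontr)
      assume "D x \<noteq> 1"
      hence "D x = - 1" using signX[OF D(1)] x by blast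
      hence "(?A x = - 1 \<or> ?B x = - 1) \<and> ?C x = 1" using D(3) x by blast
      thus False using x eR fR r ineq by (auto split: if_splits)
    qed
    have "D r1 = - 1" using D(2)[of r1] eR r ineq by simp
    thus False using noodd[OF D(1) r(1) DY _ DR] by blast
  qed
  define r1 r2 where "r1 = s0" and "r2 = r0"
  have r12: "r1 \<in> ?R" "r2 \<in> ?R" "r1 \<noteq> r2" using g by (auto simp: r1_def r2_def)
  \<comment> \<open>With only two points outside \<open>Y\<close>, the given \<open>g\<close> would
    be negative at \<open>s0\<close> alone.\<close>
  have "\<exists>r3\<in>?R. r3 \<noteq> r1 \<and> r3 \<noteq> r2"
  proof (rule ccontr)
    assume "\<not> ?thesis"
    hence "g x = 1" if "x \<in> ?R" "x \<noteq> s0" for x using that g(5) by (auto simp: r1_def r2_def)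
    thus False using noodd[OF g(1,4)] g(2,6) by blast
  qed
  then obtain r3 where r3: "r3 \<in> ?R" "r3 \<noteq> r1" "r3 \<noteq> r2" by blast
  note r = r12(1,2) r3(1)
  note ineq = r12(3) r12(3)[symmetric] r3(2,3) r3(2,3)[symmetric]
  have R3: "x = r1 \<or> x = r2 \<or> x = r3" if "x \<in> ?R" for x
    using no4[OF r that] ineq by auto
  \<comment> \<open>The functions \<open>e r s\<close> flip signs outside \<open>Y\<close> in pairs,
    so only the product of the three signs has to be controlled. What decides is whether this
    product is evaluation at a point of \<open>Y\<close>.\<close>
  define \<chi> where "\<chi> = (\<lambda>g :: 'a \<Rightarrow> int. g r1 * g r2 * g r3)"
  have signR: "h r1 = 1 \<or> h r1 = - 1" "h r2 = 1 \<or> h r2 = - 1" "h r3 = 1 \<or> h r3 = - 1"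
    if "h \<in> G" for h
    using sign[OF that] r by blast+
  have adjust: "\<exists>h'\<in>G. (\<forall>y\<in>Y. h' y = h y) \<and> h' r1 = s1 \<and> h' r2 = s2 \<and> h' r3 = s3"
    if h: "h \<in> G" "\<chi> h = s1 * s2 * s3" and s: "s1 = 1 \<or> s1 = - 1" "s2 = 1 \<or> s2 = - 1" "s3 = 1 \<or> s3 = - 1"
    for h s1 s2 s3
  proof -
    define p where "p = (if h r1 = s1 then 1 else e r1 r3)"
    define q where "q = (if h r2 = s2 then 1 else e r2 r3)"
    have pq: "p \<in> G" "q \<in> G" using one eG r by (auto simp: p_def q_def)
    have 1: "(h * p * q) r1 = s1"
      using signR[OF h(1)] s eR r ineq by (auto simp: p_def q_def)
    have 2: "(h * p * q) r2 = s2"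
      using signR[OF h(1)] s eR r ineq by (auto simp: p_def q_def)
    have "\<chi> p = 1" "\<chi> q = 1" using eR r ineq by (auto simp: p_def q_def \<chi>_def)
    hence "\<chi> (h * p * q) = s1 * s2 * s3" using h(2) by (simp add: \<chi>_def algebra_simps)
    hence "s1 * s2 * (h * p * q) r3 = s1 * s2 * s3" unfolding \<chi>_def 1 2 .
    hence 3: "(h * p * q) r3 = s3" using s by auto
    have "\<forall>y\<in>Y. (h * p * q) y = h y" using eY r by (auto simp: p_def q_def)
    thus ?thesis using 1 2 3 mult[OF mult[OF h(1) pq(1)] pq(2)] by blast
  qed
  have \<chi>Y: "\<chi> h = 1" if h: "h \<in> G" "\<forall>y\<in>Y. h y = 1" for h
  proof (rule ccontr)
    assume "\<chi> h \<noteq> 1"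
    hence "\<chi> h = - 1 * 1 * 1" using signR[OF h(1)] by (auto simp: \<chi>_def)
    then obtain h' where h': "h' \<in> G" "\<forall>y\<in>Y. h' y = h y" "h' r1 = - 1" "h' r2 = 1" "h' r3 = 1"
      using adjust[OF h(1), of "- 1" 1 1] by blast
    have "h' x = 1" if "x \<in> ?R" "x \<noteq> r1" for x using R3[OF that(1)] that(2) h'(4,5) by blast
    thus False using noodd[OF h'(1) r(1) _ h'(3)] h'(2) h(2) by simp
  qed
  obtain A where A: "A \<in> G" "\<forall>y\<in>Y. A y = 1 y" "A r1 = - 1" "A r2 = - 1" "A r3 = 1"
    using adjust[OF one, of "- 1" "- 1" 1] by (auto simp: \<chi>_def)
  show ?thesis
  proof (cases "\<exists>y\<in>Y. \<forall>h\<in>G. \<chi> h = h y")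
    case False
    interpret Y: sign_space Y G by (fact space_Y)
    have "\<exists>a\<in>G. \<exists>c\<in>G. \<chi> a = 1 \<and> (\<forall>x\<in>Y. a x = 1 \<longrightarrow> c x = 1) \<and> \<chi> c \<noteq> 1"
    proof (rule ccontr)
      assume neg: "\<not> ?thesis"
      have "\<exists>y\<in>Y. \<forall>h\<in>G. \<chi> h = h y"
      proof (rule Y.character_point)
        show "\<chi> a = 1 \<or> \<chi> a = - 1" if "a \<in> G" for a
          using signR[OF that] by (auto simp: \<chi>_def)
        show "\<chi> (a * b) = \<chi> a * \<chi> b" for a b by (simp add: \<chi>_def algebra_simps)
        show "\<chi> (- 1) = - 1" by (simp add: \<chi>_def)
        show "\<chi> c = 1" if "a \<in> G" "c \<in> G" "\<chi> a = 1" "\<forall>x\<in>Y. a x = 1 \<longrightarrow> c x = 1" for a c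
          using neg that by blast
      qed
      thus False using False by blast
    qed
    then obtain a c where ac: "a \<in> G" "c \<in> G" "\<chi> a = 1" "\<forall>x\<in>Y. a x = 1 \<longrightarrow> c x = 1" "\<chi> c \<noteq> 1"
      by blast
    have \<chi>c: "\<chi> c = - 1" using ac(5) signR[OF ac(2)] by (auto simp: \<chi>_def)
    \<comment> \<open>At r1, r2, r3 the functions \<open>A\<close>, \<open>B\<close>,
      \<open>C\<close>, \<open>K\<close> are negative on {r1,r2}, {r1,r3}, {r2,r3}, {r3}; on
      \<open>Y\<close> they are 1, 1, \<open>a\<close>, \<open>c\<close>. The violation of (AX2) by
      \<open>\<chi>\<close> is exactly what makes \<open>C\<close> and \<open>K\<close> available,
      and \<open>D\<close> is again negative at \<open>r1\<close> alone.\<close>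
    obtain B where B: "B \<in> G" "\<forall>y\<in>Y. B y = 1 y" "B r1 = - 1" "B r2 = 1" "B r3 = - 1"
      using adjust[OF one, of "- 1" 1 "- 1"] by (auto simp: \<chi>_def)
    obtain C where C: "C \<in> G" "\<forall>y\<in>Y. C y = a y" "C r1 = 1" "C r2 = - 1" "C r3 = - 1"
      using adjust[OF ac(1), of 1 "- 1" "- 1"] ac(3) by auto
    obtain K where K: "K \<in> G" "\<forall>y\<in>Y. K y = c y" "K r1 = 1" "K r2 = 1" "K r3 = - 1"
      using adjust[OF ac(2), of 1 1 "- 1"] \<chi>c by auto
    obtain D where D: "D \<in> G" "\<And>x. \<lbrakk>x \<in> X; A x = - 1; B x = - 1\<rbrakk> \<Longrightarrow> D x = - 1"
        "\<And>x. \<lbrakk>x \<in> X; D x = - 1\<rbrakk> \<Longrightarrow> (A x = - 1 \<or> B x = - 1) \<and> C x = 1"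
    proof (rule exchange[OF A(1) B(1) C(1) K(1)])
      fix x assume x: "x \<in> X" "B x = - 1" "C x = - 1"
      show "K x = - 1"
      proof (cases "x \<in> Y")
        case True thus ?thesis using x B(2) by simp
      next
        case False thus ?thesis using R3[of x] x B C K by auto
      qed
    next
      fix x assume x: "x \<in> X" "K x = - 1"
      show "(B x = - 1 \<or> C x = - 1) \<and> A x = 1"
      proof (cases "x \<in> Y")
        case True
        hence "a x \<noteq> 1" using ac(4) x K(2) by auto
        hence "a x = - 1" using sign[OF ac(1) x(1)] by blast
        thus ?thesis using C(2) A(2) True by simp
      next
        case False thus ?thesis using R3[of x] x A B C K by auto
      qed
    qed blast
    have DY: "D y = 1" if "y \<in> Y" for y
      using D(3)[of y] signX[OF D(1), of y] A(2) B(2) that Y_subset by force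
    have "D r1 = - 1" using D(2)[of r1] A(3) B(3) r by simp
    moreover have "D r2 = 1" using D(3)[of r2] signX[OF D(1), of r2] C(4) r by force
    moreover have "D r3 = 1" using D(3)[of r3] signX[OF D(1), of r3] C(5) r by force
    ultimately have False using noodd[OF D(1) r(1) DY] R3 by blast
    thus ?thesis ..
  next
    case True
    then obtain y where y: "y \<in> Y" "\<forall>h\<in>G. \<chi> h = h y" by blast
    have yX: "y \<in> X" using y Y_subset by blast
    show ?thesis
    proof (cases "Y = {y}")
      case True
      \<comment> \<open>As characters y = r1 r2 r3, so y r1 = r2 r3 interchanges \<open>y\<close>
        with \<open>r1\<close> and \<open>r2\<close> with \<open>r3\<close>.\<close>
      define \<alpha> where "\<alpha> = (\<lambda>h :: 'a \<Rightarrow> int. h y * h r1)"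
      have X: "x = y \<or> x = r1 \<or> x = r2 \<or> x = r3" if "x \<in> X" for x using R3[of x] that True by blast
      have rel: "h y = h r1 * h r2 * h r3" if "h \<in> G" for h using y(2) that by (simp add: \<chi>_def)
      have sh: "shifted G \<alpha> y r1" "shifted G \<alpha> r1 y" "shifted G \<alpha> r2 r3" "shifted G \<alpha> r3 r2"
        unfolding shifted_def \<alpha>_def using rel signR by (auto; fastforce)+
      have "sign_character G \<alpha>"
        unfolding sign_character_def
      proof (intro conjI ballI)
        fix a assume "a \<in> G"
        thus "\<alpha> a = 1 \<or> \<alpha> a = - 1" using signR[of a] sign[OF _ yX, of a] by (auto simp: \<alpha>_def)
      qed (simp add: \<alpha>_def algebra_simps)
      moreover have "\<exists>a\<in>G. \<alpha> a = - 1"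
      proof -
        obtain h where "h \<in> G" "h y = 1" "h r1 = - 1"
          using normalized_separates[OF yX, of r1] r y by blast
        thus ?thesis by (intro bexI[of _ h]) (auto simp: \<alpha>_def)
      qed
      moreover have "\<exists>z\<in>X. shifted G \<alpha> x z" if "x \<in> X" for x
        using X[OF that] sh yX r by blast
      ultimately show ?thesis unfolding translation_def by blast
    next
      case False
      \<comment> \<open>\<open>b\<close> has as few negative points on \<open>Y\<close> as possible
        subject to \<open>b y = - 1\<close>. It has one besides \<open>y\<close>, namely
        \<open>p\<close>, since otherwise it would split \<open>y\<close> off from \<open>Y\<close>.
        The exchange produces a \<open>D\<close> with \<open>D y = - 1\<close> whose negative points
        on \<open>Y\<close> are among those of \<open>b\<close> but omit \<open>p\<close>.\<close>
      define m where "m = (\<lambda>b :: 'a \<Rightarrow> int. card {x\<in>Y. b x = - 1})"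
      obtain b where b: "b \<in> G \<and> b y = - 1"
        and bmin: "\<And>b'. b' \<in> G \<and> b' y = - 1 \<Longrightarrow> m b \<le> m b'"
        using ex_has_least_nat[of "\<lambda>b. b \<in> G \<and> b y = - 1" "- 1" m] minus_one by auto
      have "\<exists>p\<in>Y. p \<noteq> y \<and> b p = - 1"
      proof (rule ccontr)
        assume neg: "\<not> ?thesis"
        have "b x = 1" if "x \<in> Y" "x \<noteq> y" for x
          using neg that sign[of b x] b Y_subset by blast
        hence "splits G {y} (Y - {y})" using splits_single[OF y(1) _ _ _ Y_subset, of b] b by blast
        moreover have "Y = {y} \<union> (Y - {y})" using y(1) by blast
        ultimately have "Y - {y} = {}" using indecomposableD[OF connected_Y] by blast
        thus False using False y(1) by blast
      qed
      then obtain p where p: "p \<in> Y" "p \<noteq> y" "b p = - 1" by blast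
      obtain c where c: "c \<in> G" "c y = 1" "c p = - 1"
        using normalized_separates[OF yX, of p] p Y_subset by blast
      have \<chi>b: "\<chi> b = - 1" "\<chi> c = 1" using y(2) b c by auto
      obtain B where B: "B \<in> G" "\<forall>y\<in>Y. B y = b y" "B r1 = - 1" "B r2 = 1" "B r3 = 1"
        using adjust[of b "- 1" 1 1] b \<chi>b by auto
      obtain C where C: "C \<in> G" "\<forall>y\<in>Y. C y = c y" "C r1 = 1" "C r2 = - 1" "C r3 = - 1"
        using adjust[OF c(1), of 1 "- 1" "- 1"] \<chi>b by auto
      obtain K where K: "K \<in> G" "\<forall>y\<in>Y. K y = b y" "K r1 = 1" "K r2 = 1" "K r3 = - 1"
        using adjust[of b 1 1 "- 1"] b \<chi>b by auto
      obtain D where D: "D \<in> G" "\<And>x. \<lbrakk>x \<in> X; A x = - 1; B x = - 1\<rbrakk> \<Longrightarrow> D x = - 1"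
          "\<And>x. \<lbrakk>x \<in> X; D x = - 1\<rbrakk> \<Longrightarrow> (A x = - 1 \<or> B x = - 1) \<and> C x = 1"
      proof (rule exchange[OF A(1) B(1) C(1) K(1)])
        fix x assume x: "x \<in> X" "B x = - 1" "C x = - 1"
        show "K x = - 1"
        proof (cases "x \<in> Y")
          case True thus ?thesis using x B(2) K(2) by simp
        next
          case False thus ?thesis using R3[of x] x B C K by auto
        qed
      next
        fix x assume x: "x \<in> X" "K x = - 1"
        show "(B x = - 1 \<or> C x = - 1) \<and> A x = 1"
        proof (cases "x \<in> Y")
          case True thus ?thesis using x A(2) B(2) K(2) by simp
        next
          case False thus ?thesis using R3[of x] x A B C K by auto
        qed
      qed blast
      have "D r1 = - 1" using D(2)[of r1] A(3) B(3) r by simp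
      moreover have "D r2 = 1" using D(3)[of r2] signX[OF D(1), of r2] C(4) r by force
      moreover have "D r3 = 1" using D(3)[of r3] signX[OF D(1), of r3] C(5) r by force
      ultimately have "\<chi> D = - 1" by (simp add: \<chi>_def)
      hence "D y = - 1" using y(2) D(1) by simp
      hence "m b \<le> m D" using bmin D(1) by blast
      moreover have "{x\<in>Y. D x = - 1} \<subset> {x\<in>Y. b x = - 1}"
      proof
        show "{x\<in>Y. D x = - 1} \<subseteq> {x\<in>Y. b x = - 1}"
        proof safe
          fix x assume "x \<in> Y" "D x = - 1"
          thus "b x = - 1" using D(3)[of x] A(2) B(2) Y_subset by auto
        qed
        have "D p \<noteq> - 1" using D(3)[of p] C(2) c(3) p(1) Y_subset by auto
        thus "{x\<in>Y. D x = - 1} \<noteq> {x\<in>Y. b x = - 1}" using p by blast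
      qed
      hence "m D < m b" unfolding m_def
        by (intro psubset_card_mono finite_subset[OF _ finite_X]) (use Y_subset in auto)
      ultimately have False by simp
      thus ?thesis ..
    qed
  qed
qed

end

context maximal_flat
begin

subsection \<open>Flats of codimension one\<close>

text \<open>
  Here \<open>Y\<close> is the positive set of \<open>a\<close>. The translation \<open>\<alpha>\<close> of \<open>Y\<close> does not extend to \<open>X\<close>, and \<open>c\<close>
  cuts \<open>Y\<close> into a transversal \<open>T\<close> and its translate.
\<close>

lemma translation_codim_one:
  assumes a: "a \<in> G" "\<forall>y\<in>Y. a y = 1" "\<forall>x\<in>X - Y. a x = - 1"
    and codim: "\<And>d. \<lbrakk>d \<in> G; \<forall>y\<in>Y. d y = 1\<rbrakk> \<Longrightarrow> (\<forall>x\<in>X - Y. d x = 1) \<or> (\<forall>x\<in>X - Y. d x = - 1)"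
    and IH: "\<And>W. \<lbrakk>flat X G W; W \<noteq> X; indecomposable G W; \<exists>x\<in>W. \<exists>y\<in>W. x \<noteq> y\<rbrakk>
      \<Longrightarrow> \<exists>\<alpha>. translation G W \<alpha>"
  shows "\<exists>\<alpha>. translation G X \<alpha>"
proof (rule ccontr)
  assume none: "\<not> ?thesis"
  define Z where "Z = X - Y"
  have X: "X = Y \<union> Z" "Y \<inter> Z = {}" and ZX: "Z \<subseteq> X" using Y_subset by (auto simp: Z_def)
  have aZ: "\<forall>x\<in>Z. a x = - 1" using a(3) by (simp add: Z_def)
  have Z_nonempty: "Z \<noteq> {}" using Y_subset Y_proper by (auto simp: Z_def)
  have Z2: "\<exists>x\<in>Z. x \<noteq> z" if z: "z \<in> Z" for z
  proof (rule ccontr)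
    assume neg: "\<not> ?thesis"
    hence Zz: "Z = {z}" using z by blast
    have "splits G {z} (X - {z})"
      by (rule splits_single[OF _ a(1)]) (use z ZX Zz X a(2) aZ in auto)
    moreover have "X - {z} = Y" using Zz X by blast
    ultimately have "splits G Y Z" using splits_commute Zz by auto
    thus False using not_splits by (simp add: Z_def)
  qed
  have Y2: "\<exists>x\<in>Y. \<exists>y\<in>Y. x \<noteq> y"
  proof (rule ccontr)
    assume neg: "\<not> ?thesis"
    obtain y where y: "y \<in> Y" using Y_nonempty by blast
    hence Yy: "Y = {y}" using neg by blast
    have "splits G {y} (X - {y})"
      by (rule splits_single[OF _ minus[OF a(1)]]) (use y Y_subset Yy a(2) aZ Z_def in auto)
    thus False using not_splits Yy by simp
  qed
  obtain \<alpha> where \<alpha>: "translation G Y \<alpha>" using IH[OF flat_Y Y_proper connected_Y Y2] by blast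
  have ch: "sign_character G \<alpha>" using \<alpha> by (simp add: translation_def)
  have "\<forall>y\<in>Y. \<exists>y'\<in>Y. shifted G \<alpha> y y'" using \<alpha> by (simp add: translation_def)
  then obtain \<sigma> where \<sigma>: "\<And>y. y \<in> Y \<Longrightarrow> \<sigma> y \<in> Y" "\<And>y. y \<in> Y \<Longrightarrow> shifted G \<alpha> y (\<sigma> y)"
    by metis
  have \<sigma>v: "g (\<sigma> y) = \<alpha> g * g y" if "y \<in> Y" "g \<in> G" for y g
    using shiftedD[OF \<sigma>(2)] that by blast
  obtain y0 where y0: "y0 \<in> Y" using Y_nonempty by blast
  have \<alpha>s: "\<alpha> g = 1 \<or> \<alpha> g = - 1" if "g \<in> G" for g using sign_characterD(1)[OF ch that] .
  \<comment> \<open>The points whose translate exists form a flat containing \<open>Y\<close>. If it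
    contained one point of \<open>Z\<close>, it would be all of \<open>X\<close>, because
    annihilating elements of \<open>Y\<close> are constant on \<open>Z\<close>; then
    \<open>\<alpha>\<close> would translate \<open>X\<close>.\<close>
  have no_shift: "\<not> (\<exists>w\<in>X. shifted G \<alpha> z w)" if z: "z \<in> Z" for z
  proof
    assume w: "\<exists>w\<in>X. shifted G \<alpha> z w"
    let ?W = "{x\<in>X. \<exists>y\<in>X. shifted G \<alpha> x y}"
    have y0X: "y0 \<in> X" "\<sigma> y0 \<in> X" using y0 \<sigma>(1) Y_subset by blast+
    have W: "flat X G ?W" using flat_shift[OF ch y0X \<sigma>(2)[OF y0]] .
    have YW: "Y \<subseteq> ?W" using \<sigma> Y_subset by blast
    have zW: "z \<in> ?W" using w z ZX by blast
    have "x \<in> ?W" if x: "x \<in> X" for x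
    proof (rule flatD[OF W x])
      fix g assume g: "g \<in> G" "\<forall>y\<in>?W. g y = 1"
      have gY: "\<forall>y\<in>Y. g y = 1" using g(2) YW by blast
      moreover have "g z = 1" using g(2) zW by blast
      ultimately have "\<forall>x\<in>X - Y. g x = 1" using codim[OF g(1)] z by (auto simp: Z_def)
      thus "g x = 1" using gY x by blast
    qed
    hence "\<forall>x\<in>X. \<exists>y\<in>X. shifted G \<alpha> x y" by blast
    hence "translation G X \<alpha>" using \<alpha> by (simp add: translation_def)
    thus False using none by blast
  qed
  obtain z0 where z0: "z0 \<in> Z" using Z_nonempty by blast
  obtain c d where cd: "c \<in> G" "d \<in> G" "\<alpha> c = - 1" "d z0 = - 1" "\<forall>y\<in>Y. d y = 1"
      "\<forall>x\<in>X. d x = - 1 \<longrightarrow> c x = 1"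
    using no_shift_separation[OF \<alpha> Y_subset Y_nonempty _ no_shift[OF z0]] z0 ZX by blast
  have "\<forall>x\<in>Z. d x = - 1" using codim[OF cd(2,5)] cd(4) z0 by (auto simp: Z_def)
  hence cZ: "\<forall>x\<in>Z. c x = 1" using cd(6) ZX by blast
  note c = cd(1,3)
  define T where "T = {y\<in>Y. c y = 1}"
  define S where "S = {x\<in>X. c x = 1}"
  have S: "S = Z \<union> T" using cZ X by (auto simp: S_def T_def)
  have TY: "T \<subseteq> Y" by (auto simp: T_def)
  have aT: "\<forall>x\<in>T. a x = 1" using a(2) TY by blast
  have S_flat: "flat X G S" unfolding S_def by (rule flat_positive[OF flat_self c(1)])
  have c\<sigma>: "c (\<sigma> y) = - c y" if "y \<in> Y" for y using \<sigma>v[OF that c(1)] c(2) by simp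
  have signc: "c y = 1 \<or> c y = - 1" if "y \<in> Y" for y using sign[OF c(1)] that Y_subset by blast
  have \<sigma>T: "\<sigma> t \<in> Y - S" if "t \<in> T" for t
    using that \<sigma>(1)[of t] c\<sigma>[of t] by (auto simp: T_def S_def)
  have Y_cases: "\<exists>t\<in>T. shifted G \<alpha> t y" if y: "y \<in> Y" "y \<notin> T" for y
  proof -
    have "c y = - 1" using y signc[OF y(1)] by (auto simp: T_def)
    hence "\<sigma> y \<in> T" using \<sigma>(1)[OF y(1)] c\<sigma>[OF y(1)] by (simp add: T_def)
    moreover have "shifted G \<alpha> (\<sigma> y) y"
      unfolding shifted_def
    proof
      fix g assume g: "g \<in> G"
      show "g y = \<alpha> g * g (\<sigma> y)" using \<sigma>v[OF y(1) g] \<alpha>s[OF g] by auto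
    qed
    ultimately show ?thesis by blast
  qed
  have T_nonempty: "T \<noteq> {}" using Y_cases[OF y0] by auto
  have S_proper: "S \<noteq> X"
  proof -
    obtain t where "t \<in> T" using T_nonempty by blast
    thus ?thesis using \<sigma>T[of t] Y_subset by blast
  qed
  have \<alpha>a: "\<alpha> a = 1" using \<sigma>v[OF y0 a(1)] a(2) y0 \<sigma>(1)[OF y0] by simp
  \<comment> \<open>\<open>c\<close> is 1 on \<open>S\<close> and \<open>\<alpha> c = - 1\<close>,
    so multiplying by \<open>c\<close> flips the sign of \<open>\<alpha>\<close> and keeps the
    values on \<open>S\<close>. Conversely the values on \<open>T\<close> together with this sign
    determine an element on \<open>Y\<close>.\<close>
  have adjust: "\<exists>h\<in>G. (\<forall>x\<in>S. h x = g x) \<and> \<alpha> h = s" if g: "g \<in> G" and s: "s = 1 \<or> s = - 1" for g s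
  proof (cases "\<alpha> g = s")
    case True
    thus ?thesis using g by blast
  next
    case False
    have "\<alpha> (g * c) = s" using sign_characterD(2)[OF ch g c(1)] c(2) \<alpha>s[OF g] s False by auto
    moreover have "\<forall>x\<in>S. (g * c) x = g x" by (simp add: S_def)
    ultimately show ?thesis using mult[OF g c(1)] by blast
  qed
  have Y_values: "h y = g y"
    if hg: "h \<in> G" "g \<in> G" "\<alpha> h = \<alpha> g" "\<forall>x\<in>T. h x = g x" and y: "y \<in> Y" for h g y
  proof (cases "y \<in> T")
    case True thus ?thesis using hg(4) by blast
  next
    case False
    then obtain t where t: "t \<in> T" "shifted G \<alpha> t y" using Y_cases y by blast
    thus ?thesis using shiftedD[OF t(2) hg(1)] shiftedD[OF t(2) hg(2)] hg(3,4) by simp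
  qed
  have \<alpha>1: "\<alpha> 1 = 1" using \<sigma>v[OF y0 one] by simp
  have SX: "S \<subseteq> X" by (auto simp: S_def)
  interpret S: sign_space S G
    using sign_space_flat[OF S_flat] S Z_nonempty by blast
  have "finite S" using SX finite_X by (rule finite_subset)
  moreover have "z0 \<in> S" using z0 S by blast
  ultimately obtain S' where S': "z0 \<in> S'" "S' \<subseteq> S" "splits G S' (S - S')" "indecomposable G S'"
    by (rule S.component)
  \<comment> \<open>Otherwise 1 on \<open>S'\<close>, \<open>a\<close> on the rest of
    \<open>S\<close> and sign 1 under \<open>\<alpha>\<close> define an element that is 1 on
    \<open>Y\<close> but not constant on \<open>Z\<close>.\<close>
  have ZS': "Z \<subseteq> S'"
  proof (rule ccontr)
    assume "\<not> Z \<subseteq> S'"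
    then obtain z where z: "z \<in> Z" "z \<notin> S'" by blast
    obtain e where e: "e \<in> G" "\<forall>x\<in>S'. e x = 1 x" "\<forall>x\<in>S - S'. e x = a x"
      using splitsD[OF S'(3) one a(1)] by blast
    obtain e' where e': "e' \<in> G" "\<forall>x\<in>S. e' x = e x" "\<alpha> e' = 1"
      using adjust[OF e(1), of 1] by blast
    have e'S': "\<forall>x\<in>S'. e' x = 1" using e(2) e'(2) S'(2) by (simp add: subset_iff)
    have e'S: "\<forall>x\<in>S - S'. e' x = a x" using e(3) e'(2) by auto
    have "\<forall>x\<in>T. e' x = 1 x" using e'S' e'S aT S by auto
    hence "\<forall>y\<in>Y. e' y = 1"
      using Y_values[OF e'(1) one] e'(3) \<alpha>1 by simp
    moreover have "e' z0 = 1" using e'S' S'(1) by blast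
    moreover have "e' z = - 1" using e'S aZ z S by auto
    ultimately show False using codim[OF e'(1)] z(1) z0 by (auto simp: Z_def)
  qed
  have S'_flat: "flat X G S'" using flat_trans[OF S_flat S.splits_flat[OF S'(3,2)]] .
  have S'_proper: "S' \<noteq> X" using S'(2) S_proper SX by blast
  have "\<exists>x\<in>S'. \<exists>y\<in>S'. x \<noteq> y" using Z2[OF z0] z0 ZS' by blast
  then obtain \<beta> where \<beta>: "translation G S' \<beta>" using IH[OF S'_flat S'_proper S'(4)] by blast
  have ch\<beta>: "sign_character G \<beta>" using \<beta> by (simp add: translation_def)
  have \<beta>s: "\<beta> g = 1 \<or> \<beta> g = - 1" if "g \<in> G" for g using sign_characterD(1)[OF ch\<beta> that] .
  have "\<forall>x\<in>S'. \<exists>y\<in>S'. shifted G \<beta> x y" using \<beta> by (simp add: translation_def)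
  then obtain \<tau> where \<tau>: "\<And>x. x \<in> S' \<Longrightarrow> \<tau> x \<in> S'" "\<And>x. x \<in> S' \<Longrightarrow> shifted G \<beta> x (\<tau> x)"
    by metis
  have \<tau>v: "g (\<tau> x) = \<beta> g * g x" if "x \<in> S'" "g \<in> G" for x g
    using shiftedD[OF \<tau>(2)] that by blast
  define T' where "T' = S' \<inter> T"
  define T'' where "T'' = S - S'"
  have T: "T = T' \<union> T''" "T' \<inter> T'' = {}" "S' = Z \<union> T'"
  proof -
    have "Z \<inter> T = {}" using X(2) TY by blast
    show "T = T' \<union> T''" using S \<open>Z \<inter> T = {}\<close> ZS' unfolding T'_def T''_def by blast
    show "T' \<inter> T'' = {}" unfolding T'_def T''_def by blast
    show "S' = Z \<union> T'" using S ZS' S'(2) unfolding T'_def by blast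
  qed
  have in_Z: "x \<in> Z" if "x \<in> S'" "a x = - 1" for x using that T(3) T(1) aT by auto
  have in_T': "x \<in> T'" if "x \<in> S'" "a x = 1" for x using that T(3) aZ by auto
  \<comment> \<open>If \<open>T'\<close> were empty, \<open>Z\<close> would split from
    \<open>T\<close> inside \<open>S\<close>; prescribing the sign under \<open>\<alpha>\<close> too
    extends this to a splitting of \<open>Y\<close> from \<open>Z\<close>.\<close>
  have T'_nonempty: "T' \<noteq> {}"
  proof
    assume empty: "T' = {}"
    have "splits G Y Z"
      unfolding splits_def
    proof (intro ballI)
      fix g h assume g: "g \<in> G" and h: "h \<in> G"
      obtain k where k: "k \<in> G" "\<forall>x\<in>S'. k x = h x" "\<forall>x\<in>S - S'. k x = g x"
        using splitsD[OF S'(3) h g] by blast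
      obtain k' where k': "k' \<in> G" "\<forall>x\<in>S. k' x = k x" "\<alpha> k' = \<alpha> g"
        using adjust[OF k(1) \<alpha>s[OF g]] by blast
      have "\<forall>x\<in>T. k' x = g x"
      proof
        fix x assume "x \<in> T"
        hence "x \<in> S - S'" using T(1) empty by (simp add: T''_def)
        thus "k' x = g x" using k(3) k'(2) by simp
      qed
      hence "\<forall>y\<in>Y. k' y = g y" using Y_values[OF k'(1) g k'(3)] by blast
      moreover have "\<forall>x\<in>Z. k' x = h x" using k(2) k'(2) ZS' S'(2) by (simp add: subset_iff)
      ultimately show "\<exists>k\<in>G. (\<forall>x\<in>Y. k x = g x) \<and> (\<forall>x\<in>Z. k x = h x)" using k'(1) by blast
    qed
    thus False using not_splits by (simp add: Z_def)
  qed
  have two_T': "\<exists>p\<in>T'. \<exists>q\<in>T'. p \<noteq> q" if "\<beta> a = - 1"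
  proof -
    obtain z where z: "z \<in> Z" "z \<noteq> z0" using Z2[OF z0] by blast
    obtain h where h: "h \<in> G" "h z \<noteq> h z0" using separates[of z z0] z z0 ZX by blast
    have zS': "z \<in> S'" "z0 \<in> S'" using z z0 ZS' by blast+
    have "h (\<tau> z) \<noteq> h (\<tau> z0)" using \<tau>v[OF zS'(1) h(1)] \<tau>v[OF zS'(2) h(1)] h \<beta>s[OF h(1)] by auto
    moreover have "\<tau> z \<in> T'" "\<tau> z0 \<in> T'"
      using in_T' \<tau>(1) \<tau>v[OF _ a(1)] zS' that aZ z z0 by auto
    ultimately show ?thesis by metis
  qed
  show False
  proof (cases "T'' = {}")
    case False
    then obtain t'' where t'': "t'' \<in> T''" by blast
    \<comment> \<open>If \<open>\<beta>\<close> preserves the sign of \<open>a\<close>, take a point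
      of \<open>T'\<close> and its translate, since \<open>\<beta> g = 1\<close> for every
      \<open>g\<close> that is 1 on \<open>Z\<close>. Otherwise take two points of
      \<open>T'\<close>; their translates lie in \<open>Z\<close>.\<close>
    have "\<exists>p\<in>T'. \<exists>q\<in>T'. p \<noteq> q \<and> (\<forall>g\<in>G. (\<forall>z\<in>Z. g z = 1) \<longrightarrow> g p = g q)"
    proof (cases "\<beta> a = 1")
      case True
      obtain p where p: "p \<in> T'" using T'_nonempty by blast
      have pS': "p \<in> S'" "p \<in> T" using p by (auto simp: T'_def)
      have "\<tau> p \<in> T'" using in_T' \<tau>(1)[OF pS'(1)] \<tau>v[OF pS'(1) a(1)] True aT pS'(2) by simp
      moreover have "p \<noteq> \<tau> p"
      proof -
        obtain h where h: "h \<in> G" "\<beta> h = - 1" using \<beta> by (auto simp: translation_def)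
        have "h p = 1 \<or> h p = - 1" using sign[OF h(1)] pS' S'(2) SX by blast
        hence "h (\<tau> p) \<noteq> h p" using \<tau>v[OF pS'(1) h(1)] h(2) by auto
        thus ?thesis by metis
      qed
      moreover have "g p = g (\<tau> p)" if g: "g \<in> G" "\<forall>z\<in>Z. g z = 1" for g
      proof -
        have "z0 \<in> S'" using z0 ZS' by blast
        hence "\<tau> z0 \<in> Z" "g (\<tau> z0) = \<beta> g * g z0"
          using in_Z \<tau>(1) \<tau>v[OF _ a(1)] True aZ z0 \<tau>v[OF _ g(1)] by auto
        hence "\<beta> g = 1" using g(2) z0 by simp
        thus ?thesis using \<tau>v[OF pS'(1) g(1)] by simp
      qed
      ultimately show ?thesis using p by blast
    next
      case False
      hence \<beta>a: "\<beta> a = - 1" using \<beta>s[OF a(1)] by blast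
      obtain p q where pq: "p \<in> T'" "q \<in> T'" "p \<noteq> q" using two_T'[OF \<beta>a] by blast
      have pqS': "p \<in> S'" "q \<in> S'" "p \<in> T" "q \<in> T" using pq by (auto simp: T'_def)
      have "\<tau> p \<in> Z" "\<tau> q \<in> Z"
        using in_Z \<tau>(1) \<tau>v[OF _ a(1)] \<beta>a aT pqS' by auto
      hence "g p = g q" if "g \<in> G" "\<forall>z\<in>Z. g z = 1" for g
        using \<tau>v[OF pqS'(1) that(1)] \<tau>v[OF pqS'(2) that(1)] that(2) \<beta>s[OF that(1)] by auto
      thus ?thesis using pq by blast
    qed
    then obtain p q where pq: "p \<in> T'" "q \<in> T'" "p \<noteq> q"
      and rel: "\<And>g. \<lbrakk>g \<in> G; \<forall>z\<in>Z. g z = 1\<rbrakk> \<Longrightarrow> g p = g q" by blast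
    have pqX: "p \<in> X" "q \<in> X" "p \<in> T" "q \<in> T" "p \<in> Y" "q \<in> Y"
      using pq TY Y_subset by (auto simp: T'_def)
    have t''X: "t'' \<in> X" "t'' \<in> T" "t'' \<in> Y" using t'' T TY Y_subset by auto
    obtain f where f: "f \<in> G" "f q = 1" "f p = - 1"
      using normalized_separates[of q p] pqX pq(3) by metis
    have build: "\<exists>k\<in>G. (\<forall>x\<in>S'. k x = g x) \<and> (\<forall>x\<in>T''. k x = h x) \<and> \<alpha> k = s"
      if gh: "g \<in> G" "h \<in> G" and s: "s = 1 \<or> s = - 1" for g h s
    proof -
      obtain k where k: "k \<in> G" "\<forall>x\<in>S'. k x = g x" "\<forall>x\<in>S - S'. k x = h x"
        using splitsD[OF S'(3) gh] by blast
      obtain k' where "k' \<in> G" "\<forall>x\<in>S. k' x = k x" "\<alpha> k' = s" using adjust[OF k(1) s] by blast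
      thus ?thesis using k S'(2) by (intro bexI[of _ k']) (auto simp: T''_def)
    qed
    \<comment> \<open>With \<open>K = a\<close>, the exchanged \<open>D\<close> is 1 on
      \<open>Z\<close>, hence equal at \<open>p\<close> and \<open>q\<close>, and -1 at
      \<open>p\<close>. It is 1 at \<open>t''\<close> and at its translate, so
      \<open>\<alpha> D = 1\<close>. Then \<open>D\<close> is -1 at \<open>\<sigma> q\<close>, where
      \<open>A\<close> and \<open>B\<close> are both 1.\<close>
    obtain A where A: "A \<in> G" "\<forall>x\<in>S'. A x = (- a) x" "\<forall>x\<in>T''. A x = 1 x" "\<alpha> A = - 1"
      using build[OF minus[OF a(1)] one, of "- 1"] by blast
    obtain B where B: "B \<in> G" "\<forall>x\<in>S'. B x = f x" "\<forall>x\<in>T''. B x = 1 x" "\<alpha> B = 1"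
      using build[OF f(1) one, of 1] by blast
    obtain C where C: "C \<in> G" "\<forall>x\<in>S'. C x = a x" "\<forall>x\<in>T''. C x = (- 1) x" "\<alpha> C = 1"
      using build[OF a(1) minus_one, of 1] by blast
    have cells: "x \<in> Z \<or> x \<in> T' \<or> x \<in> T'' \<or> (\<exists>t\<in>T'. shifted G \<alpha> t x) \<or> (\<exists>t\<in>T''. shifted G \<alpha> t x)"
      if "x \<in> X" for x
      using that X Y_cases[of x] T(1) by blast
    have vZ: "A x = 1" "C x = - 1" "a x = - 1" if "x \<in> Z" for x
      using that A(2) C(2) aZ ZS' by auto
    have vT': "A x = - 1" "B x = f x" "C x = 1" "a x = 1" if "x \<in> T'" for x
      using that A(2) B(2) C(2) aT by (auto simp: T'_def)
    have vT'': "A x = 1" "B x = 1" "C x = - 1" "a x = 1" if "x \<in> T''" for x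
      using that A(3) B(3) C(3) aT T(1) by auto
    have v\<sigma>T': "A x = 1" "B x = f t" "C x = 1" "a x = 1" if "t \<in> T'" "shifted G \<alpha> t x" for t x
      using shiftedD[OF that(2) A(1)] shiftedD[OF that(2) B(1)] shiftedD[OF that(2) C(1)]
        shiftedD[OF that(2) a(1)] vT'[OF that(1)] A(4) B(4) C(4) \<alpha>a by simp_all
    have v\<sigma>T'': "A x = - 1" "B x = 1" "C x = - 1" "a x = 1" if "t \<in> T''" "shifted G \<alpha> t x" for t x
      using shiftedD[OF that(2) A(1)] shiftedD[OF that(2) B(1)] shiftedD[OF that(2) C(1)]
        shiftedD[OF that(2) a(1)] vT''[OF that(1)] A(4) B(4) C(4) \<alpha>a by simp_all
    obtain D where D: "D \<in> G" "\<And>x. \<lbrakk>x \<in> X; A x = - 1; B x = - 1\<rbrakk> \<Longrightarrow> D x = - 1"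
        "\<And>x. \<lbrakk>x \<in> X; D x = - 1\<rbrakk> \<Longrightarrow> (A x = - 1 \<or> B x = - 1) \<and> C x = 1"
    proof (rule exchange[OF A(1) B(1) C(1) a(1)])
      fix x assume x: "x \<in> X" "B x = - 1" "C x = - 1"
      consider "x \<in> Z" | "x \<in> T'" | "x \<in> T''" | t where "t \<in> T'" "shifted G \<alpha> t x"
        | t where "t \<in> T''" "shifted G \<alpha> t x"
        using cells[OF x(1)] by blast
      thus "a x = - 1"
        by cases (use x(2,3) vZ vT' vT'' v\<sigma>T' v\<sigma>T'' in fastforce)+
    next
      fix x assume x: "x \<in> X" "a x = - 1"
      hence "x \<in> Z" using a(2) X(1) by auto
      thus "(B x = - 1 \<or> C x = - 1) \<and> A x = 1" using vZ by simp
    qed blast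
    have D1: "D x = 1" if "x \<in> X" "C x = - 1 \<or> (A x = 1 \<and> B x = 1)" for x
      using D(3)[OF that(1)] sign[OF D(1) that(1)] that(2) by auto
    have "\<forall>z\<in>Z. D z = 1" using D1 vZ ZX by blast
    hence "D p = D q" using rel[OF D(1)] by blast
    moreover have "D p = - 1" using D(2)[OF pqX(1)] vT'[OF pq(1)] f by simp
    ultimately have Dq: "D q = - 1" by simp
    have \<sigma>X: "\<sigma> q \<in> X" "\<sigma> t'' \<in> X" using \<sigma>(1) pqX t''X Y_subset by blast+
    have "D t'' = 1" using D1[OF t''X(1)] vT''[OF t''] by blast
    moreover have "D (\<sigma> t'') = 1" using D1[OF \<sigma>X(2)] v\<sigma>T''[OF t'' \<sigma>(2)[OF t''X(3)]] by blast
    ultimately have "\<alpha> D = 1" using \<sigma>v[OF t''X(3) D(1)] by simp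
    hence "D (\<sigma> q) = - 1" using \<sigma>v[OF pqX(6) D(1)] Dq by simp
    moreover have "D (\<sigma> q) = 1" using D1[OF \<sigma>X(1)] v\<sigma>T'[OF pq(2) \<sigma>(2)[OF pqX(6)]] f(2) by simp
    ultimately show False by simp
  next
    case True
    hence TT: "T' = T" "S' = S" using T S by auto
    have \<beta>: "sign_character G \<beta>" "\<exists>g\<in>G. \<beta> g = - 1" using \<beta> by (simp_all add: translation_def)
    show False
    proof (cases "\<beta> a = 1")
      case True
      \<comment> \<open>Here \<open>\<beta>\<close> keeps \<open>T\<close> inside itself. A point
        outside \<open>S\<close> is the \<open>\<alpha>\<close>-translate of some \<open>t\<close>
        in \<open>T\<close>, and it is sent to the \<open>\<alpha>\<close>-translate of
        \<open>\<tau> t\<close>.\<close>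
      have "\<exists>y\<in>X. shifted G \<beta> x y" if x: "x \<in> X" for x
      proof (cases "x \<in> S")
        case True
        thus ?thesis using \<tau>[of x] TT SX by blast
      next
        case False
        hence "x \<in> Y" "x \<notin> T" using x X S by auto
        then obtain t where t: "t \<in> T" "shifted G \<alpha> t x" using Y_cases by blast
        have tS: "t \<in> S'" using t S TT by blast
        have "\<tau> t \<in> T" using in_T' \<tau>(1)[OF tS] \<tau>v[OF tS a(1)] True aT t(1) TT by simp
        hence tY: "\<tau> t \<in> Y" using TY by blast
        have "shifted G \<beta> x (\<sigma> (\<tau> t))"
          unfolding shifted_def
        proof
          fix g assume g: "g \<in> G"
          show "g (\<sigma> (\<tau> t)) = \<beta> g * g x"
            using \<sigma>v[OF tY g] \<tau>v[OF tS g] shiftedD[OF t(2) g] by simp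
        qed
        thus ?thesis using \<sigma>(1)[OF tY] Y_subset by blast
      qed
      hence "translation G X \<beta>" using \<beta> by (simp add: translation_def)
      thus False using none by blast
    next
      case False
      hence \<beta>a: "\<beta> a = - 1" using \<beta>s[OF a(1)] by blast
      have \<tau>Z: "\<tau> z \<in> T" if "z \<in> Z" for z
        using in_T' \<tau>(1) \<tau>v[OF _ a(1)] \<beta>a aZ that ZS' TT by auto
      have \<tau>T: "\<tau> t \<in> Z" if "t \<in> T" for t
      proof -
        have t: "t \<in> S'" using that S TT by simp
        have "a (\<tau> t) = - 1" using \<tau>v[OF t a(1)] \<beta>a aT that by simp
        thus ?thesis by (rule in_Z[OF \<tau>(1)[OF t]])
      qed
      \<comment> \<open>\<open>X\<close> now consists of \<open>T\<close> and its translates by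
        \<open>\<alpha>\<close> and \<open>\<beta>\<close>, the latter being \<open>Z\<close>. A
        translation of \<open>T\<close> is copied to all three pieces and so translates
        \<open>X\<close>.\<close>
      have no_\<gamma>: False if \<gamma>: "translation G T \<gamma>" for \<gamma>
      proof -
        have \<gamma>T: "\<exists>t'\<in>T. shifted G \<gamma> t t'" if "t \<in> T" for t using \<gamma> that by (simp add: translation_def)
        have "\<exists>y\<in>X. shifted G \<gamma> x y" if x: "x \<in> X" for x
        proof -
          consider "x \<in> T" | "x \<in> Z" | t where "t \<in> T" "shifted G \<alpha> t x"
            using x X Y_cases by blast
          thus ?thesis
          proof cases
            case 1
            thus ?thesis using \<gamma>T TY Y_subset by blast
          next
            case 2
            have xS: "x \<in> S'" using 2 ZS' by blast
            obtain t where t: "t \<in> T" "shifted G \<gamma> (\<tau> x) t" using \<gamma>T \<tau>Z[OF 2] by blast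
            have tS: "t \<in> S'" using t(1) S TT by blast
            have "shifted G \<gamma> x (\<tau> t)"
              unfolding shifted_def
            proof
              fix g assume g: "g \<in> G"
              show "g (\<tau> t) = \<gamma> g * g x"
                using \<tau>v[OF tS g] shiftedD[OF t(2) g] \<tau>v[OF xS g] \<beta>s[OF g] by auto
            qed
            thus ?thesis using \<tau>T[OF t(1)] ZX by blast
          next
            case 3
            obtain t' where t': "t' \<in> T" "shifted G \<gamma> t t'" using \<gamma>T 3(1) by blast
            have t'Y: "t' \<in> Y" using t'(1) TY by blast
            have "shifted G \<gamma> x (\<sigma> t')"
              unfolding shifted_def
            proof
              fix g assume g: "g \<in> G"
              show "g (\<sigma> t') = \<gamma> g * g x"
                using \<sigma>v[OF t'Y g] shiftedD[OF t'(2) g] shiftedD[OF 3(2) g] by simp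
            qed
            thus ?thesis using \<sigma>(1)[OF t'Y] Y_subset by blast
          qed
        qed
        hence "translation G X \<gamma>" using \<gamma> by (simp add: translation_def)
        thus False using none by blast
      qed
      have T_flat: "flat X G T" unfolding T_def by (rule flat_positive[OF flat_Y c(1)])
      have T_proper: "T \<noteq> X" using TY Y_proper Y_subset by blast
      have T2: "\<exists>p\<in>T. \<exists>q\<in>T. p \<noteq> q" using two_T'[OF \<beta>a] TT by simp
      have "\<not> indecomposable G T" using IH[OF T_flat T_proper _ T2] no_\<gamma> by blast
      then obtain T1 T2 where T12: "T1 \<noteq> {}" "T2 \<noteq> {}" "T = T1 \<union> T2" "splits G T1 T2"
        unfolding indecomposable_def by blast
      have kill: False if U: "T = U \<union> V" "splits G U V" "p \<in> U" "q \<in> U" "p \<noteq> q" "r \<in> V" for U V p q r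
      proof -
        have pqr: "p \<in> T" "q \<in> T" "r \<in> T" using U by auto
        have T_Y: "t \<in> Y" if "t \<in> T" for t using that TY by blast
        have T_S: "t \<in> S'" if "t \<in> T" for t using that S TT by blast
        have T_X: "t \<in> X" if "t \<in> T" for t using that TY Y_subset by blast
        obtain f where f: "f \<in> G" "f q = 1" "f p = - 1"
          using normalized_separates[of q p] T_X pqr U(5) by metis
        obtain t0 where t0: "t0 \<in> T" using T_nonempty by blast
        have \<beta>c: "\<beta> c = 1"
          using \<tau>v[OF T_S[OF t0] c(1)] \<tau>T[OF t0] cZ t0 by (simp add: T_def)
        \<comment> \<open>\<open>a\<close> and \<open>c\<close> are both 1 on \<open>T\<close>;
          \<open>a\<close> has signs 1, -1 and \<open>c\<close> has signs -1, 1 under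
          \<open>\<alpha>\<close>, \<open>\<beta>\<close>. So both signs can be corrected
          independently of the values on \<open>T\<close>.\<close>
        have build: "\<exists>k\<in>G. (\<forall>x\<in>U. k x = g x) \<and> (\<forall>x\<in>V. k x = h x) \<and> \<alpha> k = s \<and> \<beta> k = s'"
          if gh: "g \<in> G" "h \<in> G" and s: "s = 1 \<or> s = - 1" "s' = 1 \<or> s' = - 1" for g h s s'
        proof -
          obtain k where k: "k \<in> G" "\<forall>x\<in>U. k x = g x" "\<forall>x\<in>V. k x = h x"
            using splitsD[OF U(2) gh] by blast
          define l where "l = (if \<beta> k = s' then k else k * a)"
          have l: "l \<in> G" "\<beta> l = s'"
            using k(1) mult[OF k(1) a(1)] sign_characterD(2)[OF ch\<beta> k(1) a(1)] \<beta>a \<beta>s[OF k(1)] s(2)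
            by (auto simp: l_def)
          have lk: "l x = k x" if "x \<in> T" for x using that aT by (simp add: l_def)
          define m where "m = (if \<alpha> l = s then l else l * c)"
          have m: "m \<in> G" "\<alpha> m = s" "\<beta> m = s'"
            using l mult[OF l(1) c(1)] sign_characterD(2)[OF ch l(1) c(1)] c(2) \<alpha>s[OF l(1)] s(1)
              sign_characterD(2)[OF ch\<beta> l(1) c(1)] \<beta>c
            by (auto simp: m_def)
          have mk: "m x = k x" if "x \<in> T" for x using that lk by (simp add: m_def T_def)
          have "\<forall>x\<in>U. m x = g x" "\<forall>x\<in>V. m x = h x" using mk k U(1) by simp_all
          thus ?thesis using m by blast
        qed
        \<comment> \<open>The exchanged \<open>D\<close> is -1 at \<open>p\<close> and 1 at
          \<open>\<sigma> p\<close>, so \<open>\<alpha> D = - 1\<close>; it is 1 at \<open>r\<close>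
          and \<open>\<tau> r\<close>, so \<open>\<beta> D = 1\<close>. From
          \<open>D (\<sigma> q) = 1\<close> it follows that \<open>D\<close> is -1 at
          \<open>q\<close> and at \<open>\<tau> q\<close>, but \<open>A\<close> and \<open>B\<close>
          are 1 at \<open>\<tau> q\<close>.\<close>
        obtain A where A: "A \<in> G" "\<forall>x\<in>U. A x = f x" "\<forall>x\<in>V. A x = 1 x" "\<alpha> A = 1" "\<beta> A = 1"
          using build[OF f(1) one, of 1 1] by blast
        obtain B where B: "B \<in> G" "\<forall>x\<in>U. B x = (- 1) x" "\<forall>x\<in>V. B x = 1 x" "\<alpha> B = - 1" "\<beta> B = - 1"
          using build[OF minus_one one, of "- 1" "- 1"] by blast
        obtain C where C: "C \<in> G" "\<forall>x\<in>U. C x = 1 x" "\<forall>x\<in>V. C x = (- 1) x" "\<alpha> C = - 1" "\<beta> C = 1"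
          using build[OF one minus_one, of "- 1" 1] by blast
        obtain K where K: "K \<in> G" "\<forall>x\<in>U. K x = 1 x" "\<forall>x\<in>V. K x = (- 1) x" "\<alpha> K = 1" "\<beta> K = 1"
          using build[OF one minus_one, of 1 1] by blast
        note G = A(1) B(1) C(1) K(1)
        have vU: "A x = f x" "B x = - 1" "C x = 1" "K x = 1" if "x \<in> U" for x
          using that A(2) B(2) C(2) K(2) by auto
        have vV: "A x = 1" "B x = 1" "C x = - 1" "K x = - 1" if "x \<in> V" for x
          using that A(3) B(3) C(3) K(3) by auto
        have \<alpha>v: "A y = A x" "B y = - B x" "C y = - C x" "K y = K x" if "shifted G \<alpha> x y" for x y
          using shiftedD[OF that G(1)] shiftedD[OF that G(2)] shiftedD[OF that G(3)] shiftedD[OF that G(4)]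
            A(4,5) B(4,5) C(4,5) K(4,5) by simp_all
        have \<beta>v: "A y = A x" "B y = - B x" "C y = C x" "K y = K x" if "shifted G \<beta> x y" for x y
          using shiftedD[OF that G(1)] shiftedD[OF that G(2)] shiftedD[OF that G(3)] shiftedD[OF that G(4)]
            A(4,5) B(4,5) C(4,5) K(4,5) by simp_all
        have from_\<tau>: "shifted G \<beta> (\<tau> z) z" if "z \<in> Z" for z
          unfolding shifted_def
        proof
          fix g assume g: "g \<in> G"
          have "z \<in> S'" using that ZS' by blast
          thus "g z = \<beta> g * g (\<tau> z)" using \<tau>v[OF _ g] \<beta>s[OF g] by auto
        qed
        have cells: "\<exists>t\<in>T. x = t \<or> shifted G \<alpha> t x \<or> shifted G \<beta> t x" if "x \<in> X" for x
          using that X Y_cases[of x] from_\<tau> \<tau>Z by blast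
        obtain D where D: "D \<in> G" "\<And>x. \<lbrakk>x \<in> X; A x = - 1; B x = - 1\<rbrakk> \<Longrightarrow> D x = - 1"
            "\<And>x. \<lbrakk>x \<in> X; D x = - 1\<rbrakk> \<Longrightarrow> (A x = - 1 \<or> B x = - 1) \<and> C x = 1"
        proof (rule exchange[OF G])
          fix x assume x: "x \<in> X" "B x = - 1" "C x = - 1"
          obtain t where t: "t \<in> T" "x = t \<or> shifted G \<alpha> t x \<or> shifted G \<beta> t x"
            using cells[OF x(1)] by blast
          show "K x = - 1"
          proof (cases "t \<in> U")
            case True
            show ?thesis using t(2) x(2,3) vU[OF True] \<alpha>v[of t x] \<beta>v[of t x] by auto
          next
            case False
            hence "t \<in> V" using t(1) U(1) by blast
            show ?thesis using t(2) x(2,3) vV[OF \<open>t \<in> V\<close>] \<alpha>v[of t x] \<beta>v[of t x] by auto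
          qed
        next
          fix x assume x: "x \<in> X" "K x = - 1"
          obtain t where t: "t \<in> T" "x = t \<or> shifted G \<alpha> t x \<or> shifted G \<beta> t x"
            using cells[OF x(1)] by blast
          show "(B x = - 1 \<or> C x = - 1) \<and> A x = 1"
          proof (cases "t \<in> U")
            case True
            show ?thesis using t(2) x(2) vU[OF True] \<alpha>v[of t x] \<beta>v[of t x] by auto
          next
            case False
            hence "t \<in> V" using t(1) U(1) by blast
            show ?thesis using t(2) x(2) vV[OF \<open>t \<in> V\<close>] \<alpha>v[of t x] \<beta>v[of t x] by auto
          qed
        qed blast
        have D1: "D x = 1" if "x \<in> X" "C x = - 1 \<or> (A x = 1 \<and> B x = 1)" for x
          using D(3)[OF that(1)] sign[OF D(1) that(1)] that(2) by auto
        have \<sigma>X: "\<sigma> t \<in> X" if "t \<in> T" for t using \<sigma>(1)[OF T_Y[OF that]] Y_subset by blast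
        have \<tau>X: "\<tau> t \<in> X" if "t \<in> T" for t using \<tau>T[OF that] ZX by blast
        note \<sigma>S = \<alpha>v[OF \<sigma>(2)[OF T_Y]] and \<tau>S = \<beta>v[OF \<tau>(2)[OF T_S]]
        have "D p = - 1" using D(2)[OF T_X[OF pqr(1)]] vU[OF U(3)] f(3) by simp
        moreover have "D (\<sigma> p) = 1" using D1[OF \<sigma>X[OF pqr(1)]] \<sigma>S[OF pqr(1)] vU[OF U(3)] by simp
        ultimately have \<alpha>D: "\<alpha> D = - 1" using \<sigma>v[OF T_Y[OF pqr(1)] D(1)] by simp
        have "D r = 1" using D1[OF T_X[OF pqr(3)]] vV[OF U(6)] by simp
        moreover have "D (\<tau> r) = 1" using D1[OF \<tau>X[OF pqr(3)]] \<tau>S[OF pqr(3)] vV[OF U(6)] by simp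
        ultimately have \<beta>D: "\<beta> D = 1" using \<tau>v[OF T_S[OF pqr(3)] D(1)] by simp
        have "D (\<sigma> q) = 1" using D1[OF \<sigma>X[OF pqr(2)]] \<sigma>S[OF pqr(2)] vU[OF U(4)] by simp
        hence "D q = - 1" using \<sigma>v[OF T_Y[OF pqr(2)] D(1)] \<alpha>D by simp
        hence "D (\<tau> q) = - 1" using \<tau>v[OF T_S[OF pqr(2)] D(1)] \<beta>D by simp
        moreover have "D (\<tau> q) = 1"
          using D1[OF \<tau>X[OF pqr(2)]] \<tau>S[OF pqr(2)] vU[OF U(4)] f(2) by simp
        ultimately show False by simp
      qed
      obtain t1 t2 where t12: "t1 \<in> T1" "t2 \<in> T2" using T12 by blast
      have T1: "T1 = {t1}" using kill[OF T12(3,4) t12(1) _ _ t12(2)] t12(1) by blast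
      have "T = T2 \<union> T1" using T12(3) by blast
      hence T2: "T2 = {t2}" using kill[OF _ splits_commute[OF T12(4)] t12(2) _ _ t12(1)] t12(2) by blast
      have Tt: "T = {t1, t2}" using T12(3) T1 T2 by auto
      have tX: "t1 \<in> X" "t2 \<in> X" using Tt TY Y_subset by auto
      \<comment> \<open>A two-point \<open>T\<close> is a direct sum and still has a translation:
        the product of its points interchanges them.\<close>
      define \<gamma> where "\<gamma> = (\<lambda>g :: 'a \<Rightarrow> int. g t1 * g t2)"
      have signs: "g t1 = 1 \<or> g t1 = - 1" "g t2 = 1 \<or> g t2 = - 1" if "g \<in> G" for g
        using sign[OF that] tX by blast+
      have "sign_character G \<gamma>"
        unfolding sign_character_def
      proof (intro conjI ballI)
        fix g assume "g \<in> G"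
        thus "\<gamma> g = 1 \<or> \<gamma> g = - 1" using signs[of g] by (auto simp: \<gamma>_def)
      qed (simp add: \<gamma>_def algebra_simps)
      moreover have "\<exists>g\<in>G. \<gamma> g = - 1"
      proof -
        obtain k where k: "k \<in> G" "\<forall>x\<in>T1. k x = 1 x" "\<forall>x\<in>T2. k x = (- 1) x"
          using splitsD[OF T12(4) one minus_one] by blast
        thus ?thesis using t12 by (intro bexI[of _ k]) (simp_all add: \<gamma>_def)
      qed
      moreover have "shifted G \<gamma> t1 t2" "shifted G \<gamma> t2 t1"
        unfolding shifted_def
      proof (safe)
        fix g assume "g \<in> G"
        thus "g t2 = \<gamma> g * g t1" "g t1 = \<gamma> g * g t2" using signs[of g] by (auto simp: \<gamma>_def)
      qed
      ultimately have "translation G T \<gamma>" using Tt by (simp add: translation_def)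
      thus False by (rule no_\<gamma>)
    qed
  qed
qed

end

text \<open>Two points are required because a character that fixes a point is trivial. A maximal
  \<open>Y\<close> exists since single points are indecomposable flats.\<close>

theorem finite_indecomposable_translation:
  assumes "sign_space X G" "finite X" "indecomposable G X" "\<exists>x\<in>X. \<exists>y\<in>X. x \<noteq> y"
  shows "\<exists>\<alpha>. translation G X \<alpha>"
  using assms
proof (induction "card X" arbitrary: X rule: less_induct)
  case less
  interpret sign_space X G by (fact less.prems)
  have IH: "\<exists>\<alpha>. translation G W \<alpha>"
    if W: "flat X G W" "W \<noteq> X" "indecomposable G W" "\<exists>x\<in>W. \<exists>y\<in>W. x \<noteq> y" for W
  proof (rule less.hyps)
    have "W \<subset> X" using flat_subset[OF W(1)] W(2) by blast
    thus "card W < card X" "finite W"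
      using less.prems(2) psubset_card_mono finite_subset by blast+
    show "sign_space W G" using sign_space_flat[OF W(1)] W(4) by blast
  qed (fact W)+
  define P where "P = (\<lambda>Y. flat X G Y \<and> indecomposable G Y \<and> Y \<noteq> {} \<and> Y \<noteq> X)"
  obtain x y where xy: "x \<in> X" "y \<in> X" "x \<noteq> y" using less.prems(4) by blast
  have "P {x}"
  proof -
    have "flat X G {x}"
    proof (rule flatI)
      fix z assume z: "z \<in> X" and ann: "\<And>g. \<lbrakk>g \<in> G; \<forall>y\<in>{x}. g y = 1\<rbrakk> \<Longrightarrow> g z = 1"
      show "z \<in> {x}"
      proof (rule ccontr)
        assume "z \<notin> {x}"
        then obtain g where "g \<in> G" "g x = 1" "g z = - 1"
          using normalized_separates[of x z] xy(1) z by blast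
        thus False using ann[of g] by simp
      qed
    qed (use xy in simp)
    thus ?thesis using indecomposable_single xy by (auto simp: P_def)
  qed
  moreover have "\<forall>Y. P Y \<longrightarrow> card Y < Suc (card X)"
    using flat_subset less.prems(2) card_mono by (fastforce simp: P_def le_imp_less_Suc)
  ultimately obtain Y where Y: "P Y" and max: "\<And>W. P W \<Longrightarrow> card W \<le> card Y"
    using ex_has_greatest_nat[of P "{x}" card "Suc (card X)"] by blast
  interpret maximal_flat X G Y
  proof
    show "finite X" "indecomposable G X" by (fact less.prems)+
    show "flat X G Y" "Y \<noteq> {}" "Y \<noteq> X" "indecomposable G Y" using Y by (simp_all add: P_def)
    fix W assume W: "flat X G W" "indecomposable G W" "Y \<subseteq> W" "W \<noteq> X"
    hence "P W" using \<open>Y \<noteq> {}\<close> by (auto simp: P_def)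
    hence "card W \<le> card Y" by (rule max)
    moreover have "finite W" using flat_subset[OF W(1)] less.prems(2) by (rule finite_subset)
    ultimately show "W = Y" using W(3) card_seteq by blast
  qed
  show ?case
  \<comment> \<open>The alternative is whether the annihilator of \<open>Y\<close> has rank at least
    two or consists, on \<open>X\<close>, of 1 and a single further function that is -1 off
    \<open>Y\<close>.\<close>
  proof (cases "\<exists>g\<in>G. (\<forall>y\<in>Y. g y = 1) \<and> (\<exists>r\<in>X - Y. \<exists>s\<in>X - Y. g r = 1 \<and> g s = - 1)")
    case True
    thus ?thesis using translation_codim_two by blast
  next
    case False
    have codim: "(\<forall>x\<in>X - Y. d x = 1) \<or> (\<forall>x\<in>X - Y. d x = - 1)"
      if d: "d \<in> G" "\<forall>y\<in>Y. d y = 1" for d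
    proof -
      have "d x = 1 \<or> d x = - 1" if "x \<in> X" for x using sign[OF d(1) that] .
      thus ?thesis using False d by blast
    qed
    obtain r where r: "r \<in> X - Y" using Y_proper Y_subset by blast
    obtain a where a: "a \<in> G" "\<forall>y\<in>Y. a y = 1" "a r = - 1" using annihilator_negative[OF r] by blast
    hence "\<forall>x\<in>X - Y. a x = - 1" using codim[OF a(1,2)] r by auto
    thus ?thesis using translation_codim_one[OF a(1,2) _ codim IH] by blast
  qed
qed

section \<open>Small sets on which a formula fails\<close>

text \<open>Positive primitive formulas are treated as sets of atoms, of which there are finitely many.\<close>

fun pp_sign :: "(nat \<Rightarrow> 'a \<Rightarrow> int) \<Rightarrow> (nat \<Rightarrow> 'a \<Rightarrow> int) \<Rightarrow> pp_prod \<Rightarrow> 'a \<Rightarrow> int" where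
  "pp_sign t a (PP_Prod s T A) x = s * (\<Prod>i\<in>T. t i x) * (\<Prod>l\<in>A. a l x)"

text \<open>\<open>Y\<close> may be any set of points, not only a subspace: solutions are taken from
  \<open>G\<close> and only their values on \<open>Y\<close> are tested. This allows passing to
  small sets of points.\<close>

definition satisfied ::
    "('a \<Rightarrow> int) set \<Rightarrow> nat \<Rightarrow> (pp_prod \<times> pp_prod) set \<Rightarrow> (nat \<Rightarrow> 'a \<Rightarrow> int) \<Rightarrow> 'a set \<Rightarrow> bool" where
  "satisfied G n M a Y \<longleftrightarrow>
     (\<exists>t. (\<forall>i<n. t i \<in> G) \<and>
       (\<forall>(p, q)\<in>M. \<forall>x\<in>Y. 1 = pp_sign t a p x \<or> pp_sign t a q x = pp_sign t a p x))"

definition pp_atoms :: "nat \<Rightarrow> nat \<Rightarrow> (pp_prod \<times> pp_prod) set" where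
  "pp_atoms n k = {(p, q). pp_prod_wf n k p \<and> pp_prod_wf n k q}"

definition failing ::
    "('a \<Rightarrow> int) set \<Rightarrow> nat \<Rightarrow> nat \<Rightarrow> (nat \<Rightarrow> 'a \<Rightarrow> int) \<Rightarrow> 'a set \<Rightarrow> (pp_prod \<times> pp_prod) set set" where
  "failing G n k a Y = {M. M \<subseteq> pp_atoms n k \<and> \<not> satisfied G n M a Y}"

text \<open>A character multiplies the variables by signs \<open>\<epsilon>\<close> and the
  parameters by signs \<open>\<delta>\<close>; these are absorbed into the coefficient, so the shape
  of the formula is kept.\<close>

fun pp_twist :: "(nat \<Rightarrow> int) \<Rightarrow> (nat \<Rightarrow> int) \<Rightarrow> pp_prod \<Rightarrow> pp_prod" where
  "pp_twist \<epsilon> \<delta> (PP_Prod s T A) = PP_Prod (s * (\<Prod>i\<in>T. \<epsilon> i) * (\<Prod>l\<in>A. \<delta> l)) T A"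

section \<open>Finiteness, monotonicity and twists of formulas\<close>

lemma finite_pp_atoms: "finite (pp_atoms n k)"
proof -
  let ?P = "{p. pp_prod_wf n k p}"
  have "?P \<subseteq> (\<lambda>(s, T, A). PP_Prod s T A) ` ({1, - 1} \<times> Pow {..<n} \<times> Pow {..<k})"
  proof
    fix p assume "p \<in> ?P"
    thus "p \<in> (\<lambda>(s, T, A). PP_Prod s T A) ` ({1, - 1} \<times> Pow {..<n} \<times> Pow {..<k})"
    proof (cases p)
      case (PP_Prod s T A)
      hence "(s, T, A) \<in> {1, - 1} \<times> Pow {..<n} \<times> Pow {..<k}" using \<open>p \<in> ?P\<close> by simp
      thus ?thesis unfolding PP_Prod by (rule rev_image_eqI) simp
    qed
  qed
  hence "finite ?P" by (rule finite_subset) simp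
  hence "finite (?P \<times> ?P)" by simp
  moreover have "pp_atoms n k = ?P \<times> ?P" by (auto simp: pp_atoms_def)
  ultimately show ?thesis by simp
qed

lemma failing_subset: "failing G n k a Y \<subseteq> Pow (pp_atoms n k)"
  by (auto simp: failing_def)

lemma finite_failing: "finite (failing G n k a Y)"
  using failing_subset by (rule finite_subset) (simp add: finite_pp_atoms)

lemma satisfied_mono:
  assumes "satisfied G n M a Y" "Y' \<subseteq> Y" "M' \<subseteq> M" shows "satisfied G n M' a Y'"
proof -
  obtain t where t: "\<forall>i<n. t i \<in> G"
      "\<forall>(p, q)\<in>M. \<forall>x\<in>Y. 1 = pp_sign t a p x \<or> pp_sign t a q x = pp_sign t a p x"
    using assms(1) unfolding satisfied_def by blast
  have "\<forall>(p, q)\<in>M'. \<forall>x\<in>Y'. 1 = pp_sign t a p x \<or> pp_sign t a q x = pp_sign t a p x"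
    using t(2) assms(2,3) by fast
  thus ?thesis using t(1) unfolding satisfied_def by blast
qed

lemma failing_mono: "Y' \<subseteq> Y \<Longrightarrow> failing G n k a Y' \<subseteq> failing G n k a Y"
  using satisfied_mono[of G n _ a Y Y'] by (auto simp: failing_def)

lemma pp_sign_cong:
  assumes "pp_prod_wf n k p" "\<And>i. i < n \<Longrightarrow> t i x = t' i y" "\<And>l. l < k \<Longrightarrow> a l x = a' l y"
  shows "pp_sign t a p x = pp_sign t' a' p y"
proof (cases p)
  case (PP_Prod s T A)
  have "(\<Prod>i\<in>T. t i x) = (\<Prod>i\<in>T. t' i y)"
    by (rule prod.cong) (use assms PP_Prod in auto)
  moreover have "(\<Prod>i\<in>A. a i x) = (\<Prod>i\<in>A. a' i y)"
    by (rule prod.cong) (use assms PP_Prod in auto)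
  ultimately show ?thesis by (simp add: PP_Prod)
qed

lemma pp_sign_shifted:
  assumes "pp_prod_wf n k p" "\<And>i. i < n \<Longrightarrow> t i y = \<epsilon> i * t i x" "\<And>l. l < k \<Longrightarrow> a l y = \<delta> l * a l x"
  shows "pp_sign t a p y = pp_sign t a (pp_twist \<epsilon> \<delta> p) x"
proof (cases p)
  case (PP_Prod s T A)
  have "(\<Prod>i\<in>T. t i y) = (\<Prod>i\<in>T. \<epsilon> i * t i x)"
    by (rule prod.cong) (use assms PP_Prod in auto)
  moreover have "(\<Prod>i\<in>A. a i y) = (\<Prod>i\<in>A. \<delta> i * a i x)"
    by (rule prod.cong) (use assms PP_Prod in auto)
  ultimately show ?thesis by (simp add: PP_Prod prod.distrib)
qed

lemma prod_signs:
  assumes "\<And>i. i \<in> T \<Longrightarrow> f i = 1 \<or> f i = - 1"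
  shows "(\<Prod>i\<in>T. f i) = 1 \<or> (\<Prod>i\<in>T. f i) = (- 1 :: int)"
  using assms
proof (induction T rule: infinite_finite_induct)
  case (insert i T)
  have "f i = 1 \<or> f i = - 1" "prod f T = 1 \<or> prod f T = - 1"
    using insert.prems insert.IH by simp_all
  thus ?case using insert.hyps by auto
qed simp_all

lemma pp_twist_wf:
  assumes "pp_prod_wf n k p" "\<And>i. i < n \<Longrightarrow> \<epsilon> i = 1 \<or> \<epsilon> i = - 1" "\<And>l. l < k \<Longrightarrow> \<delta> l = 1 \<or> \<delta> l = - 1"
  shows "pp_prod_wf n k (pp_twist \<epsilon> \<delta> p)"
proof (cases p)
  case (PP_Prod s T A)
  have "(\<Prod>i\<in>T. \<epsilon> i) = 1 \<or> (\<Prod>i\<in>T. \<epsilon> i) = - 1"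
    by (rule prod_signs) (use assms PP_Prod in auto)
  moreover have "(\<Prod>i\<in>A. \<delta> i) = 1 \<or> (\<Prod>i\<in>A. \<delta> i) = - 1"
    by (rule prod_signs) (use assms PP_Prod in auto)
  ultimately show ?thesis using assms(1) by (auto simp: PP_Prod)
qed

text \<open>Atoms are tested pointwise, so solutions on \<open>Y\<close> and on \<open>Z\<close> can
  be glued variable by variable.\<close>

lemma failing_splits:
  assumes "splits G Y Z"
  shows "failing G n k a (Y \<union> Z) \<subseteq> failing G n k a Y \<union> failing G n k a Z"
proof
  fix M assume M: "M \<in> failing G n k a (Y \<union> Z)"
  show "M \<in> failing G n k a Y \<union> failing G n k a Z"
  proof (rule ccontr)
    assume "\<not> ?thesis"
    hence "satisfied G n M a Y" "satisfied G n M a Z" using M by (auto simp: failing_def)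
    then obtain t u where t: "\<forall>i<n. t i \<in> G"
        "\<forall>(p, q)\<in>M. \<forall>x\<in>Y. 1 = pp_sign t a p x \<or> pp_sign t a q x = pp_sign t a p x"
      and u: "\<forall>i<n. u i \<in> G"
        "\<forall>(p, q)\<in>M. \<forall>x\<in>Z. 1 = pp_sign u a p x \<or> pp_sign u a q x = pp_sign u a p x"
      unfolding satisfied_def by blast
    have "\<forall>i. \<exists>k. i < n \<longrightarrow> k \<in> G \<and> (\<forall>x\<in>Y. k x = t i x) \<and> (\<forall>x\<in>Z. k x = u i x)"
    proof
      fix i
      show "\<exists>k. i < n \<longrightarrow> k \<in> G \<and> (\<forall>x\<in>Y. k x = t i x) \<and> (\<forall>x\<in>Z. k x = u i x)"
      proof (cases "i < n")
        case True
        hence "t i \<in> G" "u i \<in> G" using t(1) u(1) by simp_all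
        from splitsD[OF assms this] show ?thesis by (auto simp: Bex_def)
      qed simp
    qed
    from choice[OF this] obtain v
      where v: "\<forall>i. i < n \<longrightarrow> v i \<in> G \<and> (\<forall>x\<in>Y. v i x = t i x) \<and> (\<forall>x\<in>Z. v i x = u i x)" ..
    have "1 = pp_sign v a p x \<or> pp_sign v a q x = pp_sign v a p x"
      if pq: "(p, q) \<in> M" and x: "x \<in> Y \<union> Z" for p q x
    proof -
      have wf: "pp_prod_wf n k p" "pp_prod_wf n k q"
        using M pq by (auto simp: failing_def pp_atoms_def)
      show ?thesis
      proof (cases "x \<in> Y")
        case True
        have "pp_sign v a p x = pp_sign t a p x" "pp_sign v a q x = pp_sign t a q x"
          by (rule pp_sign_cong[OF wf(1)] pp_sign_cong[OF wf(2)]; use v True in simp)+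
        thus ?thesis using t(2) pq True by auto
      next
        case False
        hence xZ: "x \<in> Z" using x by blast
        have "pp_sign v a p x = pp_sign u a p x" "pp_sign v a q x = pp_sign u a q x"
          by (rule pp_sign_cong[OF wf(1)] pp_sign_cong[OF wf(2)]; use v xZ in simp)+
        thus ?thesis using u(2) pq xZ by auto
      qed
    qed
    hence "satisfied G n M a (Y \<union> Z)" unfolding satisfied_def using v by blast
    thus False using M by (simp add: failing_def)
  qed
qed

text \<open>
  Along a translation \<open>\<alpha>\<close>, a formula on \<open>X\<close> becomes a conjunction of the formula and a sign-twisted
  copy of it on the transversal where \<open>h = 1\<close>.
\<close>

lemma (in sign_space) failing_translation:
  assumes \<alpha>: "sign_character G \<alpha>" and h: "h \<in> G" "\<alpha> h = - 1"
    and \<sigma>: "\<And>x. x \<in> X \<Longrightarrow> \<sigma> x \<in> X" "\<And>x. x \<in> X \<Longrightarrow> shifted G \<alpha> x (\<sigma> x)"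
    and a: "\<forall>l<k. a l \<in> G"
    and W: "W \<subseteq> X" "failing G n k a {x\<in>X. h x = 1} \<subseteq> failing G n k a W"
  shows "failing G n k a X \<subseteq> failing G n k a (W \<union> \<sigma> ` W)"
proof
  let ?Z = "{x\<in>X. h x = 1}"
  fix M assume M: "M \<in> failing G n k a X"
  hence M_atoms: "M \<subseteq> pp_atoms n k" and M_no: "\<not> satisfied G n M a X" by (simp_all add: failing_def)
  have wf: "pp_prod_wf n k p" "pp_prod_wf n k q" if "(p, q) \<in> M" for p q
    using that M_atoms by (auto simp: pp_atoms_def)
  show "M \<in> failing G n k a (W \<union> \<sigma> ` W)"
  proof (rule ccontr)
    assume "\<not> ?thesis"
    hence "satisfied G n M a (W \<union> \<sigma> ` W)" using M_atoms by (simp add: failing_def)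
    then obtain t where t: "\<forall>i<n. t i \<in> G"
        "\<forall>(p, q)\<in>M. \<forall>x\<in>W \<union> \<sigma> ` W. 1 = pp_sign t a p x \<or> pp_sign t a q x = pp_sign t a p x"
      unfolding satisfied_def by blast
    \<comment> \<open>The twist uses the signs of the solution \<open>t\<close> on the small set,
      which are not known when \<open>W\<close> is chosen. This is why \<open>W\<close> has to
      detect every failing formula and not just \<open>M\<close>.\<close>
    define tw where "tw = pp_twist (\<lambda>i. \<alpha> (t i)) (\<lambda>l. \<alpha> (a l))"
    define M' where "M' = M \<union> (\<lambda>(p, q). (tw p, tw q)) ` M"
    have tw_wf: "pp_prod_wf n k (tw p)" if "pp_prod_wf n k p" for p
      unfolding tw_def using that
      by (rule pp_twist_wf) (use sign_characterD(1)[OF \<alpha>] t(1) a in auto)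
    have "M' \<subseteq> pp_atoms n k"
      using M_atoms tw_wf by (auto simp: M'_def pp_atoms_def)
    have shift: "pp_sign u a p (\<sigma> x) = pp_sign u a (tw p) x"
      if "pp_prod_wf n k p" "x \<in> X" "\<forall>i<n. u i \<in> G \<and> \<alpha> (u i) = \<alpha> (t i)" for u p x
      unfolding tw_def using that(1)
    proof (rule pp_sign_shifted)
      show "u i (\<sigma> x) = \<alpha> (t i) * u i x" if "i < n" for i
        using shiftedD[OF \<sigma>(2)[OF \<open>x \<in> X\<close>], of "u i"] \<open>\<forall>i<n. u i \<in> G \<and> \<alpha> (u i) = \<alpha> (t i)\<close> that
        by simp
      show "a l (\<sigma> x) = \<alpha> (a l) * a l x" if "l < k" for l
        using shiftedD[OF \<sigma>(2)[OF \<open>x \<in> X\<close>], of "a l"] a that by simp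
    qed
    have "1 = pp_sign t a p x \<or> pp_sign t a q x = pp_sign t a p x"
      if pq: "(p, q) \<in> M'" and x: "x \<in> W" for p q x
    proof (cases "(p, q) \<in> M")
      case True
      thus ?thesis using t(2) x by auto
    next
      case False
      then obtain p' q' where pq': "(p', q') \<in> M" "p = tw p'" "q = tw q'"
        using pq by (auto simp: M'_def)
      have xX: "x \<in> X" using x W(1) by blast
      have "pp_sign t a p' (\<sigma> x) = pp_sign t a p x" "pp_sign t a q' (\<sigma> x) = pp_sign t a q x"
        unfolding pq'(2,3) using shift[OF _ xX] wf[OF pq'(1)] t(1) by blast+
      moreover have "1 = pp_sign t a p' (\<sigma> x) \<or> pp_sign t a q' (\<sigma> x) = pp_sign t a p' (\<sigma> x)"
        using bspec[OF t(2) pq'(1)] x by simp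
      ultimately show ?thesis by simp
    qed
    hence "satisfied G n M' a W" unfolding satisfied_def using t(1) by blast
    hence "M' \<notin> failing G n k a ?Z" using W(2) by (auto simp: failing_def)
    hence "satisfied G n M' a ?Z" using \<open>M' \<subseteq> pp_atoms n k\<close> by (simp add: failing_def)
    then obtain u where u: "\<forall>i<n. u i \<in> G"
        "\<forall>(p, q)\<in>M'. \<forall>x\<in>?Z. 1 = pp_sign u a p x \<or> pp_sign u a q x = pp_sign u a p x"
      unfolding satisfied_def by blast
    \<comment> \<open>The solution \<open>u\<close> on \<open>?Z\<close> must have the signs under
      \<open>\<alpha>\<close> that were used in the twist. As \<open>h\<close> is 1 on
      \<open>?Z\<close>, multiplying by it corrects a sign without changing a value there.\<close>
    define v where "v = (\<lambda>i. if \<alpha> (u i) = \<alpha> (t i) then u i else u i * h)"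
    have v: "\<forall>i<n. v i \<in> G \<and> \<alpha> (v i) = \<alpha> (t i)"
    proof (intro allI impI)
      fix i assume i: "i < n"
      have "u i \<in> G" "t i \<in> G" using u(1) t(1) i by blast+
      thus "v i \<in> G \<and> \<alpha> (v i) = \<alpha> (t i)"
        using mult[OF _ h(1)] sign_characterD(2)[OF \<alpha> _ h(1)] h(2)
          sign_characterD(1)[OF \<alpha> \<open>u i \<in> G\<close>] sign_characterD(1)[OF \<alpha> \<open>t i \<in> G\<close>]
        by (auto simp: v_def)
    qed
    have vu: "pp_sign v a p x = pp_sign u a p x" if "pp_prod_wf n k p" "x \<in> ?Z" for p x
      by (rule pp_sign_cong[OF that(1)]) (use that(2) in \<open>auto simp: v_def\<close>)
    have on_Z: "1 = pp_sign v a p x \<or> pp_sign v a q x = pp_sign v a p x"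
      if "(p, q) \<in> M'" "x \<in> ?Z" for p q x
    proof -
      have "pp_prod_wf n k p" "pp_prod_wf n k q"
        using that(1) \<open>M' \<subseteq> pp_atoms n k\<close> by (auto simp: pp_atoms_def)
      thus ?thesis using u(2) that vu by fastforce
    qed
    have "1 = pp_sign v a p x \<or> pp_sign v a q x = pp_sign v a p x"
      if pq: "(p, q) \<in> M" and x: "x \<in> X" for p q x
    proof (cases "h x = 1")
      case True
      thus ?thesis using on_Z[of p q x] pq x by (simp add: M'_def)
    next
      case False
      hence "h x = - 1" using sign[OF h(1) x] by blast
      hence Z: "\<sigma> x \<in> ?Z" using shiftedD[OF \<sigma>(2)[OF x] h(1)] h(2) \<sigma>(1)[OF x] by simp
      have back_shift: "shifted G \<alpha> (\<sigma> x) x"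
        unfolding shifted_def
      proof
        fix g assume g: "g \<in> G"
        show "g x = \<alpha> g * g (\<sigma> x)"
          using shiftedD[OF \<sigma>(2)[OF x] g] sign_characterD(1)[OF \<alpha> g] by auto
      qed
      have "pp_sign v a r x = pp_sign v a (tw r) (\<sigma> x)" if "pp_prod_wf n k r" for r
        unfolding tw_def using that
      proof (rule pp_sign_shifted)
        show "v i x = \<alpha> (t i) * v i (\<sigma> x)" if "i < n" for i
          using shiftedD[OF back_shift, of "v i"] v that by simp
        show "a l x = \<alpha> (a l) * a l (\<sigma> x)" if "l < k" for l
          using shiftedD[OF back_shift, of "a l"] a that by simp
      qed
      moreover have "(tw p, tw q) \<in> M'" using pq by (force simp: M'_def)
      ultimately show ?thesis using on_Z[OF _ Z] wf[OF pq] by simp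
    qed
    hence "satisfied G n M a X" unfolding satisfied_def using v by blast
    thus False using M_no by simp
  qed
qed

theorem small_failing_set:
  assumes "sign_space X G" "finite X" "\<forall>l<k. a l \<in> G"
  shows "\<exists>W\<subseteq>X. card W \<le> 2 ^ card (failing G n k a X) \<and> failing G n k a X \<subseteq> failing G n k a W"
  using assms(1,2)
proof (induction "card X" arbitrary: X rule: less_induct)
  case less
  interpret sign_space X G by (fact less.prems)
  let ?E = "failing G n k a"
  let ?d = "card (?E X)"
  let ?goal = "\<exists>W\<subseteq>X. card W \<le> 2 ^ ?d \<and> ?E X \<subseteq> ?E W"
  have IH: "\<exists>W\<subseteq>Y. card W \<le> 2 ^ card (?E Y) \<and> ?E Y \<subseteq> ?E W"
    if Y: "flat X G Y" "Y \<noteq> {}" "Y \<noteq> X" for Y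
  proof (rule less.hyps)
    have "Y \<subset> X" using flat_subset[OF Y(1)] Y(3) by blast
    thus "card Y < card X" "finite Y"
      using less.prems(2) psubset_card_mono finite_subset by blast+
    show "sign_space Y G" using sign_space_flat[OF Y(1,2)] .
  qed
  \<comment> \<open>If the same formulas fail on \<open>Y\<close> and on \<open>X\<close>, the set
    found for \<open>Y\<close> proves the goal directly. Otherwise the exponent drops by at least
    one, which leaves room for two copies.\<close>
  have half: "2 * 2 ^ card (?E Y) \<le> (2 :: nat) ^ ?d"
    if no: "\<not> ?goal" and Y: "Y \<subseteq> X" and W: "W \<subseteq> Y" "card W \<le> 2 ^ card (?E Y)" "?E Y \<subseteq> ?E W" for Y W
  proof (cases "?E Y = ?E X")
    case True
    have "W \<subseteq> X" "card W \<le> 2 ^ ?d" "?E X \<subseteq> ?E W" using W Y True by auto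
    hence ?goal by (intro exI[of _ W]) simp
    thus ?thesis using no by simp
  next
    case False
    hence "?E Y \<subset> ?E X" using failing_mono[OF Y] by blast
    hence "card (?E Y) < ?d" using finite_failing by (intro psubset_card_mono)
    hence "(2 :: nat) ^ Suc (card (?E Y)) \<le> 2 ^ ?d" by (intro power_increasing) auto
    thus ?thesis by simp
  qed
  show ?case
  proof (cases "indecomposable G X")
    case False
    then obtain Y Z where YZ: "Y \<noteq> {}" "Z \<noteq> {}" "X = Y \<union> Z" "splits G Y Z"
      by (auto simp: indecomposable_def)
    have disj: "Y \<inter> Z = {}" using splits_disjoint[OF YZ(4)] .
    hence compl: "X - Y = Z" "X - Z = Y" using YZ(3) by blast+
    have flats: "flat X G Y" "flat X G Z"
      using splits_flat[of Y] splits_flat[of Z] YZ(3,4) splits_commute[OF YZ(4)] compl by simp_all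
    have proper: "Y \<noteq> X" "Z \<noteq> X" using YZ(1,2) compl by blast+
    obtain V where V: "V \<subseteq> Y" "card V \<le> 2 ^ card (?E Y)" "?E Y \<subseteq> ?E V"
      using IH[OF flats(1) YZ(1) proper(1)] by blast
    obtain W where W: "W \<subseteq> Z" "card W \<le> 2 ^ card (?E Z)" "?E Z \<subseteq> ?E W"
      using IH[OF flats(2) YZ(2) proper(2)] by blast
    have "?E X \<subseteq> ?E Y \<union> ?E Z" unfolding YZ(3) by (rule failing_splits[OF YZ(4)])
    also have "\<dots> \<subseteq> ?E (V \<union> W)"
      using V(3) W(3) failing_mono[of V "V \<union> W"] failing_mono[of W "V \<union> W"] by blast
    finally have E: "?E X \<subseteq> ?E (V \<union> W)" .
    have sub: "V \<union> W \<subseteq> X" using V(1) W(1) YZ(3) by blast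
    show ?thesis
    proof (rule ccontr)
      assume no: "\<not> ?thesis"
      have "2 * 2 ^ card (?E Y) \<le> (2 :: nat) ^ ?d" by (rule half[OF no _ V]) (use YZ in blast)
      moreover have "2 * 2 ^ card (?E Z) \<le> (2 :: nat) ^ ?d" by (rule half[OF no _ W]) (use YZ in blast)
      moreover have "card (V \<union> W) \<le> card V + card W" by (rule card_Un_le)
      ultimately have "card (V \<union> W) \<le> 2 ^ ?d" using V(2) W(2) by linarith
      thus False using no E sub by blast
    qed
  next
    case conn: True
    show ?thesis
    proof (cases "\<exists>x\<in>X. \<exists>y\<in>X. x \<noteq> y")
      case False
      then obtain x where "X = {x}" using nonempty by blast
      thus ?thesis by (intro exI[of _ X]) simp
    next
      case True
      then obtain \<alpha> where \<alpha>: "translation G X \<alpha>"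
        using finite_indecomposable_translation less.prems conn by blast
      have ch: "sign_character G \<alpha>" using \<alpha> by (simp add: translation_def)
      obtain h where h: "h \<in> G" "\<alpha> h = - 1" using \<alpha> by (auto simp: translation_def)
      have "\<forall>x\<in>X. \<exists>y. y \<in> X \<and> shifted G \<alpha> x y" using \<alpha> by (auto simp: translation_def)
      from bchoice[OF this] obtain \<sigma> where "\<forall>x\<in>X. \<sigma> x \<in> X \<and> shifted G \<alpha> x (\<sigma> x)" ..
      hence \<sigma>: "\<And>x. x \<in> X \<Longrightarrow> \<sigma> x \<in> X" "\<And>x. x \<in> X \<Longrightarrow> shifted G \<alpha> x (\<sigma> x)" by simp_all
      let ?Z = "{x\<in>X. h x = 1}"
      obtain x where x: "x \<in> X" using nonempty by blast
      have "h (\<sigma> x) = - h x" using shiftedD[OF \<sigma>(2)[OF x] h(1)] h(2) by simp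
      moreover have "h x = 1 \<or> h x = - 1" using sign[OF h(1) x] .
      ultimately have Z: "?Z \<noteq> {}" "?Z \<noteq> X" using x \<sigma>(1)[OF x] by force+
      obtain W where W: "W \<subseteq> ?Z" "card W \<le> 2 ^ card (?E ?Z)" "?E ?Z \<subseteq> ?E W"
        using IH[OF flat_positive[OF flat_self h(1)] Z] by blast
      have WX: "W \<subseteq> X" using W(1) by blast
      have E: "?E X \<subseteq> ?E (W \<union> \<sigma> ` W)"
        by (rule failing_translation[OF ch h \<sigma> assms(3) WX W(3)])
      have "finite W" using WX less.prems(2) by (rule finite_subset)
      hence "card (W \<union> \<sigma> ` W) \<le> card W + card W"
        using card_Un_le[of W "\<sigma> ` W"] card_image_le[of W \<sigma>] by linarith
      moreover have "W \<union> \<sigma> ` W \<subseteq> X" using WX \<sigma>(1) by blast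
      ultimately have "?goal" if "2 * 2 ^ card (?E ?Z) \<le> (2 :: nat) ^ ?d"
        using that E W(2) by (intro exI[of _ "W \<union> \<sigma> ` W"]) simp
      thus ?thesis using half[OF _ _ W] by blast
    qed
  qed
qed

section \<open>Spaces of orderings as sign spaces\<close>

text \<open>
  All functions whose restriction to \<open>X\<close> lies in \<open>G\<close>. Their values outside \<open>X\<close> are irrelevant, which
  makes pointwise products and passing to subspaces unproblematic.
\<close>

definition liftings :: "'a set \<Rightarrow> ('a \<Rightarrow> int) set \<Rightarrow> ('a \<Rightarrow> int) set" where
  "liftings X G = {f. restrict f X \<in> G}"

lemma sign_functions_simps:
  "carrier (sign_functions X) = (\<Pi>\<^sub>E x\<in>X. {- 1, 1})"
  "a \<otimes>\<^bsub>sign_functions X\<^esub> b = (\<lambda>x\<in>X. a x * b x)"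
  "\<one>\<^bsub>sign_functions X\<^esub> = (\<lambda>x\<in>X. 1)"
  by (simp_all add: sign_functions_def sign_img_def)

lemma group_on_simps:
  "carrier (group_on X G) = G" "a \<otimes>\<^bsub>group_on X G\<^esub> b = (\<lambda>x\<in>X. a x * b x)"
  by (simp_all add: group_on_def sign_functions_simps)

lemma sign_img_simps: "carrier sign_img = {- 1, 1}" "a \<otimes>\<^bsub>sign_img\<^esub> b = a * b" "\<one>\<^bsub>sign_img\<^esub> = 1"
  by (simp_all add: sign_img_def)

context space_of_orderings
begin

lemma subgroup_closed:
  shows "\<lbrakk>a \<in> G; b \<in> G\<rbrakk> \<Longrightarrow> (\<lambda>x\<in>X. a x * b x) \<in> G" and "(\<lambda>x\<in>X. 1) \<in> G"
    and "G \<subseteq> (\<Pi>\<^sub>E x\<in>X. {- 1, 1})"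
  using subgroup.m_closed[OF G_subgroup] subgroup.one_closed[OF G_subgroup]
    subgroup.subset[OF G_subgroup]
  by (simp_all add: sign_functions_simps)

lemma restrict_mem: "a \<in> G \<Longrightarrow> restrict a X = a"
  using subgroup_closed(3) by (auto simp: PiE_def extensional_restrict)

lemma mem_liftings: "a \<in> G \<Longrightarrow> a \<in> liftings X G"
  by (simp add: liftings_def restrict_mem)

lemma sign_group_liftings: "sign_group X (liftings X G)"
proof
  fix a x assume "a \<in> liftings X G" and x: "x \<in> X"
  hence "restrict a X \<in> (\<Pi>\<^sub>E x\<in>X. {- 1, 1})"
    unfolding liftings_def using subgroup_closed(3) by blast
  hence "restrict a X x \<in> {- 1, 1}" using x by (rule PiE_mem)
  thus "a x = 1 \<or> a x = - 1" using x by auto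
next
  have "restrict 1 X = (\<lambda>x\<in>X. 1 :: int)" by (rule restrict_ext) simp
  thus "1 \<in> liftings X G" using subgroup_closed(2) by (simp add: liftings_def)
next
  fix a b assume "a \<in> liftings X G" "b \<in> liftings X G"
  hence "(\<lambda>x\<in>X. restrict a X x * restrict b X x) \<in> G"
    unfolding liftings_def mem_Collect_eq by (rule subgroup_closed(1))
  moreover have "(\<lambda>x\<in>X. restrict a X x * restrict b X x) = restrict (a * b) X"
    by (rule restrict_ext) simp
  ultimately show "a * b \<in> liftings X G" by (simp add: liftings_def)
next
  fix a assume "a \<in> liftings X G"
  hence "(\<lambda>x\<in>X. minus_one X x * restrict a X x) \<in> G"
    unfolding liftings_def mem_Collect_eq by (rule subgroup_closed(1)[OF minus_one_mem])
  moreover have "(\<lambda>x\<in>X. minus_one X x * restrict a X x) = restrict (- a) X"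
    by (rule restrict_ext) (simp add: minus_one_def)
  ultimately show "- a \<in> liftings X G" by (simp add: liftings_def)
qed

lemma sign_space_liftings: "sign_space X (liftings X G)"
proof -
  interpret sign_group X "liftings X G" by (rule sign_group_liftings)
  show ?thesis
  proof
    show "X \<noteq> {}" by (rule nonempty)
    fix x y assume "x \<in> X" "y \<in> X" "x \<noteq> y"
    from separates[OF this] show "\<exists>a\<in>liftings X G. a x \<noteq> a y" using mem_liftings by blast
  next
    fix \<chi> :: "('a \<Rightarrow> int) \<Rightarrow> int"
    assume signs: "\<And>a. a \<in> liftings X G \<Longrightarrow> \<chi> a = 1 \<or> \<chi> a = - 1"
      and hom: "\<And>a b. \<lbrakk>a \<in> liftings X G; b \<in> liftings X G\<rbrakk> \<Longrightarrow> \<chi> (a * b) = \<chi> a * \<chi> b"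
      and m1: "\<chi> (- 1) = - 1"
      and sat: "\<And>a c. \<lbrakk>a \<in> liftings X G; c \<in> liftings X G; \<chi> a = 1; \<forall>x\<in>X. a x = 1 \<longrightarrow> c x = 1\<rbrakk> \<Longrightarrow> \<chi> c = 1"
    have \<chi>1: "\<chi> 1 = 1" using hom[OF one one] signs[OF one] by auto
    \<comment> \<open>A character of the liftings sees only the values on \<open>X\<close>:
      \<open>f * g\<close> is 1 on \<open>X\<close>, hence in D(1,1).\<close>
    have cong: "\<chi> f = \<chi> g" if fg: "f \<in> liftings X G" "g \<in> liftings X G" "\<forall>x\<in>X. f x = g x" for f g
    proof -
      have "\<forall>x\<in>X. 1 x = 1 \<longrightarrow> (f * g) x = 1"
        using fg(3) sign[OF fg(2)] by fastforce
      hence "\<chi> (f * g) = 1" by (rule sat[OF one mult[OF fg(1,2)] \<chi>1])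
      thus ?thesis using hom[OF fg(1,2)] signs[OF fg(1)] signs[OF fg(2)] by auto
    qed
    have "\<exists>x\<in>X. \<forall>a\<in>G. \<chi> a = a x"
    proof (rule character_in_image)
      show "\<chi> \<in> hom (group_on X G) sign_img"
      proof (rule homI)
        fix a assume "a \<in> carrier (group_on X G)"
        thus "\<chi> a \<in> carrier sign_img"
          using signs[OF mem_liftings] by (auto simp: group_on_simps sign_img_simps)
      next
        fix a b assume "a \<in> carrier (group_on X G)" "b \<in> carrier (group_on X G)"
        hence ab: "a \<in> G" "b \<in> G" by (simp_all add: group_on_simps)
        have "\<chi> (\<lambda>x\<in>X. a x * b x) = \<chi> (a * b)"
        proof (rule cong)
          show "(\<lambda>x\<in>X. a x * b x) \<in> liftings X G" by (rule mem_liftings[OF subgroup_closed(1)[OF ab]])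
          show "a * b \<in> liftings X G" by (rule mult[OF mem_liftings[OF ab(1)] mem_liftings[OF ab(2)]])
        qed simp
        thus "\<chi> (a \<otimes>\<^bsub>group_on X G\<^esub> b) = \<chi> a \<otimes>\<^bsub>sign_img\<^esub> \<chi> b"
          using hom[OF mem_liftings[OF ab(1)] mem_liftings[OF ab(2)]]
          by (simp add: group_on_simps sign_img_simps)
      qed
      have "\<chi> (minus_one X) = \<chi> (- 1)"
        by (rule cong[OF mem_liftings[OF minus_one_mem] minus[OF one]]) (simp add: minus_one_def)
      thus "\<chi> (minus_one X) = - 1" using m1 by simp
      show "\<forall>a\<in>kernel (group_on X G) sign_img \<chi>. \<forall>b\<in>kernel (group_on X G) sign_img \<chi>.
          value_set X G a b \<subseteq> kernel (group_on X G) sign_img \<chi>"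
      proof (intro ballI subsetI)
        fix a b c assume "a \<in> kernel (group_on X G) sign_img \<chi>" "b \<in> kernel (group_on X G) sign_img \<chi>"
          and c: "c \<in> value_set X G a b"
        hence a: "a \<in> liftings X G" "\<chi> a = 1" and b: "b \<in> liftings X G" "\<chi> b = 1"
          using mem_liftings by (simp_all add: kernel_def group_on_simps sign_img_simps)
        have cG: "c \<in> G" and cv: "\<forall>x\<in>X. a x = c x \<or> b x = c x" using c by (simp_all add: value_set_def)
        note cL = mem_liftings[OF cG]
        \<comment> \<open>Translates D(a,b) back to D(1,ab), the form of (AX2) in
          \<open>sign_space\<close>.\<close>
        have "\<chi> (a * c) = 1"
        proof (rule sat[OF mult[OF a(1) b(1)] mult[OF a(1) cL]])
          show "\<chi> (a * b) = 1" using hom[OF a(1) b(1)] a b by simp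
          show "\<forall>x\<in>X. (a * b) x = 1 \<longrightarrow> (a * c) x = 1"
            using cv sign[OF a(1)] sign[OF b(1)] by fastforce
        qed
        hence "\<chi> c = 1" using hom[OF a(1) cL] a by simp
        thus "c \<in> kernel (group_on X G) sign_img \<chi>"
          using cG by (simp add: kernel_def group_on_simps sign_img_simps)
      qed
    qed
    then obtain x where x: "x \<in> X" "\<forall>a\<in>G. \<chi> a = a x" by blast
    have "\<chi> a = a x" if a: "a \<in> liftings X G" for a
    proof -
      have G: "restrict a X \<in> G" using a by (simp add: liftings_def)
      have "\<chi> a = \<chi> (restrict a X)" by (rule cong[OF a mem_liftings[OF G]]) simp
      thus ?thesis using x G by simp
    qed
    thus "\<exists>x\<in>X. \<forall>a\<in>liftings X G. \<chi> a = a x" using x(1) by blast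
  next
    fix a1 a2 a3 b c
    assume L: "a1 \<in> liftings X G" "a2 \<in> liftings X G" "a3 \<in> liftings X G" "b \<in> liftings X G" "c \<in> liftings X G"
      and c: "\<forall>x\<in>X. a2 x = c x \<or> a3 x = c x" and b: "\<forall>x\<in>X. a1 x = b x \<or> c x = b x"
    let ?r = "\<lambda>f. restrict f X"
    have G: "?r a1 \<in> G" "?r a2 \<in> G" "?r a3 \<in> G" "?r b \<in> G" "?r c \<in> G"
      using L by (simp_all add: liftings_def)
    have "?r c \<in> value_set X G (?r a2) (?r a3)" "?r b \<in> value_set X G (?r a1) (?r c)"
      using G b c by (simp_all add: value_set_def)
    from weak_associativity[OF G(1-3) this] obtain d
      where d: "d \<in> value_set X G (?r a1) (?r a2)" "?r b \<in> value_set X G d (?r a3)" by blast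
    have "d \<in> liftings X G" using d(1) mem_liftings by (simp add: value_set_def)
    moreover have "\<forall>x\<in>X. a1 x = d x \<or> a2 x = d x" using d(1) by (simp add: value_set_def)
    moreover have "\<forall>x\<in>X. d x = b x \<or> a3 x = b x" using d(2) by (simp add: value_set_def)
    ultimately show "\<exists>d\<in>liftings X G. (\<forall>x\<in>X. a1 x = d x \<or> a2 x = d x) \<and> (\<forall>x\<in>X. d x = b x \<or> a3 x = b x)"
      by blast
  qed
qed

lemma flat_liftings:
  assumes "ordering_subspace X G Y" shows "flat X (liftings X G) Y"
proof (rule flatI)
  obtain S where S: "S \<subseteq> G" "Y = X \<inter> (\<Inter>a\<in>S. positive_set X a)"
    using assms by (auto simp: ordering_subspace_def)
  show "Y \<subseteq> X" using S(2) by blast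
  fix x assume x: "x \<in> X" and ann: "\<And>g. \<lbrakk>g \<in> liftings X G; \<forall>y\<in>Y. g y = 1\<rbrakk> \<Longrightarrow> g x = 1"
  have "x \<in> positive_set X a" if a: "a \<in> S" for a
  proof -
    have "\<forall>y\<in>Y. a y = 1" using S(2) a by (auto simp: positive_set_def)
    hence "a x = 1" using ann mem_liftings S(1) a by blast
    thus ?thesis using x by (simp add: positive_set_def)
  qed
  thus "x \<in> Y" using S(2) x by blast
qed

end

lemma (in sign_group) pp_sign_mem:
  assumes "pp_prod_wf n k p" "\<forall>i<n. t i \<in> G" "\<forall>l<k. a l \<in> G"
  shows "pp_sign t a p \<in> G"
proof (cases p)
  case (PP_Prod s T A)
  have prods: "(\<lambda>x. \<Prod>i\<in>B. f i x) \<in> G" if "\<And>i. i \<in> B \<Longrightarrow> f i \<in> G" for B :: "nat set" and f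
    using that
  proof (induction B rule: infinite_finite_induct)
    case (insert i B)
    have "f i * (\<lambda>x. \<Prod>j\<in>B. f j x) \<in> G" using insert by (intro mult) auto
    moreover have "f i * (\<lambda>x. \<Prod>j\<in>B. f j x) = (\<lambda>x. \<Prod>j\<in>insert i B. f j x)"
      using insert.hyps by (simp add: fun_eq_iff)
    ultimately show ?case by simp
  qed (use one in \<open>simp_all add: one_fun_def\<close>)
  have "(\<lambda>x. \<Prod>i\<in>T. t i x) * (\<lambda>x. \<Prod>l\<in>A. a l x) \<in> G"
    by (intro mult prods) (use assms PP_Prod in auto)
  moreover have "pp_sign t a p = (\<lambda>x. \<Prod>i\<in>T. t i x) * (\<lambda>x. \<Prod>l\<in>A. a l x) \<or>
      pp_sign t a p = - ((\<lambda>x. \<Prod>i\<in>T. t i x) * (\<lambda>x. \<Prod>l\<in>A. a l x))"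
    using assms(1) by (auto simp: PP_Prod fun_eq_iff)
  ultimately show ?thesis using minus by metis
qed

lemma pp_value_eq: "pp_value X t a p = restrict (pp_sign t a p) X"
  by (cases p) (auto simp: fun_eq_iff)

text \<open>Stated over a sign group, so that it applies to the levels and to the limit alike.
  Restriction to \<open>X\<close> turns witnesses among the liftings into witnesses in
  \<open>G\<close> without changing any tested value.\<close>

lemma pp_holds_iff:
  assumes "sign_group X (liftings X G)" and ext: "\<forall>g\<in>G. restrict g X = g"
    and P: "pp_formula n k P" and a: "\<forall>l<k. a l \<in> G"
  shows "pp_holds X G n P a \<longleftrightarrow> satisfied (liftings X G) n (set P) a X"
    and "Y \<subseteq> X \<Longrightarrow> pp_holds_in_subspace X G Y n P a \<longleftrightarrow> satisfied (liftings X G) n (set P) a Y"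
proof -
  interpret sign_group X "liftings X G" by fact
  have lift: "g \<in> liftings X G" if "g \<in> G" for g using that ext by (simp add: liftings_def)
  have wf: "pp_prod_wf n k p" "pp_prod_wf n k q" if "(p, q) \<in> set P" for p q
    using P that by (auto simp: pp_formula_def)
  have mem: "pp_value X t a p \<in> G" if "pp_prod_wf n k p" "\<forall>i<n. t i \<in> G" for t p
    using pp_sign_mem[OF that(1), of t a] that(2) a lift by (simp add: liftings_def pp_value_eq)
  have atoms_X: "pp_value X t a p \<in> value_set X G \<one>\<^bsub>sign_functions X\<^esub> (pp_value X t a q) \<longleftrightarrow>
      (\<forall>x\<in>X. 1 = pp_sign t a p x \<or> pp_sign t a q x = pp_sign t a p x)"
    if "(p, q) \<in> set P" "\<forall>i<n. t i \<in> G" for t p q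
    using mem[OF wf(1)[OF that(1)] that(2)]
    by (auto simp: value_set_def pp_value_eq sign_functions_simps)
  have atoms_Y: "restrict (pp_value X t a p) Y
        \<in> value_set Y (restrict_group G Y) \<one>\<^bsub>sign_functions Y\<^esub> (restrict (pp_value X t a q) Y) \<longleftrightarrow>
      (\<forall>x\<in>Y. 1 = pp_sign t a p x \<or> pp_sign t a q x = pp_sign t a p x)"
    if "(p, q) \<in> set P" "\<forall>i<n. t i \<in> G" "Y \<subseteq> X" for t p q Y
  proof -
    have "restrict (pp_value X t a p) Y \<in> restrict_group G Y"
      using mem[OF wf(1)[OF that(1)] that(2)] by (simp add: restrict_group_def)
    moreover have "pp_value X t a r x = pp_sign t a r x" if "x \<in> Y" for r x
      using \<open>Y \<subseteq> X\<close> that by (auto simp: pp_value_eq)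
    ultimately show ?thesis by (auto simp: value_set_def sign_functions_simps)
  qed
  have sat: "satisfied (liftings X G) n (set P) a Y \<longleftrightarrow>
      (\<exists>t. (\<forall>i<n. t i \<in> G) \<and>
        (\<forall>(p, q)\<in>set P. \<forall>x\<in>Y. 1 = pp_sign t a p x \<or> pp_sign t a q x = pp_sign t a p x))"
    if Y: "Y \<subseteq> X" for Y
  proof
    assume "satisfied (liftings X G) n (set P) a Y"
    then obtain t where t: "\<forall>i<n. t i \<in> liftings X G"
        "\<forall>(p, q)\<in>set P. \<forall>x\<in>Y. 1 = pp_sign t a p x \<or> pp_sign t a q x = pp_sign t a p x"
      unfolding satisfied_def by blast
    define t' where "t' = (\<lambda>i. restrict (t i) X)"
    have eq: "pp_sign t' a p x = pp_sign t a p x" if "pp_prod_wf n k p" "x \<in> Y" for p x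
      by (rule pp_sign_cong[OF that(1)]) (use that(2) Y in \<open>auto simp: t'_def\<close>)
    have "\<forall>(p, q)\<in>set P. \<forall>x\<in>Y. 1 = pp_sign t' a p x \<or> pp_sign t' a q x = pp_sign t' a p x"
    proof (intro ballI, clarify)
      fix p q x assume pq: "(p, q) \<in> set P" and x: "x \<in> Y" and no: "pp_sign t' a q x \<noteq> pp_sign t' a p x"
      show "1 = pp_sign t' a p x"
        using bspec[OF t(2) pq] x no eq[OF wf(1)[OF pq] x] eq[OF wf(2)[OF pq] x] by auto
    qed
    moreover have "\<forall>i<n. t' i \<in> G" using t(1) by (simp add: t'_def liftings_def)
    ultimately show "\<exists>t. (\<forall>i<n. t i \<in> G) \<and>
        (\<forall>(p, q)\<in>set P. \<forall>x\<in>Y. 1 = pp_sign t a p x \<or> pp_sign t a q x = pp_sign t a p x)" by blast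
  next
    assume "\<exists>t. (\<forall>i<n. t i \<in> G) \<and>
        (\<forall>(p, q)\<in>set P. \<forall>x\<in>Y. 1 = pp_sign t a p x \<or> pp_sign t a q x = pp_sign t a p x)"
    thus "satisfied (liftings X G) n (set P) a Y" unfolding satisfied_def using lift by blast
  qed
  show "pp_holds X G n P a \<longleftrightarrow> satisfied (liftings X G) n (set P) a X"
    unfolding pp_holds_def sat[OF subset_refl]
    by (intro ex_cong1 conj_cong refl ball_cong) (auto simp: atoms_X)
  show "pp_holds_in_subspace X G Y n P a \<longleftrightarrow> satisfied (liftings X G) n (set P) a Y" if "Y \<subseteq> X"
    unfolding pp_holds_in_subspace_def sat[OF that]
    by (intro ex_cong1 conj_cong refl ball_cong) (auto simp: atoms_Y[OF _ _ that])
qed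

section \<open>Inverse limits\<close>

text \<open>A maximal proper refinement of \<open>F\<close> decides every predicate: if the negation
  of \<open>P\<close> is not eventual, adjoining \<open>P\<close> keeps the filter proper and so
  changes nothing.\<close>

lemma ultrafilter_below:
  fixes F :: "'a filter"
  assumes "F \<noteq> bot"
  shows "\<exists>U\<le>F. U \<noteq> bot \<and> (\<forall>P. eventually P U \<or> eventually (\<lambda>x. \<not> P x) U)"
proof -
  \<comment> \<open>Finer filters are smaller in the order of filters. Their sets of eventual
    predicates are larger, so Zorn's lemma for inclusion applies.\<close>
  define ev where "ev = (\<lambda>H :: 'a filter. {P. eventually P H})"
  have le_iff: "H \<le> K \<longleftrightarrow> ev K \<subseteq> ev H" for H K by (auto simp: le_filter_def ev_def)
  let ?A = "ev ` {H. H \<le> F \<and> H \<noteq> bot}"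
  have "\<exists>M\<in>?A. \<forall>S\<in>?A. M \<subseteq> S \<longrightarrow> S = M"
  proof (rule subset_Zorn_nonempty)
    show "?A \<noteq> {}" using assms by blast
    fix C assume C: "C \<noteq> {}" "subset.chain ?A C"
    define B where "B = {H. H \<le> F \<and> H \<noteq> bot \<and> ev H \<in> C}"
    have CB: "C = ev ` B" using C(2) unfolding subset.chain_def B_def by blast
    have B_ne: "B \<noteq> {}" using C(1) CB by blast
    have "\<exists>x\<in>B. x \<le> inf H K" if HK: "H \<in> B" "K \<in> B" for H K
    proof -
      have "ev H \<subseteq> ev K \<or> ev K \<subseteq> ev H"
        using HK C(2) unfolding CB subset.chain_def by blast
      hence "K \<le> H \<or> H \<le> K" using le_iff by blast
      hence "K \<le> inf H K \<or> H \<le> inf H K" by auto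
      thus ?thesis using HK by blast
    qed
    hence inf: "eventually P (Inf B) \<longleftrightarrow> (\<exists>H\<in>B. eventually P H)" for P
      using eventually_Inf_base[OF B_ne] by blast
    have "\<Union>C = ev (Inf B)" unfolding CB ev_def using inf by blast
    moreover have "Inf B \<noteq> bot" using inf[of "\<lambda>_. False"] by (auto simp: trivial_limit_def B_def)
    moreover have "Inf B \<le> F"
    proof -
      obtain H where "H \<in> B" using B_ne by blast
      thus ?thesis using Inf_lower[of H B] by (auto simp: B_def)
    qed
    ultimately show "\<Union>C \<in> ?A" by blast
  qed
  then obtain M where M: "M \<in> ?A" "\<forall>S\<in>?A. M \<subseteq> S \<longrightarrow> S = M" by (rule bexE)
  then obtain U where U: "U \<le> F" "U \<noteq> bot" and MU: "M = ev U" by auto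
  have max: "ev H = ev U" if "H \<le> F" "H \<noteq> bot" "ev U \<subseteq> ev H" for H
    using M(2) that unfolding MU by simp
  have "eventually P U \<or> eventually (\<lambda>x. \<not> P x) U" for P
  proof (rule disjCI)
    assume no: "\<not> eventually (\<lambda>x. \<not> P x) U"
    let ?H = "inf U (principal {x. P x})"
    have "?H \<noteq> bot" using no by (auto simp: trivial_limit_def eventually_inf_principal)
    moreover have "?H \<le> F" using U(1) by (rule order_trans[OF inf_le1])
    moreover have "ev U \<subseteq> ev ?H" using le_iff[of ?H U] by simp
    ultimately have "ev ?H = ev U" by (intro max)
    moreover have "P \<in> ev ?H" by (simp add: ev_def eventually_inf_principal)
    ultimately show "eventually P U" by (simp add: ev_def)
  qed
  thus ?thesis using U by blast
qed

text \<open>The ultralimit needs tuples of one length \<open>N\<close> at every level; a smaller set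
  is padded by repeating one of its points, hence the requirement that \<open>W\<close> is
  nonempty.\<close>

lemma enumerate_finite:
  fixes W :: "'b set" and N :: nat
  assumes "finite W" "W \<noteq> {}" "card W \<le> N"
  shows "\<exists>w :: nat \<Rightarrow> 'b. w ` {..<N} = W"
proof -
  obtain h where h: "bij_betw h {0..<card W} W" using ex_bij_betw_nat_finite[OF assms(1)] by blast
  have pos: "0 < card W" using assms(1,2) by (simp add: card_gt_0_iff)
  define w where "w = (\<lambda>m. if m < card W then h m else h 0)"
  have hW: "h m \<in> W" if "m < card W" for m using bij_betwE[OF h] that by simp
  have "w ` {..<N} = W"
  proof
    show "w ` {..<N} \<subseteq> W" using hW pos by (auto simp: w_def)
    show "W \<subseteq> w ` {..<N}"
    proof
      fix x assume "x \<in> W"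
      hence "x \<in> h ` {0..<card W}" using bij_betw_imp_surj_on[OF h] by simp
      then obtain m where "m < card W" "x = h m" by auto
      thus "x \<in> w ` {..<N}" using assms(3) by (intro image_eqI[of _ _ m]) (auto simp: w_def)
    qed
  qed
  show ?thesis by (rule exI[of _ w]) (fact \<open>w ` {..<N} = W\<close>)
qed

context inverse_system
begin

abbreviation "LX \<equiv> limit_points I ge X F"
abbreviation "LG \<equiv> limit_group I ge X G F"

section \<open>Points of the limit and elements of the direct limit\<close>

lemma LX_mem: "\<lbrakk>x \<in> LX; i \<in> I\<rbrakk> \<Longrightarrow> x i \<in> X i"
  by (auto simp: limit_points_def)

lemma LX_compatible: "\<lbrakk>x \<in> LX; i \<in> I; j \<in> I; ge i j\<rbrakk> \<Longrightarrow> F i j (x i) = x j"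
  by (auto simp: limit_points_def)

lemma LG_iff: "a \<in> LG \<longleftrightarrow> (\<exists>i\<in>I. \<exists>b\<in>G i. a = (\<lambda>x\<in>LX. b (x i)))"
  unfolding limit_group_def compose_def by blast

lemma F_mem: "\<lbrakk>i \<in> I; j \<in> I; ge i j; x \<in> X i\<rbrakk> \<Longrightarrow> F i j x \<in> X j"
  using F_surj by blast

lemma pullback_mem:
  assumes "i \<in> I" "j \<in> I" "ge i j" "b \<in> G j"
  shows "(\<lambda>x\<in>X i. b (F i j x)) \<in> G i"
  using F_morphism[OF assms(1-3)] assms(4) by (simp add: morphism_def compose_def)

lemma pullback_liftings:
  assumes ij: "i \<in> I" "j \<in> I" "ge i j" and b: "b \<in> liftings (X j) (G j)"
  shows "(\<lambda>x. b (F i j x)) \<in> liftings (X i) (G i)"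
proof -
  have "restrict b (X j) \<in> G j" using b by (simp add: liftings_def)
  from pullback_mem[OF ij this] have "(\<lambda>x\<in>X i. restrict b (X j) (F i j x)) \<in> G i" .
  moreover have "(\<lambda>x\<in>X i. restrict b (X j) (F i j x)) = (\<lambda>x\<in>X i. b (F i j x))"
    by (rule restrict_ext) (simp add: F_mem[OF ij])
  ultimately show ?thesis by (simp add: liftings_def)
qed

lemma limit_pullback:
  assumes "i \<in> I" "j \<in> I" "ge i j"
  shows "(\<lambda>x\<in>LX. b (x j)) = (\<lambda>x\<in>LX. (\<lambda>y\<in>X i. b (F i j y)) (x i))"
  by (rule restrict_ext) (simp add: LX_mem assms LX_compatible)

lemma sign_space_level: "i \<in> I \<Longrightarrow> sign_space (X i) (liftings (X i) (G i))"
  using space_of_orderings.sign_space_liftings[OF spaces] .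

text \<open>By directedness, finitely many elements of the direct limit come from one level, which
  may be taken above a given \<open>j\<close>. It is used for products, for the parameters and for
  the witnesses of a formula.\<close>

lemma common_level:
  fixes k :: nat
  assumes "j \<in> I" "\<forall>l<k. a l \<in> LG"
  shows "\<exists>i\<in>I. ge i j \<and> (\<exists>b. \<forall>l<k. b l \<in> G i \<and> a l = (\<lambda>x\<in>LX. b l (x i)))"
  using assms(2)
proof (induction k)
  case 0
  thus ?case using assms(1) ge_refl by blast
next
  case (Suc k)
  then obtain i b where i: "i \<in> I" "ge i j" and b: "\<And>l. l < k \<Longrightarrow> b l \<in> G i \<and> a l = (\<lambda>x\<in>LX. b l (x i))"
    by (meson less_Suc_eq)
  obtain i' c where i': "i' \<in> I" and c: "c \<in> G i'" "a k = (\<lambda>x\<in>LX. c (x i'))"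
    using Suc.prems LG_iff by blast
  obtain m where m: "m \<in> I" "ge m i" "ge m i'" using directed i(1) i' by blast
  define d where "d = (\<lambda>l. if l < k then (\<lambda>x\<in>X m. b l (F m i x)) else (\<lambda>x\<in>X m. c (F m i' x)))"
  have "d l \<in> G m \<and> a l = (\<lambda>x\<in>LX. d l (x m))" if "l < Suc k" for l
  proof (cases "l < k")
    case True
    thus ?thesis
      using pullback_mem[OF m(1) i(1) m(2)] b[OF True] limit_pullback[OF m(1) i(1) m(2), of "b l"]
      by (simp add: d_def)
  next
    case False
    hence "l = k" using that by simp
    thus ?thesis
      using pullback_mem[OF m(1) i' m(3) c(1)] c(2) limit_pullback[OF m(1) i' m(3), of c]
      by (simp add: d_def)
  qed
  moreover have "ge m j" using ge_trans m i assms(1) by blast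
  ultimately show ?case using m(1) by blast
qed

lemma LG_restrict: "g \<in> LG \<Longrightarrow> restrict g LX = g"
  using LG_iff by auto

lemma LG_mem: "\<lbrakk>i \<in> I; b \<in> G i\<rbrakk> \<Longrightarrow> (\<lambda>x\<in>LX. b (x i)) \<in> LG"
  using LG_iff by blast

lemma sign_group_limit: "sign_group LX (liftings LX LG)"
proof
  fix a x assume "a \<in> liftings LX LG" and x: "x \<in> LX"
  then obtain i b where i: "i \<in> I" "b \<in> G i" "restrict a LX = (\<lambda>x\<in>LX. b (x i))"
    unfolding liftings_def using LG_iff by blast
  interpret S: space_of_orderings "X i" "G i" by (rule spaces[OF i(1)])
  interpret L: sign_group "X i" "liftings (X i) (G i)" by (rule S.sign_group_liftings)
  have "a x = b (x i)" using fun_cong[OF i(3), of x] x by simp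
  thus "a x = 1 \<or> a x = - 1" using L.sign[OF S.mem_liftings[OF i(2)] LX_mem[OF x i(1)]] by simp
next
  obtain i where i: "i \<in> I" using index_nonempty by blast
  interpret S: space_of_orderings "X i" "G i" by (rule spaces[OF i])
  have "(\<lambda>x\<in>LX. (\<lambda>y\<in>X i. 1) (x i)) \<in> LG" by (rule LG_mem[OF i S.subgroup_closed(2)])
  moreover have "(\<lambda>x\<in>LX. (\<lambda>y\<in>X i. 1 :: int) (x i)) = restrict 1 LX"
    by (rule restrict_ext) (simp add: LX_mem i)
  ultimately show "1 \<in> liftings LX LG" by (simp add: liftings_def)
next
  fix a b assume ab: "a \<in> liftings LX LG" "b \<in> liftings LX LG"
  obtain j where j: "j \<in> I" using index_nonempty by blast
  let ?f = "\<lambda>l :: nat. if l = 0 then restrict a LX else restrict b LX"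
  have "\<forall>l<2. ?f l \<in> LG" using ab by (simp add: liftings_def)
  from common_level[OF j this] obtain i c where i: "i \<in> I"
    and c: "\<forall>l<2. c l \<in> G i \<and> ?f l = (\<lambda>x\<in>LX. c l (x i))" by blast
  interpret S: space_of_orderings "X i" "G i" by (rule spaces[OF i])
  have c01: "c 0 \<in> G i" "c 1 \<in> G i" "restrict a LX = (\<lambda>x\<in>LX. c 0 (x i))" "restrict b LX = (\<lambda>x\<in>LX. c 1 (x i))"
    using c[rule_format, of 0] c[rule_format, of 1] by simp_all
  have "(\<lambda>x\<in>LX. (\<lambda>y\<in>X i. c 0 y * c 1 y) (x i)) \<in> LG"
    by (rule LG_mem[OF i S.subgroup_closed(1)[OF c01(1,2)]])
  moreover have "(\<lambda>x\<in>LX. (\<lambda>y\<in>X i. c 0 y * c 1 y) (x i)) = restrict (a * b) LX"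
  proof (rule restrict_ext)
    fix x assume x: "x \<in> LX"
    show "(\<lambda>y\<in>X i. c 0 y * c 1 y) (x i) = (a * b) x"
      using fun_cong[OF c01(3), of x] fun_cong[OF c01(4), of x] x LX_mem[OF x i] by simp
  qed
  ultimately show "a * b \<in> liftings LX LG" by (simp add: liftings_def)
next
  fix a assume "a \<in> liftings LX LG"
  then obtain i b where i: "i \<in> I" "b \<in> G i" "restrict a LX = (\<lambda>x\<in>LX. b (x i))"
    unfolding liftings_def using LG_iff by blast
  interpret S: space_of_orderings "X i" "G i" by (rule spaces[OF i(1)])
  interpret L: sign_group "X i" "liftings (X i) (G i)" by (rule S.sign_group_liftings)
  have "restrict (- b) (X i) \<in> G i" using L.minus[OF S.mem_liftings[OF i(2)]] by (simp add: liftings_def)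
  from LG_mem[OF i(1) this] have "(\<lambda>x\<in>LX. restrict (- b) (X i) (x i)) \<in> LG" .
  moreover have "(\<lambda>x\<in>LX. restrict (- b) (X i) (x i)) = restrict (- a) LX"
  proof (rule restrict_ext)
    fix x assume x: "x \<in> LX"
    show "restrict (- b) (X i) (x i) = (- a) x"
      using fun_cong[OF i(3), of x] x LX_mem[OF x i(1)] by simp
  qed
  ultimately show "- a \<in> liftings LX LG" by (simp add: liftings_def)
qed

lemma limit_separates:
  assumes "x \<in> LX" "y \<in> LX" "x \<noteq> y"
  shows "\<exists>g\<in>LG. g x \<noteq> g y"
proof -
  have "\<exists>i\<in>I. x i \<noteq> y i"
  proof (rule ccontr)
    assume "\<not> ?thesis"
    hence "x = y" using assms(1,2) by (intro PiE_ext[of x I X y]) (auto simp: limit_points_def)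
    thus False using assms(3) by simp
  qed
  then obtain i where i: "i \<in> I" "x i \<noteq> y i" by blast
  obtain g where g: "g \<in> G i" "g (x i) \<noteq> g (y i)"
    using space_of_orderings.separates[OF spaces[OF i(1)]] LX_mem assms i by blast
  have "(\<lambda>x\<in>LX. g (x i)) x \<noteq> (\<lambda>x\<in>LX. g (x i)) y" using assms g(2) by simp
  thus ?thesis using LG_mem[OF i(1) g(1)] by blast
qed

text \<open>
  A point of the closure is determined by the sign patterns on \<open>W\<close> at which it is negative.
\<close>

lemma finite_closure:
  assumes W: "finite W" "W \<subseteq> LX" "W \<noteq> {}"
  obtains Y where "ordering_subspace LX LG Y" "finite Y" "W \<subseteq> Y"
proof -
  interpret sign_group LX "liftings LX LG" by (rule sign_group_limit)
  define S where "S = {g\<in>LG. \<forall>w\<in>W. g w = 1}"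
  define Y where "Y = LX \<inter> (\<Inter>a\<in>S. positive_set LX a)"
  have LG_lift: "g \<in> liftings LX LG" if "g \<in> LG" for g
    using that LG_restrict by (simp add: liftings_def)
  have WY: "W \<subseteq> Y" using W(2) by (auto simp: Y_def S_def positive_set_def)
  moreover have "ordering_subspace LX LG Y"
    unfolding ordering_subspace_def
  proof (intro conjI exI[of _ S])
    show "Y \<noteq> {}" using WY W(3) by blast
    show "S \<subseteq> LG" by (auto simp: S_def)
    show "Y = LX \<inter> (\<Inter>a\<in>S. positive_set LX a)" by (rule Y_def)
  qed
  moreover have "finite Y"
  proof -
    define N where "N = (\<lambda>g. {w\<in>W. g w = (- 1 :: int)})"
    define pattern where "pattern = (\<lambda>x. {N g | g. g \<in> LG \<and> g x = - 1})"
    have "inj_on pattern Y"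
    proof (rule inj_onI)
      fix x y assume x: "x \<in> Y" and y: "y \<in> Y" and eq: "pattern x = pattern y"
      have xy: "x \<in> LX" "y \<in> LX" using x y by (auto simp: Y_def)
      \<comment> \<open>An \<open>h\<close> with the same trace on \<open>W\<close> as
        \<open>g\<close> and \<open>h v = - 1\<close> makes \<open>g * h\<close> equal to 1 on
        \<open>W\<close>, hence at every point of the closure, in particular at
        \<open>v\<close>.\<close>
      have neg: "g v = - 1" if uv: "u \<in> Y" "v \<in> Y" "pattern u = pattern v" "g \<in> LG" "g u = - 1" for u v g
      proof -
        have "N g \<in> pattern u" using uv(4,5) by (auto simp: pattern_def)
        hence "N g \<in> pattern v" by (simp add: uv(3))
        then obtain h where h: "h \<in> LG" "h v = - 1" "N g = N h"
          unfolding pattern_def by blast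
        have signs: "g w = 1 \<or> g w = - 1" "h w = 1 \<or> h w = - 1" if "w \<in> LX" for w
          using sign LG_lift uv(4) h(1) that by blast+
        have "restrict (g * h) LX \<in> LG"
          using mult[OF LG_lift[OF uv(4)] LG_lift[OF h(1)]] by (simp add: liftings_def)
        moreover have "\<forall>w\<in>W. restrict (g * h) LX w = 1"
        proof
          fix w assume w: "w \<in> W"
          have "w \<in> N g \<longleftrightarrow> w \<in> N h" by (simp add: h(3))
          hence "g w = - 1 \<longleftrightarrow> h w = - 1" using w by (simp add: N_def)
          thus "restrict (g * h) LX w = 1" using signs[of w] w W(2) by auto
        qed
        ultimately have "restrict (g * h) LX \<in> S" by (simp add: S_def)
        hence "restrict (g * h) LX v = 1" using uv(2) by (auto simp: Y_def positive_set_def)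
        moreover have "v \<in> LX" using uv(2) by (simp add: Y_def)
        ultimately show ?thesis using h(2) by simp
      qed
      show "x = y"
      proof (rule ccontr)
        assume "x \<noteq> y"
        then obtain g where g: "g \<in> LG" "g x \<noteq> g y" using limit_separates xy by blast
        have "g x = 1 \<or> g x = - 1" "g y = 1 \<or> g y = - 1"
          using sign[OF LG_lift[OF g(1)]] xy by blast+
        thus False using g neg[OF x y eq g(1)] neg[OF y x eq[symmetric] g(1)] by auto
      qed
    qed
    moreover have "pattern ` Y \<subseteq> Pow (Pow W)" by (auto simp: pattern_def N_def)
    ultimately show ?thesis
      using W(1) by (meson finite_Pow_iff finite_subset finite_image_iff)
  qed
  ultimately show thesis using that by blast
qed

section \<open>Ultralimits of points along the index set\<close>

lemma tail_ultrafilter: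
  obtains U where "U \<noteq> bot" "\<And>P. eventually P U \<or> eventually (\<lambda>i. \<not> P i) U"
    "\<And>j. j \<in> I \<Longrightarrow> eventually (\<lambda>i. i \<in> I \<and> ge i j) U"
proof -
  let ?T = "\<lambda>j. principal {i\<in>I. ge i j}"
  have base: "\<exists>m\<in>I. ?T m \<le> inf (?T i) (?T j)" if ij: "i \<in> I" "j \<in> I" for i j
  proof -
    obtain m where m: "m \<in> I" "ge m i" "ge m j" using directed ij by blast
    have "{l\<in>I. ge l m} \<subseteq> {l\<in>I. ge l i} \<inter> {l\<in>I. ge l j}" using ge_trans m ij by blast
    thus ?thesis using m(1) by auto
  qed
  have ev: "eventually P (INF j\<in>I. ?T j) \<longleftrightarrow> (\<exists>j\<in>I. eventually P (?T j))" for P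
    by (rule eventually_INF_base[OF index_nonempty base])
  have "(INF j\<in>I. ?T j) \<noteq> bot"
    unfolding trivial_limit_def ev using ge_refl by (auto simp: eventually_principal)
  from ultrafilter_below[OF this] obtain U where U: "U \<le> (INF j\<in>I. ?T j)" "U \<noteq> bot"
    "\<forall>P. eventually P U \<or> eventually (\<lambda>x. \<not> P x) U" by blast
  have "eventually (\<lambda>i. i \<in> I \<and> ge i j) U" if "j \<in> I" for j
  proof (rule filter_leD[OF U(1)])
    show "eventually (\<lambda>i. i \<in> I \<and> ge i j) (INF j\<in>I. ?T j)"
      unfolding ev using that by (auto simp: eventually_principal)
  qed
  thus thesis using that[OF U(2)] U(3) by blast
qed

text \<open>At level \<open>j\<close> the limits of the signs \<open>g (F i j (w i))\<close> along
  the ultrafilter form a character. The condition of (AX2) survives the limit, so this character is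
  a point of \<open>X j\<close>. This takes the place of compactness of \<open>X j\<close>.\<close>

lemma ultralimit_point:
  assumes U: "U \<noteq> bot" "\<And>P. eventually P U \<or> eventually (\<lambda>i. \<not> P i) U"
      "\<And>j. j \<in> I \<Longrightarrow> eventually (\<lambda>i. i \<in> I \<and> ge i j) U"
    and w: "eventually (\<lambda>i. w i \<in> X i) U"
  obtains x where "x \<in> LX"
    "\<And>j g. \<lbrakk>j \<in> I; g \<in> liftings (X j) (G j)\<rbrakk> \<Longrightarrow> eventually (\<lambda>i. g (F i j (w i)) = g (x j)) U"
proof -
  have good: "eventually (\<lambda>i. i \<in> I \<and> ge i j \<and> w i \<in> X i) U" if "j \<in> I" for j
    using eventually_conj[OF U(3)[OF that] w] by (simp add: conj_assoc)
  have "\<exists>x\<in>X j. \<forall>g\<in>liftings (X j) (G j). eventually (\<lambda>i. g (F i j (w i)) = g x) U" if j: "j \<in> I" for j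
  proof -
    interpret sign_space "X j" "liftings (X j) (G j)" by (rule sign_space_level[OF j])
    define \<chi> :: "('a \<Rightarrow> int) \<Rightarrow> int"
      where "\<chi> = (\<lambda>g. if eventually (\<lambda>i. g (F i j (w i)) = 1) U then 1 else - 1)"
    have \<chi>: "eventually (\<lambda>i. g (F i j (w i)) = \<chi> g) U" if g: "g \<in> liftings (X j) (G j)" for g
    proof (cases "eventually (\<lambda>i. g (F i j (w i)) = 1) U")
      case True
      thus ?thesis by (simp add: \<chi>_def)
    next
      case False
      hence "eventually (\<lambda>i. g (F i j (w i)) \<noteq> 1) U" using U(2) by blast
      hence "eventually (\<lambda>i. g (F i j (w i)) = - 1) U"
        using good[OF j]
      proof eventually_elim
        case (elim i)
        hence "F i j (w i) \<in> X j" using F_mem j by blast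
        thus ?case using elim(1) sign[OF g] by blast
      qed
      thus ?thesis using False by (simp add: \<chi>_def)
    qed
    have const: "r = s" if "eventually (\<lambda>i. f i = r) U" "eventually (\<lambda>i. f i = s) U" for f and r s :: int
    proof -
      have "eventually (\<lambda>i. r = s) U" using that by eventually_elim simp
      thus ?thesis using U(1) by simp
    qed
    have "\<exists>x\<in>X j. \<forall>g\<in>liftings (X j) (G j). \<chi> g = g x"
    proof (rule character_point)
      show "\<chi> a = 1 \<or> \<chi> a = - 1" for a by (simp add: \<chi>_def)
      show "\<chi> (- 1) = - 1" by (simp add: \<chi>_def U(1))
    next
      fix a b assume ab: "a \<in> liftings (X j) (G j)" "b \<in> liftings (X j) (G j)"
      have "eventually (\<lambda>i. (a * b) (F i j (w i)) = \<chi> a * \<chi> b) U"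
        using \<chi>[OF ab(1)] \<chi>[OF ab(2)] by eventually_elim simp
      thus "\<chi> (a * b) = \<chi> a * \<chi> b" using const[OF \<chi>[OF mult[OF ab]]] by blast
    next
      fix a c assume ac: "a \<in> liftings (X j) (G j)" "c \<in> liftings (X j) (G j)" "\<chi> a = 1"
        "\<forall>x\<in>X j. a x = 1 \<longrightarrow> c x = 1"
      have "eventually (\<lambda>i. c (F i j (w i)) = 1) U"
        using \<chi>[OF ac(1)] good[OF j]
      proof eventually_elim
        case (elim i)
        hence "F i j (w i) \<in> X j" using F_mem j by blast
        thus ?case using elim(1) ac(3,4) by simp
      qed
      thus "\<chi> c = 1" by (simp add: \<chi>_def)
    qed
    then obtain x where "x \<in> X j" "\<forall>g\<in>liftings (X j) (G j). \<chi> g = g x" by blast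
    thus ?thesis using \<chi> by (intro bexI[of _ x]) auto
  qed
  hence "\<forall>j\<in>I. \<exists>x. x \<in> X j \<and> (\<forall>g\<in>liftings (X j) (G j). eventually (\<lambda>i. g (F i j (w i)) = g x) U)"
    by blast
  from bchoice[OF this] obtain p where p: "\<forall>j\<in>I. p j \<in> X j \<and>
      (\<forall>g\<in>liftings (X j) (G j). eventually (\<lambda>i. g (F i j (w i)) = g (p j)) U)" ..
  define x where "x = (\<lambda>j\<in>I. p j)"
  have px: "p j \<in> X j" "x j = p j" if "j \<in> I" for j using p that by (simp_all add: x_def)
  have pe: "eventually (\<lambda>i. g (F i j (w i)) = g (p j)) U" if "j \<in> I" "g \<in> liftings (X j) (G j)" for j g
    using p that by blast
  \<comment> \<open>Elements of level \<open>k\<close> separate points, and the limit of such a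
    \<open>g\<close> can also be computed at level \<open>j\<close> from its pullback.\<close>
  have "F j k (p j) = p k" if jk: "j \<in> I" "k \<in> I" "ge j k" for j k
  proof (rule ccontr)
    assume "F j k (p j) \<noteq> p k"
    then obtain g where g: "g \<in> liftings (X k) (G k)" "g (F j k (p j)) \<noteq> g (p k)"
      using sign_space.separates[OF sign_space_level[OF jk(2)] F_mem[OF jk px(1)[OF jk(1)]] px(1)[OF jk(2)]]
      by blast
    have "eventually (\<lambda>i. g (F j k (p j)) = g (p k)) U"
      using pe[OF jk(1) pullback_liftings[OF jk g(1)]] pe[OF jk(2) g(1)] good[OF jk(1)]
    proof eventually_elim
      case (elim i)
      hence "F i k (w i) = F j k (F i j (w i))"
        using F_comp[of i j k "w i"] jk by blast
      thus ?case using elim(1,2) by simp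
    qed
    thus False using g(2) U(1) by simp
  qed
  hence "x \<in> LX" using px by (auto simp: limit_points_def x_def)
  moreover have "eventually (\<lambda>i. g (F i j (w i)) = g (x j)) U" if "j \<in> I" "g \<in> liftings (X j) (G j)" for j g
    using pe[OF that] px(2)[OF that(1)] by simp
  ultimately show thesis using that by blast
qed

end

theorem theorem2:
  fixes I :: "'i set" and ge :: "'i \<Rightarrow> 'i \<Rightarrow> bool"
    and X :: "'i \<Rightarrow> 'a set" and G :: "'i \<Rightarrow> ('a \<Rightarrow> int) set"
    and F :: "'i \<Rightarrow> 'i \<Rightarrow> 'a \<Rightarrow> 'a"
  assumes "inverse_system I ge X G F"
    and "\<And>i. i \<in> I \<Longrightarrow> pp_conjecture (X i) (G i)"
  shows "pp_conjecture (limit_points I ge X F) (limit_group I ge X G F)"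
proof -
  interpret inverse_system I ge X G F by fact
  interpret L: sign_group LX "liftings LX LG" by (rule sign_group_limit)
  show ?thesis
    unfolding pp_conjecture_def
  proof (intro allI impI)
    fix n k P a
    assume P: "pp_formula n k P" and a: "\<forall>l<k. a l \<in> LG"
      and finite_sub: "\<forall>Y. ordering_subspace LX LG Y \<and> finite Y \<longrightarrow> pp_holds_in_subspace LX LG Y n P a"
    have "\<forall>g\<in>LG. restrict g LX = g" using LG_restrict by blast
    note limit_iff = pp_holds_iff[OF sign_group_limit this P a]
    have wf: "pp_prod_wf n k p" "pp_prod_wf n k q" if "(p, q) \<in> set P" for p q
      using P that by (auto simp: pp_formula_def)
    obtain i0 where i0: "i0 \<in> I" using index_nonempty by blast
    from common_level[OF i0 a] obtain j b where j: "j \<in> I"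
      and b: "\<forall>l<k. b l \<in> G j \<and> a l = (\<lambda>x\<in>LX. b l (x j))" by blast
    have bL: "b l \<in> liftings (X j) (G j)" if "l < k" for l
      using b that space_of_orderings.mem_liftings[OF spaces[OF j]] by blast
    have av: "a l x = b l (x j)" if "l < k" "x \<in> LX" for l x using b that by auto
    define c where "c = (\<lambda>i l. \<lambda>x\<in>X i. b l (F i j x))"
    have cG: "\<forall>l<k. c i l \<in> G i" if "i \<in> I" "ge i j" for i
      using pullback_mem[OF that(1) j that(2)] b by (simp add: c_def)
    \<comment> \<open>At every level the failing formulas are subsets of
      \<open>pp_atoms n k\<close>, so this bounds the size of a small failing set independently of
      the level.\<close>
    define N where "N = (2 :: nat) ^ card (Pow (pp_atoms n k))"
    show "pp_holds LX LG n P a"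
    proof (rule ccontr)
      assume "\<not> pp_holds LX LG n P a"
      hence no: "\<not> satisfied (liftings LX LG) n (set P) a LX" by (simp add: limit_iff(1))
      have "\<exists>w. i \<in> I \<and> ge i j \<longrightarrow> w ` {..<N} \<subseteq> X i \<and>
          \<not> satisfied (liftings (X i) (G i)) n (set P) (c i) (w ` {..<N})" for i
      proof (cases "i \<in> I \<and> ge i j")
        case True
        hence i: "i \<in> I" "ge i j" by simp_all
        interpret S: space_of_orderings "X i" "G i" by (rule spaces[OF i(1)])
        interpret SL: sign_space "X i" "liftings (X i) (G i)" by (rule sign_space_level[OF i(1)])
        have "\<forall>g\<in>G i. restrict g (X i) = g" using S.restrict_mem by blast
        note level_iff = pp_holds_iff[OF S.sign_group_liftings this P cG[OF i]]
        \<comment> \<open>A solution at level \<open>i\<close> composed with the projection would be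
          a solution in the limit.\<close>
        have "\<not> satisfied (liftings (X i) (G i)) n (set P) (c i) (X i)"
        proof
          assume "satisfied (liftings (X i) (G i)) n (set P) (c i) (X i)"
          then obtain t where t: "\<forall>m<n. t m \<in> liftings (X i) (G i)"
              "\<forall>(p, q)\<in>set P. \<forall>x\<in>X i. 1 = pp_sign t (c i) p x \<or> pp_sign t (c i) q x = pp_sign t (c i) p x"
            unfolding satisfied_def by blast
          define u where "u = (\<lambda>m. \<lambda>x\<in>LX. t m (x i))"
          have "u m \<in> liftings LX LG" if "m < n" for m
          proof -
            have "restrict (t m) (X i) \<in> G i" using t(1) that by (simp add: liftings_def)
            from LG_mem[OF i(1) this] have "(\<lambda>x\<in>LX. restrict (t m) (X i) (x i)) \<in> LG" .
            moreover have "(\<lambda>x\<in>LX. restrict (t m) (X i) (x i)) = restrict (u m) LX"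
              by (rule restrict_ext) (simp add: u_def LX_mem i)
            ultimately show ?thesis by (simp add: liftings_def)
          qed
          moreover have "1 = pp_sign u a p x \<or> pp_sign u a q x = pp_sign u a p x"
            if pq: "(p, q) \<in> set P" and x: "x \<in> LX" for p q x
          proof -
            have "pp_sign u a r x = pp_sign t (c i) r (x i)" if "pp_prod_wf n k r" for r
              by (rule pp_sign_cong[OF that])
                (use x i j in \<open>simp_all add: u_def c_def av LX_mem LX_compatible\<close>)
            thus ?thesis using bspec[OF t(2) pq] wf[OF pq] LX_mem[OF x i(1)] by simp
          qed
          ultimately have "satisfied (liftings LX LG) n (set P) a LX"
            unfolding satisfied_def by blast
          thus False using no by simp
        qed
        hence "\<not> pp_holds (X i) (G i) n P (c i)" by (simp add: level_iff(1))
        then obtain Y where Y: "ordering_subspace (X i) (G i) Y" "finite Y"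
            "\<not> pp_holds_in_subspace (X i) (G i) Y n P (c i)"
          using assms(2)[OF i(1)] P cG[OF i] unfolding pp_conjecture_def by blast
        have Y_flat: "flat (X i) (liftings (X i) (G i)) Y" by (rule S.flat_liftings[OF Y(1)])
        have YX: "Y \<subseteq> X i" by (rule flat_subset[OF Y_flat])
        have Y_ne: "Y \<noteq> {}" using Y(1) by (simp add: ordering_subspace_def)
        let ?E = "failing (liftings (X i) (G i)) n k (c i)"
        have "set P \<in> ?E Y"
          using Y(3) level_iff(2)[OF YX] wf by (auto simp: failing_def pp_atoms_def)
        moreover have "\<forall>l<k. c i l \<in> liftings (X i) (G i)" using cG[OF i] S.mem_liftings by blast
        from small_failing_set[OF SL.sign_space_flat[OF Y_flat Y_ne] Y(2) this]
        obtain W where W: "W \<subseteq> Y" "card W \<le> 2 ^ card (?E Y)" "?E Y \<subseteq> ?E W" by blast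
        ultimately have W_no: "\<not> satisfied (liftings (X i) (G i)) n (set P) (c i) W"
          by (auto simp: failing_def)
        have "card (?E Y) \<le> card (Pow (pp_atoms n k))"
          by (rule card_mono[OF _ failing_subset]) (simp add: finite_pp_atoms)
        hence "(2 :: nat) ^ card (?E Y) \<le> N" unfolding N_def by (intro power_increasing) auto
        hence "card W \<le> N" using W(2) by simp
        moreover have "finite W" using W(1) Y(2) by (rule finite_subset)
        moreover have "W \<noteq> {}"
        proof
          assume "W = {}"
          hence "satisfied (liftings (X i) (G i)) n (set P) (c i) W"
            unfolding satisfied_def using SL.one by (intro exI[of _ "\<lambda>_. 1"]) auto
          thus False using W_no by simp
        qed
        ultimately obtain w where "w ` {..<N} = W" using enumerate_finite by blast
        thus ?thesis using W_no W(1) YX by (intro exI[of _ w]) auto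
      next
        case False
        thus ?thesis by blast
      qed
      hence "\<forall>i. \<exists>w. i \<in> I \<and> ge i j \<longrightarrow> w ` {..<N} \<subseteq> X i \<and>
          \<not> satisfied (liftings (X i) (G i)) n (set P) (c i) (w ` {..<N})" ..
      from choice[OF this] obtain w where w: "\<forall>i. i \<in> I \<and> ge i j \<longrightarrow> w i ` {..<N} \<subseteq> X i \<and>
          \<not> satisfied (liftings (X i) (G i)) n (set P) (c i) (w i ` {..<N})" ..
      obtain U where U: "U \<noteq> bot" "\<And>P. eventually P U \<or> eventually (\<lambda>i. \<not> P i) U"
          "\<And>j. j \<in> I \<Longrightarrow> eventually (\<lambda>i. i \<in> I \<and> ge i j) U"
        using tail_ultrafilter by blast
      have "\<exists>x. x \<in> LX \<and> (\<forall>j\<in>I. \<forall>g\<in>liftings (X j) (G j). eventually (\<lambda>i. g (F i j (w i m)) = g (x j)) U)"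
        if m: "m < N" for m
      proof -
        have "eventually (\<lambda>i. w i m \<in> X i) U" using U(3)[OF j]
        proof eventually_elim
          case (elim i)
          thus ?case using w m by blast
        qed
        from ultralimit_point[OF U this] show ?thesis by metis
      qed
      hence "\<forall>m\<in>{..<N}. \<exists>x. x \<in> LX \<and>
          (\<forall>j\<in>I. \<forall>g\<in>liftings (X j) (G j). eventually (\<lambda>i. g (F i j (w i m)) = g (x j)) U)" by blast
      from bchoice[OF this] obtain y where y': "\<forall>m\<in>{..<N}. y m \<in> LX \<and>
          (\<forall>j\<in>I. \<forall>g\<in>liftings (X j) (G j). eventually (\<lambda>i. g (F i j (w i m)) = g (y m j)) U)" ..
      have y: "y m \<in> LX" if "m < N" for m using y' that by simp
      have ye: "eventually (\<lambda>i. g (F i j (w i m)) = g (y m j)) U"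
        if "m < N" "j \<in> I" "g \<in> liftings (X j) (G j)" for m j g
        using y' that by simp
      let ?W = "y ` {..<N}"
      have "N > 0" by (simp add: N_def)
      hence "?W \<noteq> {}" by auto
      moreover have "?W \<subseteq> LX" using y by auto
      moreover have "finite ?W" by simp
      ultimately obtain Y where Y: "ordering_subspace LX LG Y" "finite Y" "?W \<subseteq> Y"
        using finite_closure by metis
      have "Y \<subseteq> LX" using Y(1) by (auto simp: ordering_subspace_def)
      hence "satisfied (liftings LX LG) n (set P) a Y" using finite_sub Y limit_iff(2) by blast
      hence "satisfied (liftings LX LG) n (set P) a ?W" using satisfied_mono Y(3) by blast
      then obtain t where t: "\<forall>m<n. t m \<in> liftings LX LG"
          "\<forall>(p, q)\<in>set P. \<forall>x\<in>?W. 1 = pp_sign t a p x \<or> pp_sign t a q x = pp_sign t a p x"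
        unfolding satisfied_def by blast
      have "\<forall>m<n. restrict (t m) LX \<in> LG" using t(1) by (simp add: liftings_def)
      \<comment> \<open>The witnesses, like the parameters, come from a single level.\<close>
      from common_level[OF j this] obtain i1 e where i1: "i1 \<in> I" "ge i1 j"
        and e: "\<forall>m<n. e m \<in> G i1 \<and> restrict (t m) LX = (\<lambda>x\<in>LX. e m (x i1))" by blast
      have eL: "e m \<in> liftings (X i1) (G i1)" if "m < n" for m
        using e that space_of_orderings.mem_liftings[OF spaces[OF i1(1)]] by blast
      have tv: "t m x = e m (x i1)" if "m < n" "x \<in> LX" for m x
      proof -
        have "restrict (t m) LX x = (\<lambda>x\<in>LX. e m (x i1)) x" using e that(1) by simp
        thus ?thesis using that(2) by simp
      qed
      \<comment> \<open>Only finitely many signs are compared, so at some level \<open>i\<close> the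
        tuple \<open>w i\<close> shows the same signs as its ultralimit for all witnesses and
        parameters. The pulled-back witnesses then satisfy the formula on a tuple on which it
        fails.\<close>
      have "eventually (\<lambda>i. \<forall>m\<in>{..<N}. \<forall>l\<in>{..<n}. e l (F i i1 (w i m)) = e l (y m i1)) U"
        using ye i1(1) eL by (intro eventually_ball_finite finite_lessThan ballI) simp
      moreover have "eventually (\<lambda>i. \<forall>m\<in>{..<N}. \<forall>l\<in>{..<k}. b l (F i j (w i m)) = b l (y m j)) U"
        using ye j bL by (intro eventually_ball_finite finite_lessThan ballI) simp
      ultimately have "eventually (\<lambda>i. (i \<in> I \<and> ge i i1) \<and> (i \<in> I \<and> ge i j) \<and>
          (\<forall>m\<in>{..<N}. \<forall>l\<in>{..<n}. e l (F i i1 (w i m)) = e l (y m i1)) \<and>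
          (\<forall>m\<in>{..<N}. \<forall>l\<in>{..<k}. b l (F i j (w i m)) = b l (y m j))) U"
        using U(3)[OF i1(1)] U(3)[OF j] by eventually_elim simp
      from eventually_happens[OF this] U(1) obtain i where i: "i \<in> I" "ge i i1" "ge i j"
        and ev: "\<And>m l. \<lbrakk>m < N; l < n\<rbrakk> \<Longrightarrow> e l (F i i1 (w i m)) = e l (y m i1)"
        and bv: "\<And>m l. \<lbrakk>m < N; l < k\<rbrakk> \<Longrightarrow> b l (F i j (w i m)) = b l (y m j)"
        by auto
      define u where "u = (\<lambda>l x. e l (F i i1 x))"
      have wX: "w i m \<in> X i" if "m < N" for m using w i that by blast
      have "\<forall>l<n. u l \<in> liftings (X i) (G i)"
        unfolding u_def using pullback_liftings[OF i(1) i1(1) i(2)] eL by blast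
      moreover have "1 = pp_sign u (c i) p x \<or> pp_sign u (c i) q x = pp_sign u (c i) p x"
        if pq: "(p, q) \<in> set P" and x: "x \<in> w i ` {..<N}" for p q x
      proof -
        obtain m where m: "m < N" "x = w i m" using x by blast
        have "pp_sign u (c i) r x = pp_sign t a r (y m)" if "pp_prod_wf n k r" for r
          by (rule pp_sign_cong[OF that])
            (use m wX y in \<open>simp_all add: u_def c_def tv av ev bv\<close>)
        thus ?thesis using bspec[OF t(2) pq] wf[OF pq] m(1) by simp
      qed
      ultimately have "satisfied (liftings (X i) (G i)) n (set P) (c i) (w i ` {..<N})"
        unfolding satisfied_def by blast
      thus False using w i by blast
    qed
  qed
qed

end
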